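(* Let $\alpha,\beta\in(0,1)$ and $\mu,\lambda_1,\beta_1,\lambda>0$. The tempered space-time fractional negative binomial process $\mathcal{Q}(t)=N_\beta(M_{\alpha,\beta_1,\lambda_1,\mu}(t),\lambda)$, $t\ge0$, exhibits the long-range dependence property: there exists $d\in(0,1)$ such that for every fixed $s>0$ there is $k(s)>0$ with $$\lim_{t\to\infty}\frac{\mathrm{Corr}[\mathcal{Q}(s),\mathcal{Q}(t)]}{t^{-d}}=k(s).$$
   Context: Tempered Mittag-Leffler Lévy process: $M_{\alpha,\beta_1,\lambda_1,\mu}(t):=S_{\alpha,\mu}(G_{\lambda_1,\beta_1}(t))$, $t\ge0$, where $S_{\alpha,\mu}$ and $G_{\lambda_1,\beta_1}$ are independent; $G_{\lambda_1,\beta_1}(t)$ is the gamma subordinator (Lévy process) with density $\frac{\lambda_1^{\beta_1 t}}{\Gamma(\beta_1 t)}x^{\beta_1 t-1}e^{-\lambda_1 x}$, $x>0$; and $S_{\alpha,\mu}(t)$ is the tempered $\alpha$-stable subordinator (Lévy process) with density $e^{-\mu x+\mu^\alpha t}g_\alpha(x,t)$, $x>0$, where $g_\alpha(\cdot,t)$ is the density of the $\alpha$-stable subordinator with Laplace transform $e^{-tu^\alpha}$. Fractional Poisson process (FPP): for $0<\beta<1$, $N_\beta(t,\lambda)=N(\mathcal{E}_\beta(t))$, where $N$ is a Poisson process with rate $\lambda$ and $\mathcal{E}_\beta(t)=\inf\{r\ge 0: D_\beta(r)>t\}$ is an independent inverse stable subordinator, $D_\beta$ being the $\beta$-stable subordinator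 with $\mathbb{E}[e^{-uD_\beta(r)}]=e^{-ru^\beta}$. Tempered space-time fractional negative binomial process (TSTFNBP): $N_\beta(M_{\alpha,\beta_1,\lambda_1,\mu}(t),\lambda)$, $t\ge0$, with $N_\beta$ and $M_{\alpha,\beta_1,\lambda_1,\mu}$ independent. Long-range dependence (LRD): a process $\{X(t)\}_{t\ge0}$ such that, for fixed $s$ with $0<s<t$, $\lim_{t\to\infty}\mathrm{Corr}[X(s),X(t)]/t^{-d}=k(s)$ for some $k(s)>0$ and $d>0$, is said to have the LRD property when $d\in(0,1)$. *)

theory Defs
  imports "HOL-Probability.Probability"
begin

text \<open>A process is a family \<open>X :: real \<Rightarrow> 'a \<Rightarrow> real\<close>; only the times \<open>t \<ge> 0\<close> matter.\<close>

text \<open>All paths (not merely almost all) are required to be right-continuous with left limits and to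
  start at 0, so that random time changes \<open>X (T t \<omega>) \<omega>\<close> are random variables without completing \<open>M\<close>.
  Stochastic continuity follows from right-continuity and stationarity of the increments.\<close>

definition levy_process :: "'a measure \<Rightarrow> (real \<Rightarrow> 'a \<Rightarrow> real) \<Rightarrow> bool" where
  "levy_process M X \<longleftrightarrow>
     (\<forall>t\<ge>0. X t \<in> borel_measurable M) \<and>
     (\<forall>\<omega>\<in>space M. X 0 \<omega> = 0) \<and>
     (\<forall>n (t :: nat \<Rightarrow> real). 0 \<le> t 0 \<and> (\<forall>i<n. t i \<le> t (Suc i)) \<longrightarrow>
        prob_space.indep_vars M (\<lambda>_. borel) (\<lambda>i \<omega>. X (t (Suc i)) \<omega> - X (t i) \<omega>) {..<n}) \<and>
     (\<forall>s\<ge>0. \<forall>h\<ge>0. distr M borel (\<lambda>\<omega>. X (s + h) \<omega> - X s \<omega>) = distr M borel (X h)) \<and>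
     (\<forall>\<omega>\<in>space M. \<forall>t\<ge>0. ((\<lambda>r. X r \<omega>) \<longlongrightarrow> X t \<omega>) (at_right t)) \<and>
     (\<forall>\<omega>\<in>space M. \<forall>t>0. \<exists>l. ((\<lambda>r. X r \<omega>) \<longlongrightarrow> l) (at_left t))"

definition subordinator :: "'a measure \<Rightarrow> (real \<Rightarrow> 'a \<Rightarrow> real) \<Rightarrow> bool" where
  "subordinator M X \<longleftrightarrow> levy_process M X \<and> (\<forall>\<omega>\<in>space M. mono_on {0..} (\<lambda>t. X t \<omega>))"

definition gamma_subordinator ::
    "'a measure \<Rightarrow> real \<Rightarrow> real \<Rightarrow> (real \<Rightarrow> 'a \<Rightarrow> real) \<Rightarrow> bool" where
  "gamma_subordinator M l b G \<longleftrightarrow> subordinator M G \<and>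
     (\<forall>t>0. distributed M lborel (G t)
        (\<lambda>x. ennreal (if x > 0 then l powr (b * t) / Gamma (b * t) * x powr (b * t - 1) * exp (- l * x)
                      else 0)))"

definition stable_subordinator ::
    "'a measure \<Rightarrow> real \<Rightarrow> (real \<Rightarrow> 'a \<Rightarrow> real) \<Rightarrow> bool" where
  "stable_subordinator M b D \<longleftrightarrow> subordinator M D \<and>
     (\<forall>r\<ge>0. \<forall>u\<ge>0. prob_space.expectation M (\<lambda>\<omega>. exp (- u * D r \<omega>)) = exp (- r * u powr b))"

text \<open>\<open>g x t\<close> is the density in \<open>x > 0\<close> of the \<open>a\<close>-stable subordinator at time \<open>t > 0\<close>, given
  (up to null sets) by its Laplace transform; \<open>u = 0\<close> says that it integrates to 1.\<close>

definition stable_density :: "real \<Rightarrow> (real \<Rightarrow> real \<Rightarrow> real) \<Rightarrow> bool" where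
  "stable_density a g \<longleftrightarrow>
     (\<forall>t>0. (\<lambda>x. g x t) \<in> borel_measurable borel \<and> (\<forall>x>0. g x t \<ge> 0) \<and>
        (\<forall>u\<ge>0. (LBINT x:{0<..}. exp (- u * x) * g x t) = exp (- t * u powr a)))"

definition tempered_stable_subordinator ::
    "'a measure \<Rightarrow> real \<Rightarrow> real \<Rightarrow> (real \<Rightarrow> 'a \<Rightarrow> real) \<Rightarrow> bool" where
  "tempered_stable_subordinator M a \<mu> S \<longleftrightarrow> subordinator M S \<and>
     (\<exists>g. stable_density a g \<and>
       (\<forall>t>0. distributed M lborel (S t)
          (\<lambda>x. ennreal (if x > 0 then exp (- \<mu> * x + \<mu> powr a * t) * g x t else 0))))"

definition poisson_process :: "'a measure \<Rightarrow> real \<Rightarrow> (real \<Rightarrow> 'a \<Rightarrow> real) \<Rightarrow> bool" where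
  "poisson_process M l N \<longleftrightarrow> levy_process M N \<and>
     (\<forall>t>0. distr M borel (N t) = distr (measure_pmf (poisson_pmf (l * t))) borel real)"

text \<open>For a stable subordinator the set is nonempty almost surely; the value 0 on the exceptional null
  event replaces the unspecified infimum of the empty set.\<close>

definition inverse_subordinator :: "(real \<Rightarrow> 'a \<Rightarrow> real) \<Rightarrow> real \<Rightarrow> 'a \<Rightarrow> real" where
  "inverse_subordinator D t \<omega> =
     (if \<exists>r\<ge>0. D r \<omega> > t then Inf {r. r \<ge> 0 \<and> D r \<omega> > t} else 0)"

definition time_change ::
    "(real \<Rightarrow> 'a \<Rightarrow> real) \<Rightarrow> (real \<Rightarrow> 'a \<Rightarrow> real) \<Rightarrow> real \<Rightarrow> 'a \<Rightarrow> real" where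
  "time_change X T t \<omega> = X (T t \<omega>) \<omega>"

text \<open>Independence of the \<open>\<sigma>\<close>-algebras generated by the whole processes.\<close>

definition indep_processes ::
    "'a measure \<Rightarrow> (real \<Rightarrow> 'a \<Rightarrow> real) \<Rightarrow> (real \<Rightarrow> 'a \<Rightarrow> real) \<Rightarrow> bool" where
  "indep_processes M X Y \<longleftrightarrow>
     prob_space.indep_var M
       (PiM {0..} (\<lambda>_. borel)) (\<lambda>\<omega>. \<lambda>t\<in>{0..}. X t \<omega>)
       (PiM {0..} (\<lambda>_. borel)) (\<lambda>\<omega>. \<lambda>t\<in>{0..}. Y t \<omega>)"

definition tempered_mittag_leffler_process ::
    "'a measure \<Rightarrow> real \<Rightarrow> real \<Rightarrow> real \<Rightarrow> real \<Rightarrow> (real \<Rightarrow> 'a \<Rightarrow> real) \<Rightarrow> bool" where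
  "tempered_mittag_leffler_process M a b1 l1 \<mu> Y \<longleftrightarrow>
     (\<exists>S G. tempered_stable_subordinator M a \<mu> S \<and> gamma_subordinator M l1 b1 G \<and>
        indep_processes M S G \<and> Y = time_change S G)"

definition fractional_poisson_process ::
    "'a measure \<Rightarrow> real \<Rightarrow> real \<Rightarrow> (real \<Rightarrow> 'a \<Rightarrow> real) \<Rightarrow> bool" where
  "fractional_poisson_process M b l F \<longleftrightarrow>
     (\<exists>N D. poisson_process M l N \<and> stable_subordinator M b D \<and>
        indep_processes M N (inverse_subordinator D) \<and> F = time_change N (inverse_subordinator D))"

text \<open>The tempered space-time fractional negative binomial process.\<close>

definition tstfnbp ::
    "'a measure \<Rightarrow> real \<Rightarrow> real \<Rightarrow> real \<Rightarrow> real \<Rightarrow> real \<Rightarrow> real \<Rightarrow> (real \<Rightarrow> 'a \<Rightarrow> real) \<Rightarrow> bool" where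
  "tstfnbp M a b b1 l1 \<mu> l Q \<longleftrightarrow>
     (\<exists>F Y. fractional_poisson_process M b l F \<and>
        tempered_mittag_leffler_process M a b1 l1 \<mu> Y \<and>
        indep_processes M F Y \<and> Q = time_change F Y)"

definition covariance :: "'a measure \<Rightarrow> ('a \<Rightarrow> real) \<Rightarrow> ('a \<Rightarrow> real) \<Rightarrow> real" where
  "covariance M X Y =
     prob_space.expectation M (\<lambda>\<omega>. (X \<omega> - prob_space.expectation M X) * (Y \<omega> - prob_space.expectation M Y))"

definition correlation :: "'a measure \<Rightarrow> ('a \<Rightarrow> real) \<Rightarrow> ('a \<Rightarrow> real) \<Rightarrow> real" where
  "correlation M X Y =
     covariance M X Y / sqrt (prob_space.variance M X * prob_space.variance M Y)"

definition long_range_dependent :: "'a measure \<Rightarrow> (real \<Rightarrow> 'a \<Rightarrow> real) \<Rightarrow> bool" where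
  "long_range_dependent M X \<longleftrightarrow>
     (\<exists>d. 0 < d \<and> d < 1 \<and>
       (\<forall>s>0. \<exists>k>0. ((\<lambda>t. correlation M (X s) (X t) / t powr (- d)) \<longlongrightarrow> k) at_top))"

end

theory Submission
  imports Defs
begin

text \<open>
  Since \<open>E\<^sub>\<beta>(t)\<close> is the Lebesgue measure of \<open>{r. D\<^sub>\<beta>(r) \<le> t}\<close>,
  its first two moments are integrals against the potential measure of \<open>D\<^sub>\<beta>\<close>, whose Laplace
  transform \<open>u powr - \<beta>\<close> identifies it as \<open>x powr (\<beta> - 1) / Gamma \<beta>\<close>. Conditioning on the
  independent time change, the covariance of \<open>N\<^sub>\<beta>(s)\<close> and \<open>N\<^sub>\<beta>(t)\<close> stays bounded for fixed \<open>s\<close>,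
  while the variance of \<open>N\<^sub>\<beta>(t)\<close> grows like \<open>t powr (2 * \<beta>)\<close>. The Mittag-Leffler clock \<open>Y\<close> has
  independent increments and satisfies \<open>Y(t) / t \<longrightarrow> c\<close> in mean square, so this behaviour survives the
  time change: the covariance of \<open>\<Q>(s)\<close> and \<open>\<Q>(t)\<close> converges to a positive
  limit, the variance of \<open>\<Q>(t)\<close> is asymptotic to a multiple of \<open>t powr (2 * \<beta>)\<close>,
  and the correlation decays like \<open>t powr - \<beta>\<close>.
\<close>

section \<open>Right-continuous processes and independent time changes\<close>

text \<open>For fixed \<open>s\<close> both E[Q(s) Q(t)] and E[Q(s)] E[Q(t)] grow like t^\<beta>, so
  the covariance limit sits below their common leading order, and separate asymptotics of the two
  terms cannot reveal it. The exact two-time moment of the fractional Poisson process contains an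
  incomplete Beta integral; it is bracketed instead by two expressions that differ only in
  \<open>t powr b\<close> against \<open>(t - s) powr b\<close>, a gap that vanishes as t grows
  because b < 1. Once the clock is inserted, the lower bracket contains a power of
  \<open>Y t - Y s\<close>, and the independent clock increments factor it into a product that
  cancels E[Q(s)] E[Q(t)] up to a vanishing term. On the diagonal the Beta integral enters through a
  constant \<kappa>, in closed form Gamma(1+b)^2 / Gamma(1+2b). The leading coefficient of the
  variance is proportional to 2 \<kappa> - 1, so its growth rate rests on \<kappa> > 1/2, which
  degenerates to equality at b = 1. Moments are computed as nonnegative integrals, where Tonelli
  applies directly and integrability comes out as a consequence.\<close>

definition upper_grid :: "nat \<Rightarrow> real \<Rightarrow> real" where
  "upper_grid n a = (of_int \<lfloor>real (Suc n) * max 0 a\<rfloor> + 1) / real (Suc n)"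

lemma upper_grid_nonneg: "upper_grid n a \<ge> 0"
  unfolding upper_grid_def by (auto intro!: divide_nonneg_pos add_nonneg_nonneg)

lemma upper_grid_gt: "a \<ge> 0 \<Longrightarrow> a < upper_grid n a"
  unfolding upper_grid_def by (simp add: field_simps del: of_nat_Suc) linarith

lemma upper_grid_le: "a \<ge> 0 \<Longrightarrow> upper_grid n a \<le> a + 1 / real (Suc n)"
  unfolding upper_grid_def by (simp add: field_simps del: of_nat_Suc)

text \<open>The \<open>+ 1\<close> after rounding down keeps every grid point strictly above
  \<open>a\<close>, as the punctured filter \<open>at_right a\<close> demands. Each
  \<open>upper_grid n\<close> has only countably many values, which is what makes evaluation of a
  path along it measurable.\<close>

lemma filterlim_upper_grid:
  assumes "a \<ge> 0"
  shows "filterlim (\<lambda>n. upper_grid n a) (at_right a) sequentially"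
proof -
  have *: "(\<lambda>n. a + 1 / real (Suc n)) \<longlonglongrightarrow> a + 0"
    by (rule tendsto_add[OF tendsto_const LIMSEQ_Suc[OF lim_1_over_n]])
  have "(\<lambda>n. upper_grid n a) \<longlonglongrightarrow> a"
  proof (rule tendsto_sandwich[OF _ _ tendsto_const[of a]])
    show "\<forall>\<^sub>F n in sequentially. a \<le> upper_grid n a"
      using upper_grid_gt[OF assms] by (intro always_eventually allI less_imp_le)
    show "\<forall>\<^sub>F n in sequentially. upper_grid n a \<le> a + 1 / real (Suc n)"
      using upper_grid_le[OF assms] by (intro always_eventually allI)
    show "(\<lambda>n. a + 1 / real (Suc n)) \<longlonglongrightarrow> a"
      using * by simp
  qed
  then show ?thesis
    using upper_grid_gt[OF assms] by (simp add: filterlim_at less_imp_neq[symmetric])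
qed

text \<open>Countably many coordinates of a path determine its right limits, so this is measurable even on
  the uncountable product on which \<^const>\<open>indep_processes\<close> lives.\<close>

definition path_eval :: "(real \<Rightarrow> 'a \<Rightarrow> real) \<Rightarrow> real \<Rightarrow> 'a \<Rightarrow> real" where
  "path_eval X a x = lim (\<lambda>n. X (upper_grid n a) x)"

lemma path_eval_eq:
  assumes "((\<lambda>r. X r x) \<longlongrightarrow> X a x) (at_right a)" "a \<ge> 0"
  shows "path_eval X a x = X a x"
  unfolding path_eval_def
  by (rule limI, rule filterlim_compose[OF assms(1) filterlim_upper_grid[OF assms(2)]])

text \<open>At a fixed level \<open>n\<close> the grid time is one of countably many deterministic
  times, so evaluation there is a countable gluing of the coordinates \<open>X t\<close>, jointly
  measurable in path and time. The limit in \<open>n\<close> preserves this.\<close>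

lemma measurable_path_eval:
  assumes [measurable]: "\<And>t. t \<ge> 0 \<Longrightarrow> X t \<in> borel_measurable A"
  shows "(\<lambda>(x, a). path_eval X a x) \<in> borel_measurable (A \<Otimes>\<^sub>M borel)"
proof -
  have "(\<lambda>p. X (upper_grid n (snd p)) (fst p)) \<in> borel_measurable (A \<Otimes>\<^sub>M borel)" for n
  proof -
    \<comment> \<open>The index \<open>k\<close> runs through all integers, so
      \<open>max 0 k\<close> keeps the times nonnegative, where the coordinates are known to be
      measurable; on the actual floor it changes nothing.\<close>
    have "(\<lambda>p. (\<lambda>k p. X ((of_int (max 0 k) + 1) / real (Suc n)) (fst p))
            ((\<lambda>p. \<lfloor>real (Suc n) * max 0 (snd p)\<rfloor>) p) p) \<in> borel_measurable (A \<Otimes>\<^sub>M borel)"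
      by (rule measurable_compose_countable) measurable
    also have "(\<lambda>p. (\<lambda>k p. X ((of_int (max 0 k) + 1) / real (Suc n)) (fst p))
            ((\<lambda>p. \<lfloor>real (Suc n) * max 0 (snd p)\<rfloor>) p) p)
        = (\<lambda>p. X (upper_grid n (snd p)) (fst p))"
      by (auto simp: upper_grid_def max_def fun_eq_iff mult_nonneg_nonneg simp del: of_nat_Suc)
    finally show ?thesis .
  qed
  then show ?thesis
    unfolding path_eval_def case_prod_beta by (rule borel_measurable_lim_metric)
qed

lemma measurable_path_eval_compose:
  assumes "\<And>t. t \<ge> 0 \<Longrightarrow> X t \<in> borel_measurable A"
    and [measurable]: "f \<in> measurable N A" "g \<in> borel_measurable N"
  shows "(\<lambda>z. path_eval X (g z) (f z)) \<in> borel_measurable N"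
proof -
  note [measurable] = measurable_path_eval[of X A, OF assms(1)]
  have "(\<lambda>z. (\<lambda>(x, a). path_eval X a x) (f z, g z)) \<in> borel_measurable N"
    by measurable
  then show ?thesis by simp
qed

text \<open>The part of \<open>levy_process\<close> that survives in the fractional Poisson process,
  whose increments are dependent, and on which random time substitution relies.\<close>

definition right_cont_process :: "'a measure \<Rightarrow> (real \<Rightarrow> 'a \<Rightarrow> real) \<Rightarrow> bool" where
  "right_cont_process M X \<longleftrightarrow>
     (\<forall>t\<ge>0. X t \<in> borel_measurable M) \<and>
     (\<forall>\<omega>\<in>space M. \<forall>t\<ge>0. ((\<lambda>r. X r \<omega>) \<longlongrightarrow> X t \<omega>) (at_right t))"

lemma right_cont_processD:
  assumes "right_cont_process M X"
  shows "t \<ge> 0 \<Longrightarrow> X t \<in> borel_measurable M"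
    and "\<omega> \<in> space M \<Longrightarrow> t \<ge> 0 \<Longrightarrow> path_eval X t \<omega> = X t \<omega>"
    and "\<omega> \<in> space M \<Longrightarrow> t \<ge> 0 \<Longrightarrow> ((\<lambda>r. X r \<omega>) \<longlongrightarrow> X t \<omega>) (at_right t)"
  using assms path_eval_eq[of X \<omega> t] by (simp_all add: right_cont_process_def)

lemma levy_process_right_cont: "levy_process M X \<Longrightarrow> right_cont_process M X"
  by (auto simp: levy_process_def right_cont_process_def)

lemma right_cont_process_compose_measurable:
  assumes X: "right_cont_process M X" and [measurable]: "f \<in> measurable N M" "g \<in> borel_measurable N"
    and g0: "\<And>z. z \<in> space N \<Longrightarrow> g z \<ge> 0"
  shows "(\<lambda>z. X (g z) (f z)) \<in> borel_measurable N"
proof -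
  have "(\<lambda>z. path_eval X (g z) (f z)) \<in> borel_measurable N"
    by (intro measurable_path_eval_compose[of X M] right_cont_processD(1)[OF X]) auto
  also have "?this \<longleftrightarrow> ?thesis"
    by (intro measurable_cong right_cont_processD(2)[OF X] g0 measurable_space[OF assms(2)])
  finally show ?thesis .
qed

section \<open>Integrating out an independent time change\<close>

context prob_space
begin

text \<open>Independence turns the joint law into a product. Pulling both marginals back to
  \<open>M\<close> lets a second sample point \<omega>' play the independent copy of
  \<open>Y\<close>, so that no product space remains in later statements.\<close>

lemma nn_integral_indep_var:
  assumes "indep_var S X T Y" and [measurable]: "f \<in> borel_measurable (S \<Otimes>\<^sub>M T)"
  shows "(\<integral>\<^sup>+\<omega>. f (X \<omega>, Y \<omega>) \<partial>M) = (\<integral>\<^sup>+\<omega>'. \<integral>\<^sup>+\<omega>. f (X \<omega>, Y \<omega>') \<partial>M \<partial>M)"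
proof -
  note ind = assms(1)[unfolded indep_var_distribution_eq]
  from ind have [measurable]: "X \<in> measurable M S" "Y \<in> measurable M T" by auto
  interpret X: prob_space "distr M S X" by (rule prob_space_distr) measurable
  interpret Y: prob_space "distr M T Y" by (rule prob_space_distr) measurable
  interpret XY: pair_sigma_finite "distr M S X" "distr M T Y" ..
  have "(\<integral>\<^sup>+\<omega>. f (X \<omega>, Y \<omega>) \<partial>M) = (\<integral>\<^sup>+p. f p \<partial>distr M (S \<Otimes>\<^sub>M T) (\<lambda>x. (X x, Y x)))"
    by (simp add: nn_integral_distr)
  also have "\<dots> = (\<integral>\<^sup>+p. f p \<partial>(distr M S X \<Otimes>\<^sub>M distr M T Y))"
    using ind by simp
  also have "\<dots> = (\<integral>\<^sup>+y. \<integral>\<^sup>+x. f (x, y) \<partial>distr M S X \<partial>distr M T Y)"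
    by (rule XY.nn_integral_snd[symmetric]) measurable
  also have "\<dots> = (\<integral>\<^sup>+\<omega>'. \<integral>\<^sup>+x. f (x, Y \<omega>') \<partial>distr M S X \<partial>M)"
    by (subst nn_integral_distr) measurable
  also have "\<dots> = (\<integral>\<^sup>+\<omega>'. \<integral>\<^sup>+\<omega>. f (X \<omega>, Y \<omega>') \<partial>M \<partial>M)"
    by (intro nn_integral_cong nn_integral_distr) (auto intro: measurable_space)
  finally show ?thesis .
qed

lemma indep_processes_measurable:
  assumes "indep_processes M X T" "t \<ge> 0"
  shows "X t \<in> borel_measurable M" "T t \<in> borel_measurable M"
proof -
  from assms have "(\<lambda>\<omega>. \<lambda>t\<in>{0..}. X t \<omega>) \<in> measurable M (PiM {0..} (\<lambda>_. borel))"
    "(\<lambda>\<omega>. \<lambda>t\<in>{0..}. T t \<omega>) \<in> measurable M (PiM {0..} (\<lambda>_. borel))"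
    unfolding indep_processes_def indep_var_distribution_eq by auto
  from this[THEN measurable_compose, OF measurable_component_singleton[of t "{0..}" "\<lambda>_. borel"]]
  show "X t \<in> borel_measurable M" "T t \<in> borel_measurable M"
    using assms(2) by simp_all
qed

text \<open>\<open>indep_processes\<close> only sees the coordinates of the two paths, so evaluation
  at a random time must first be exhibited as a measurable functional of the pair of paths. After
  that the claim is Tonelli, with the clock frozen at \<omega>' in the outer integral.\<close>

lemma time_change_decoupling:
  assumes ind: "indep_processes M X T" and X: "right_cont_process M X"
    and T0: "\<And>r \<omega>. r \<ge> 0 \<Longrightarrow> \<omega> \<in> space M \<Longrightarrow> T r \<omega> \<ge> 0" and st: "s \<ge> 0" "t \<ge> 0"
    and [measurable]: "h \<in> borel_measurable (borel \<Otimes>\<^sub>M borel)"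
  shows "(\<integral>\<^sup>+\<omega>. h (time_change X T s \<omega>, time_change X T t \<omega>) \<partial>M)
       = (\<integral>\<^sup>+\<omega>'. \<integral>\<^sup>+\<omega>. h (X (T s \<omega>') \<omega>, X (T t \<omega>') \<omega>) \<partial>M \<partial>M)"
proof -
  let ?P = "PiM {0..} (\<lambda>_. borel) :: (real \<Rightarrow> real) measure"
  let ?X = "\<lambda>\<omega>. \<lambda>t\<in>{0..}. X t \<omega>" and ?T = "\<lambda>\<omega>. \<lambda>t\<in>{0..}. T t \<omega>"
  \<comment> \<open>\<open>ev\<close> reads only the first path of the pair but takes the whole pair
    as argument, so that the time can be read from the second path of the same point, as in
    \<open>ev (snd p s) p\<close>.\<close>
  define ev where "ev a p = path_eval (\<lambda>t (x, y). x t) a p" for a and p :: "(real \<Rightarrow> real) \<times> (real \<Rightarrow> real)"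
  have ev_meas: "(\<lambda>p. ev (snd p r) p) \<in> borel_measurable (?P \<Otimes>\<^sub>M ?P)" if "r \<ge> 0" for r
    unfolding ev_def case_prod_beta using that
    by (intro measurable_path_eval_compose[of _ "?P \<Otimes>\<^sub>M ?P"])
       (auto intro!: measurable_compose[OF measurable_fst measurable_component_singleton] measurable_compose[OF measurable_snd measurable_component_singleton])
  have ev_eq: "ev a (?X \<omega>, y) = X a \<omega>" if "a \<ge> 0" "\<omega> \<in> space M" for a y \<omega>
  proof -
    have "ev a (?X \<omega>, y) = path_eval X a \<omega>"
      unfolding ev_def path_eval_def by (simp add: upper_grid_nonneg)
    then show ?thesis using right_cont_processD(2)[OF X that(2,1)] by simp
  qed
  define f where "f p = h (ev (snd p s) p, ev (snd p t) p)" for p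
  have f: "f \<in> borel_measurable (?P \<Otimes>\<^sub>M ?P)"
    unfolding f_def using ev_meas[OF st(1)] ev_meas[OF st(2)] by measurable
  have "(\<integral>\<^sup>+\<omega>. f (?X \<omega>, ?T \<omega>) \<partial>M) = (\<integral>\<^sup>+\<omega>'. \<integral>\<^sup>+\<omega>. f (?X \<omega>, ?T \<omega>') \<partial>M \<partial>M)"
    using ind f unfolding indep_processes_def by (rule nn_integral_indep_var)
  moreover have "f (?X \<omega>, ?T \<omega>') = h (X (T s \<omega>') \<omega>, X (T t \<omega>') \<omega>)"
    if "\<omega> \<in> space M" "\<omega>' \<in> space M" for \<omega> \<omega>'
    using that st T0 unfolding f_def by (simp add: ev_eq)
  ultimately show ?thesis
    unfolding time_change_def by (simp cong: nn_integral_cong_simp)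
qed

lemma time_change_right_cont_measurable:
  assumes ind: "indep_processes M X T" and X: "right_cont_process M X"
    and T0: "\<And>r \<omega>. r \<ge> 0 \<Longrightarrow> \<omega> \<in> space M \<Longrightarrow> T r \<omega> \<ge> 0" and "t \<ge> 0"
  shows "time_change X T t \<in> borel_measurable M"
proof -
  have "(\<lambda>\<omega>. X (T t \<omega>) \<omega>) \<in> borel_measurable M"
    using assms by (intro right_cont_process_compose_measurable[OF X] indep_processes_measurable[OF ind]) auto
  then show ?thesis by (simp add: time_change_def[abs_def])
qed

lemma time_change_decoupling1:
  assumes "indep_processes M X T" "right_cont_process M X"
    "\<And>r \<omega>. r \<ge> 0 \<Longrightarrow> \<omega> \<in> space M \<Longrightarrow> T r \<omega> \<ge> 0" "t \<ge> 0"
    and [measurable]: "h \<in> borel_measurable borel"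
  shows "(\<integral>\<^sup>+\<omega>. h (time_change X T t \<omega>) \<partial>M) = (\<integral>\<^sup>+\<omega>'. \<integral>\<^sup>+\<omega>. h (X (T t \<omega>') \<omega>) \<partial>M \<partial>M)"
proof -
  have "(\<lambda>p. h (fst p)) \<in> borel_measurable (borel \<Otimes>\<^sub>M (borel :: real measure))"
    by measurable
  from time_change_decoupling[OF assms(1-3) assms(4) assms(4) this] show ?thesis
    by (simp only: fst_conv)
qed

text \<open>The exceptional null set may differ for each of uncountably many fixed times, so no
  union bound is available. Decoupling the indicator of the exceptional event averages these null
  sets over the clock instead.\<close>

lemma time_change_AE:
  assumes "indep_processes M X T" "right_cont_process M X"
    "\<And>r \<omega>. r \<ge> 0 \<Longrightarrow> \<omega> \<in> space M \<Longrightarrow> T r \<omega> \<ge> 0" "t \<ge> 0"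
    and [measurable]: "Measurable.pred borel P"
    and T: "AE \<omega>' in M. AE \<omega> in M. P (X (T t \<omega>') \<omega>)"
  shows "AE \<omega> in M. P (time_change X T t \<omega>)"
proof -
  let ?h = "\<lambda>x. indicator {x. \<not> P x} x :: ennreal"
  note m[measurable] = time_change_right_cont_measurable[OF assms(1-4)]
  have X_meas[measurable]: "X (T t \<omega>') \<in> borel_measurable M" if "\<omega>' \<in> space M" for \<omega>'
    using right_cont_processD(1)[OF assms(2)] assms(3,4) that by auto
  have "(\<integral>\<^sup>+\<omega>. ?h (time_change X T t \<omega>) \<partial>M) = (\<integral>\<^sup>+\<omega>'. \<integral>\<^sup>+\<omega>. ?h (X (T t \<omega>') \<omega>) \<partial>M \<partial>M)"
    by (rule time_change_decoupling1[OF assms(1-4)]) measurable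
  also have "\<dots> = (\<integral>\<^sup>+\<omega>'. 0 \<partial>M)"
  proof (rule nn_integral_cong_AE)
    show "AE \<omega>' in M. (\<integral>\<^sup>+\<omega>. ?h (X (T t \<omega>') \<omega>) \<partial>M) = 0"
      using T AE_space
    proof eventually_elim
      case (elim \<omega>')
      have "(\<integral>\<^sup>+\<omega>. ?h (X (T t \<omega>') \<omega>) \<partial>M) = (\<integral>\<^sup>+\<omega>. 0 \<partial>M)"
        using elim(1) by (intro nn_integral_cong_AE) (auto simp: indicator_def)
      then show ?case by simp
    qed
  qed
  finally have "(\<integral>\<^sup>+\<omega>. ?h (time_change X T t \<omega>) \<partial>M) = 0"
    by simp
  moreover have "(\<lambda>\<omega>. ?h (time_change X T t \<omega>)) \<in> borel_measurable M"
    by (rule measurable_compose[OF m]) measurable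
  ultimately have "AE \<omega> in M. ?h (time_change X T t \<omega>) = 0"
    by (simp add: nn_integral_0_iff_AE)
  then show ?thesis by (rule AE_mp) (auto simp: indicator_def split: if_splits)
qed

end

section \<open>Moments and growth of subordinators\<close>

text \<open>Nonnegativity makes a solution of Cauchy's equation monotone. Comparing
  \<open>real n * t\<close> with its neighbouring integers then gives \<bar>f t - f 1 * t\<bar> * n
  \<le> f 1 for every positive \<open>n\<close>, which forces the difference to vanish.\<close>

lemma additive_nonneg_imp_linear:
  fixes f :: "real \<Rightarrow> real"
  assumes add: "\<And>s t. s \<ge> 0 \<Longrightarrow> t \<ge> 0 \<Longrightarrow> f (s + t) = f s + f t"
    and nonneg: "\<And>t. t \<ge> 0 \<Longrightarrow> f t \<ge> 0" and t: "t \<ge> 0"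
  shows "f t = f 1 * t"
proof -
  have f0: "f 0 = 0" using add[of 0 0] by simp
  have mult: "f (real n * s) = real n * f s" if "s \<ge> 0" for n s
  proof (induction n)
    case (Suc n)
    have "f (real (Suc n) * s) = f (real n * s + s)" by (simp add: algebra_simps)
    also have "\<dots> = f (real n * s) + f s" using that by (intro add) auto
    finally show ?case using Suc by (simp add: algebra_simps)
  qed (simp add: f0)
  have mono: "f a \<le> f b" if "0 \<le> a" "a \<le> b" for a b
    using add[of a "b - a"] nonneg[of "b - a"] that by simp
  have bound: "\<bar>f t - f 1 * t\<bar> * real n \<le> f 1" if "n > 0" for n :: nat
  proof -
    define k where "k = nat \<lfloor>real n * t\<rfloor>"
    have k: "real k \<le> real n * t" "real n * t \<le> real (Suc k)"
      unfolding k_def using t by (auto simp: of_nat_nat) linarith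
    have "f (real k) \<le> f (real n * t)" "f (real n * t) \<le> f (real (Suc k))"
      by (intro mono; use k t in simp)+
    then have "real k * f 1 \<le> real n * f t" "real n * f t \<le> (real k + 1) * f 1"
      using mult[of 1 k] mult[of 1 "Suc k"] mult[of t n] t by (simp_all add: algebra_simps)
    moreover have "real k * f 1 \<le> (real n * t) * f 1" "(real n * t) * f 1 \<le> (real k + 1) * f 1"
      using k nonneg[of 1] by (auto intro!: mult_right_mono)
    ultimately have "\<bar>(f t - f 1 * t) * real n\<bar> \<le> f 1"
      by (simp add: abs_le_iff algebra_simps)
    then show ?thesis by (simp add: abs_mult)
  qed
  have "\<bar>f t - f 1 * t\<bar> \<le> 0"
  proof (rule ccontr)
    assume "\<not> ?thesis"
    then have pos: "\<bar>f t - f 1 * t\<bar> > 0" by simp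
    obtain n :: nat where "f 1 / \<bar>f t - f 1 * t\<bar> < real n" using reals_Archimedean2 by blast
    then have *: "f 1 < \<bar>f t - f 1 * t\<bar> * real n" using pos by (simp add: divide_less_eq mult.commute)
    then have "n > 0" using nonneg[of 1] by (cases n) auto
    with bound[OF this] * show False by simp
  qed
  then show ?thesis by simp
qed

lemma subordinatorD:
  assumes "subordinator M X"
  shows "levy_process M X" "right_cont_process M X"
    and "\<omega> \<in> space M \<Longrightarrow> 0 \<le> s \<Longrightarrow> s \<le> t \<Longrightarrow> X s \<omega> \<le> X t \<omega>"
    and "\<omega> \<in> space M \<Longrightarrow> 0 \<le> t \<Longrightarrow> 0 \<le> X t \<omega>"
    and "\<omega> \<in> space M \<Longrightarrow> X 0 \<omega> = 0"
proof -
  show levy: "levy_process M X" and "right_cont_process M X"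
    using assms levy_process_right_cont by (auto simp: subordinator_def)
  show mono: "X s \<omega> \<le> X t \<omega>" if "\<omega> \<in> space M" "0 \<le> s" "s \<le> t" for \<omega> s t
    using assms that by (auto simp: subordinator_def mono_on_def)
  show zero: "X 0 \<omega> = 0" if "\<omega> \<in> space M" for \<omega>
    using levy that by (simp add: levy_process_def)
  show "0 \<le> X t \<omega>" if "\<omega> \<in> space M" "0 \<le> t"
    using mono[OF that(1) order_refl that(2)] zero[OF that(1)] by simp
qed

section \<open>Increments of Levy processes as independent copies\<close>

context prob_space
begin

lemma levy_process_measurable: "levy_process M X \<Longrightarrow> t \<ge> 0 \<Longrightarrow> X t \<in> borel_measurable M"
  by (auto simp: levy_process_def)

lemma levy_process_indep_var:
  assumes X: "levy_process M X" and ab: "0 \<le> a" "a \<le> b"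
  shows "indep_var borel (X a) borel (\<lambda>\<omega>. X b \<omega> - X a \<omega>)"
proof -
  \<comment> \<open>The partition 0, a, b: paths start at 0, so its first increment is
    \<open>X a\<close> itself.\<close>
  define t :: "nat \<Rightarrow> real" where "t i = (if i = 0 then 0 else if i = 1 then a else b)" for i
  let ?D = "\<lambda>i \<omega>. X (t (Suc i)) \<omega> - X (t i) \<omega>"
  have ind: "indep_vars (\<lambda>_. borel) ?D {..<2}"
  proof -
    have "0 \<le> t 0 \<and> (\<forall>i<2. t i \<le> t (Suc i))"
      using ab by (auto simp: t_def)
    with X show ?thesis unfolding levy_process_def by blast
  qed
  have "indep_var borel ((\<lambda>f. f 0) \<circ> (\<lambda>\<omega>. \<lambda>i\<in>{0}. ?D i \<omega>)) borel ((\<lambda>f. f 1) \<circ> (\<lambda>\<omega>. \<lambda>i\<in>{1}. ?D i \<omega>))"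
    by (rule indep_var_compose[OF indep_var_restrict[OF ind, of "{0}" "{1}"]])
       (auto intro!: measurable_component_singleton)
  then have ind: "indep_var borel (\<lambda>\<omega>. X a \<omega> - X 0 \<omega>) borel (\<lambda>\<omega>. X b \<omega> - X a \<omega>)"
    by (simp add: comp_def t_def)
  have Xa[measurable]: "X a \<in> borel_measurable M" using levy_process_measurable[OF X] ab by simp
  have eq: "X a \<omega> - X 0 \<omega> = X a \<omega>" if "\<omega> \<in> space M" for \<omega>
    using X that by (simp add: levy_process_def)
  \<comment> \<open>\<open>X 0\<close> vanishes on \<open>space M\<close> only, so
    \<open>X a - X 0\<close> and \<open>X a\<close> need not be equal as functions; their laws are
    equal, and independence is a statement about laws.\<close>
  have "distr M borel (\<lambda>\<omega>. X a \<omega> - X 0 \<omega>) = distr M borel (X a)"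
    "distr M (borel \<Otimes>\<^sub>M borel) (\<lambda>\<omega>. (X a \<omega> - X 0 \<omega>, X b \<omega> - X a \<omega>))
      = distr M (borel \<Otimes>\<^sub>M borel) (\<lambda>\<omega>. (X a \<omega>, X b \<omega> - X a \<omega>))"
    by (intro distr_cong; simp add: eq)+
  with ind show ?thesis
    unfolding indep_var_distribution_eq by simp
qed

lemma levy_process_increment_distr:
  assumes X: "levy_process M X" and ab: "0 \<le> a" "a \<le> b"
  shows "distr M borel (\<lambda>\<omega>. X b \<omega> - X a \<omega>) = distr M borel (X (b - a))"
proof -
  have "\<forall>s\<ge>0. \<forall>h\<ge>0. distr M borel (\<lambda>\<omega>. X (s + h) \<omega> - X s \<omega>) = distr M borel (X h)"
    using X by (simp add: levy_process_def)
  from this[rule_format, of a "b - a"] ab show ?thesis by simp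
qed

lemma levy_process_increment_nn_integral:
  assumes X: "levy_process M X" and ab: "0 \<le> a" "a \<le> b" and [measurable]: "f \<in> borel_measurable borel"
  shows "(\<integral>\<^sup>+\<omega>. f (X b \<omega> - X a \<omega>) \<partial>M) = (\<integral>\<^sup>+\<omega>. f (X (b - a) \<omega>) \<partial>M)"
proof -
  note [measurable] = levy_process_measurable[OF X]
  have "(\<integral>\<^sup>+\<omega>. f (X b \<omega> - X a \<omega>) \<partial>M) = (\<integral>\<^sup>+x. f x \<partial>distr M borel (\<lambda>\<omega>. X b \<omega> - X a \<omega>))"
    using ab by (subst nn_integral_distr) auto
  also have "\<dots> = (\<integral>\<^sup>+x. f x \<partial>distr M borel (X (b - a)))"
    by (simp only: levy_process_increment_distr[OF X ab])
  also have "\<dots> = (\<integral>\<^sup>+\<omega>. f (X (b - a) \<omega>) \<partial>M)"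
    using ab by (subst nn_integral_distr) auto
  finally show ?thesis .
qed

lemma levy_process_nn_integral:
  assumes X: "levy_process M X" and ab: "0 \<le> a" "a \<le> b"
    and [measurable]: "h \<in> borel_measurable (borel \<Otimes>\<^sub>M borel)"
  shows "(\<integral>\<^sup>+\<omega>. h (X a \<omega>, X b \<omega> - X a \<omega>) \<partial>M) = (\<integral>\<^sup>+\<omega>'. \<integral>\<^sup>+\<omega>. h (X a \<omega>, X (b - a) \<omega>') \<partial>M \<partial>M)"
proof -
  have [measurable]: "X a \<in> borel_measurable M" using levy_process_measurable[OF X] ab by simp
  have "(\<integral>\<^sup>+\<omega>. h (X a \<omega>, X b \<omega> - X a \<omega>) \<partial>M)
      = (\<integral>\<^sup>+\<omega>'. \<integral>\<^sup>+\<omega>. h (X a \<omega>, X b \<omega>' - X a \<omega>') \<partial>M \<partial>M)"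
    by (rule nn_integral_indep_var[OF levy_process_indep_var[OF X ab]]) measurable
  also have "\<dots> = (\<integral>\<^sup>+\<omega>'. \<integral>\<^sup>+\<omega>. h (X a \<omega>, X (b - a) \<omega>') \<partial>M \<partial>M)"
  proof (rule levy_process_increment_nn_integral[OF X ab])
    show "(\<lambda>y. \<integral>\<^sup>+\<omega>. h (X a \<omega>, y) \<partial>M) \<in> borel_measurable borel"
      by measurable
  qed
  finally show ?thesis .
qed

lemma levy_process_nn_integral_mult:
  assumes X: "levy_process M X" and ab: "0 \<le> a" "a \<le> b"
    and [measurable]: "f \<in> borel_measurable borel" "g \<in> borel_measurable borel"
  shows "(\<integral>\<^sup>+\<omega>. f (X a \<omega>) * g (X b \<omega> - X a \<omega>) \<partial>M)
       = (\<integral>\<^sup>+\<omega>. f (X a \<omega>) \<partial>M) * (\<integral>\<^sup>+\<omega>. g (X (b - a) \<omega>) \<partial>M)"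
proof -
  have [measurable]: "X a \<in> borel_measurable M" "X (b - a) \<in> borel_measurable M"
    using levy_process_measurable[OF X] ab by simp_all
  have "(\<lambda>p. f (fst p) * g (snd p)) \<in> borel_measurable (borel \<Otimes>\<^sub>M borel)" by measurable
  from levy_process_nn_integral[OF X ab this] show ?thesis
    by (simp add: nn_integral_multc nn_integral_cmult)
qed

text \<open>With p = E[exp(- X 1)] < 1, independent stationary increments give E[exp(- X n)] = p^n.
  The infimum over \<open>n\<close> of \<open>exp (- X n)\<close> therefore has integral 0 and
  vanishes almost surely, so the path is unbounded along the integers; monotonicity turns this into
  divergence along all real times.\<close>

lemma subordinator_tendsto_infinity:
  assumes X: "subordinator M X" and nz: "\<not> (AE \<omega> in M. X 1 \<omega> = 0)"
  shows "AE \<omega> in M. filterlim (\<lambda>t. X t \<omega>) at_top at_top"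
proof -
  note XD = subordinatorD[OF X]
  have X_meas[measurable]: "X t \<in> borel_measurable M" if "t \<ge> 0" for t
    using levy_process_measurable[OF XD(1) that] .
  have X_n[measurable]: "X (real n) \<in> borel_measurable M" for n
    by (rule X_meas) simp
  define p where "p = (\<integral>\<^sup>+\<omega>. ennreal (exp (- X 1 \<omega>)) \<partial>M)"
  have int: "integrable M (\<lambda>\<omega>. exp (- X 1 \<omega>))"
    by (rule integrable_const_bound[where B=1]) (use XD(4) X_meas[of 1] in \<open>auto intro!: AE_I2\<close>)
  have p_eq: "p = ennreal (expectation (\<lambda>\<omega>. exp (- X 1 \<omega>)))"
    unfolding p_def by (rule nn_integral_eq_integral[OF int]) simp
  have p1: "p < 1"
  proof -
    have "expectation (\<lambda>\<omega>. exp (- X 1 \<omega>)) \<le> 1"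
      using int XD(4) by (intro integral_le_const) (auto intro!: AE_I2)
    moreover have "expectation (\<lambda>\<omega>. exp (- X 1 \<omega>)) \<noteq> 1"
    proof
      assume "expectation (\<lambda>\<omega>. exp (- X 1 \<omega>)) = 1"
      then have "expectation (\<lambda>\<omega>. 1 - exp (- X 1 \<omega>)) = 0"
        using int by (simp add: prob_space)
      moreover have "AE \<omega> in M. 0 \<le> 1 - exp (- X 1 \<omega>)"
        using XD(4) by (auto intro!: AE_I2)
      ultimately have "AE \<omega> in M. 1 - exp (- X 1 \<omega>) = 0"
        using int by (subst (asm) integral_nonneg_eq_0_iff_AE) auto
      then have "AE \<omega> in M. X 1 \<omega> = 0" by eventually_elim simp
      with nz show False ..
    qed
    ultimately show ?thesis unfolding p_eq by (simp add: ennreal_less_one_iff)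
  qed
  have pow: "(\<integral>\<^sup>+\<omega>. ennreal (exp (- X (real n) \<omega>)) \<partial>M) = p ^ n" for n
  proof (induction n)
    case 0
    have "(\<integral>\<^sup>+\<omega>. ennreal (exp (- X (real 0) \<omega>)) \<partial>M) = (\<integral>\<^sup>+\<omega>. 1 \<partial>M)"
      by (intro nn_integral_cong) (simp add: XD(5))
    then show ?case by (simp add: emeasure_space_1)
  next
    case (Suc n)
    have "(\<integral>\<^sup>+\<omega>. ennreal (exp (- X (real (Suc n)) \<omega>)) \<partial>M)
        = (\<integral>\<^sup>+\<omega>. ennreal (exp (- X (real n) \<omega>)) * ennreal (exp (- (X (real (Suc n)) \<omega> - X (real n) \<omega>))) \<partial>M)"
      by (intro nn_integral_cong) (simp add: ennreal_mult[symmetric] exp_add[symmetric])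
    also have "\<dots> = (\<integral>\<^sup>+\<omega>. ennreal (exp (- X (real n) \<omega>)) \<partial>M) *
        (\<integral>\<^sup>+\<omega>. ennreal (exp (- X (real (Suc n) - real n) \<omega>)) \<partial>M)"
      by (rule levy_process_nn_integral_mult[OF XD(1), of "real n" "real (Suc n)"
             "\<lambda>x. ennreal (exp (- x))" "\<lambda>x. ennreal (exp (- x))"]) auto
    finally show ?case by (simp add: Suc p_def mult.commute)
  qed
  have "(\<integral>\<^sup>+\<omega>. (INF n. ennreal (exp (- X (real n) \<omega>))) \<partial>M) \<le> p ^ n" for n
    unfolding pow[symmetric] by (intro nn_integral_mono INF_lower) simp
  moreover have "(\<lambda>n. p ^ n) \<longlonglongrightarrow> 0"
  proof -
    have "norm (expectation (\<lambda>\<omega>. exp (- X 1 \<omega>))) < 1"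
      using p1 unfolding p_eq by (simp add: ennreal_less_one_iff)
    then have "(\<lambda>n. expectation (\<lambda>\<omega>. exp (- X 1 \<omega>)) ^ n) \<longlonglongrightarrow> 0"
      by (rule LIMSEQ_power_zero)
    then have "(\<lambda>n. ennreal (expectation (\<lambda>\<omega>. exp (- X 1 \<omega>)) ^ n)) \<longlonglongrightarrow> ennreal 0"
      by (rule tendsto_ennrealI)
    then show ?thesis by (simp add: p_eq ennreal_power)
  qed
  ultimately have "(\<integral>\<^sup>+\<omega>. (INF n. ennreal (exp (- X (real n) \<omega>))) \<partial>M) \<le> 0"
    by (intro LIMSEQ_le_const[of "\<lambda>n. p ^ n"]) auto
  then have "(\<integral>\<^sup>+\<omega>. (INF n. ennreal (exp (- X (real n) \<omega>))) \<partial>M) = 0" by simp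
  then have "AE \<omega> in M. (INF n. ennreal (exp (- X (real n) \<omega>))) = 0"
    by (subst (asm) nn_integral_0_iff_AE) auto
  then show ?thesis
    using AE_space
  proof eventually_elim
    case (elim \<omega>)
    show ?case
    proof (rule filterlim_at_top[THEN iffD2], rule allI)
      fix K :: real
      have "(INF n. ennreal (exp (- X (real n) \<omega>))) < ennreal (exp (- K))"
        using elim by simp
      then obtain n where "ennreal (exp (- X (real n) \<omega>)) < ennreal (exp (- K))"
        unfolding INF_less_iff by blast
      then have "K < X (real n) \<omega>" by (simp add: ennreal_less_iff)
      then have "K \<le> X t \<omega>" if "t \<ge> real n" for t
        using XD(3)[OF elim(2), of "real n" t] that by simp
      then show "\<forall>\<^sub>F t in at_top. K \<le> X t \<omega>"
        by (auto simp: eventually_at_top_linorder)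
    qed
  qed
qed

section \<open>Linear growth of mean and variance\<close>

lemma square_integrable_imp_integrable:
  fixes f :: "'a \<Rightarrow> real"
  assumes [measurable]: "f \<in> borel_measurable M" and "integrable M (\<lambda>x. (f x)\<^sup>2)"
  shows "integrable M f"
proof (rule Bochner_Integration.integrable_bound)
  show "integrable M (\<lambda>x. 1 + (f x)\<^sup>2)" using assms by simp
  show "AE x in M. norm (f x) \<le> norm (1 + (f x)\<^sup>2)"
  proof (rule AE_I2)
    fix x
    have "\<bar>f x\<bar> \<le> 1 + \<bar>f x\<bar>\<^sup>2"
      using sum_squares_bound[of 1 "\<bar>f x\<bar>"] by auto
    then show "norm (f x) \<le> norm (1 + (f x)\<^sup>2)" by simp
  qed
qed measurable

text \<open>Mean and variance are additive in time by independence and stationarity of the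
  increments, and nonnegative, hence linear; \<open>m\<close> and \<open>v\<close> are their values
  at time 1. Strict positivity of \<open>m\<close> holds because a nonnegative variable with mean 0
  vanishes almost surely.\<close>

lemma subordinator_moments:
  assumes X: "subordinator M X" and sq: "\<And>t. t \<ge> 0 \<Longrightarrow> integrable M (\<lambda>\<omega>. (X t \<omega>)\<^sup>2)"
    and nz: "\<not> (AE \<omega> in M. X 1 \<omega> = 0)"
  obtains m v where "m > 0" "v \<ge> 0"
    "\<And>t. t \<ge> 0 \<Longrightarrow> expectation (X t) = m * t"
    "\<And>t. t \<ge> 0 \<Longrightarrow> expectation (\<lambda>\<omega>. (X t \<omega>)\<^sup>2) = (m * t)\<^sup>2 + v * t"
proof -
  note XD = subordinatorD[OF X]
  have meas: "X t \<in> borel_measurable M" if "t \<ge> 0" for t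
    using levy_process_measurable[OF XD(1) that] .
  have int: "integrable M (X t)" if "t \<ge> 0" for t
    using square_integrable_imp_integrable[OF meas[OF that] sq[OF that]] .
  define f g where "f t = expectation (X t)" and "g t = expectation (\<lambda>\<omega>. (X t \<omega>)\<^sup>2) - (f t)\<^sup>2" for t
  have f_nonneg: "f t \<ge> 0" if "t \<ge> 0" for t
    unfolding f_def using XD(4) that by (intro integral_nonneg_AE AE_I2) auto
  have g_nonneg: "g t \<ge> 0" if "t \<ge> 0" for t
    unfolding g_def f_def using variance_positive[of "X t"] variance_eq[OF int[OF that] sq[OF that]] by simp
  have fg_add: "f (s + t) = f s + f t \<and> g (s + t) = g s + g t" if st: "s \<ge> 0" "t \<ge> 0" for s t
  proof -
    let ?D = "\<lambda>\<omega>. X (s + t) \<omega> - X s \<omega>"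
    have [measurable]: "X (s + t) \<in> borel_measurable M" "X s \<in> borel_measurable M" "X t \<in> borel_measurable M"
      using st by (auto intro!: meas)
    have distr: "distr M borel ?D = distr M borel (X t)"
      using levy_process_increment_distr[OF XD(1), of s "s + t"] st by simp
    have D: "expectation (\<lambda>\<omega>. h (?D \<omega>)) = expectation (\<lambda>\<omega>. h (X t \<omega>))"
      if [measurable]: "h \<in> borel_measurable borel" for h :: "real \<Rightarrow> real"
    proof -
      have "expectation (\<lambda>\<omega>. h (?D \<omega>)) = integral\<^sup>L (distr M borel ?D) h"
        by (subst integral_distr) auto
      also have "\<dots> = expectation (\<lambda>\<omega>. h (X t \<omega>))"
        unfolding distr by (subst integral_distr) auto
      finally show ?thesis .
    qed
    have intD: "integrable M (\<lambda>\<omega>. (?D \<omega>)\<^sup>2)"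
    proof -
      have "integrable (distr M borel ?D) (\<lambda>x. x\<^sup>2)"
        unfolding distr using sq[OF st(2)] by (subst integrable_distr_eq) auto
      then show ?thesis by (subst (asm) integrable_distr_eq) auto
    qed
    have ind: "indep_var borel (X s) borel ?D"
      using levy_process_indep_var[OF XD(1), of s "s + t"] st by simp
    have intst: "integrable M (X s)" "integrable M ?D" "integrable M (X (s + t))"
      using int st by auto
    have f: "f (s + t) = f s + f t"
      using D[of "\<lambda>x. x"] intst unfolding f_def by simp
    have prod: "integrable M (\<lambda>\<omega>. X s \<omega> * ?D \<omega>)" "expectation (\<lambda>\<omega>. X s \<omega> * ?D \<omega>) = f s * f t"
      using indep_var_integrable[OF ind intst(1,2)] indep_var_lebesgue_integral[OF ind intst(1,2)]
        D[of "\<lambda>x. x"] by (auto simp: f_def)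
    have "expectation (\<lambda>\<omega>. (X (s + t) \<omega>)\<^sup>2)
        = expectation (\<lambda>\<omega>. (X s \<omega>)\<^sup>2 + 2 * (X s \<omega> * ?D \<omega>) + (?D \<omega>)\<^sup>2)"
      by (intro Bochner_Integration.integral_cong) (auto simp: power2_eq_square algebra_simps)
    also have "\<dots> = expectation (\<lambda>\<omega>. (X s \<omega>)\<^sup>2) + 2 * (f s * f t) + expectation (\<lambda>\<omega>. (X t \<omega>)\<^sup>2)"
      using sq[OF st(1)] intD prod D[of "\<lambda>x. x\<^sup>2"] by simp
    finally show ?thesis using f unfolding g_def by (simp add: power2_eq_square algebra_simps)
  qed
  have f_lin: "f t = f 1 * t" and g_lin: "g t = g 1 * t" if "t \<ge> 0" for t
    using additive_nonneg_imp_linear[of f t] additive_nonneg_imp_linear[of g t]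
      fg_add f_nonneg g_nonneg that by auto
  have "f 1 \<noteq> 0"
  proof
    assume "f 1 = 0"
    then have "AE \<omega> in M. X 1 \<omega> = 0"
      using int[of 1] XD(4)[of _ 1] unfolding f_def
      by (subst (asm) integral_nonneg_eq_0_iff_AE) (auto intro!: AE_I2)
    with nz show False ..
  qed
  show thesis
  proof
    show "f 1 > 0" using \<open>f 1 \<noteq> 0\<close> f_nonneg[of 1] by simp
    show "g 1 \<ge> 0" using g_nonneg[of 1] by simp
    fix t :: real assume t: "t \<ge> 0"
    show "expectation (X t) = f 1 * t" using f_lin[OF t] by (simp add: f_def)
    show "expectation (\<lambda>\<omega>. (X t \<omega>)\<^sup>2) = (f 1 * t)\<^sup>2 + g 1 * t"
      using g_lin[OF t] f_lin[OF t] by (simp add: g_def)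
  qed
qed

text \<open>Supplies the nondegeneracy demanded by \<open>subordinator_moments\<close> and
  \<open>subordinator_tendsto_infinity\<close>: a density carried by the positive half-line makes
  the variable positive almost surely.\<close>

lemma distributed_pos_imp_not_AE_0:
  fixes X :: "'a \<Rightarrow> real"
  assumes X: "distributed M lborel X (\<lambda>x. ennreal (if x > 0 then f x else 0))"
  shows "\<not> (AE \<omega> in M. X \<omega> = 0)"
proof
  assume "AE \<omega> in M. X \<omega> = 0"
  moreover have "AE \<omega> in M. X \<omega> > 0"
    by (subst distributed_AE2[OF X, of "\<lambda>x. x > 0"]) (auto intro!: AE_I2)
  ultimately have "AE \<omega> in M. False" by eventually_elim simp
  then show False by simp
qed

end

section \<open>Laplace uniqueness and the potential measure of the stable subordinator\<close>

lemma nn_integral_gamma_kernel: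
  fixes s u :: real
  assumes s: "s > 0" and u: "u > 0"
  shows "(\<integral>\<^sup>+x. ennreal (if x > 0 then x powr (s - 1) * exp (- u * x) else 0) \<partial>lborel)
       = ennreal (Gamma s / u powr s)"
proof -
  let ?f = "\<lambda>x. ennreal (if x > 0 then x powr (s - 1) * exp (- u * x) else 0)"
  have "(\<integral>\<^sup>+x. ?f x \<partial>lborel) = \<bar>1 / u\<bar> * (\<integral>\<^sup>+x. ?f (0 + (1 / u) * x) \<partial>lborel)"
    using u by (intro nn_integral_real_affine) auto
  also have "(\<integral>\<^sup>+x. ?f (0 + (1 / u) * x) \<partial>lborel)
     = (\<integral>\<^sup>+x. ennreal (1 / u powr (s - 1)) * ennreal (indicator {0..} x * x powr (s - 1) / exp x) \<partial>lborel)"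
  proof (intro nn_integral_cong_AE)
    have "AE x in lborel. x \<noteq> (0 :: real)" by (rule AE_lborel_singleton)
    then show "AE x in lborel. ?f (0 + (1 / u) * x)
        = ennreal (1 / u powr (s - 1)) * ennreal (indicator {0..} x * x powr (s - 1) / exp x)"
    proof eventually_elim
      case (elim x)
      show ?case
      proof (cases "x > 0")
        case True
        then show ?thesis using u
          by (simp add: powr_divide ennreal_mult[symmetric] exp_minus field_simps)
      next
        case False
        with elim u show ?thesis by (simp add: indicator_def divide_less_0_iff zero_less_divide_iff)
      qed
    qed
  qed
  also have "\<dots> = ennreal (1 / u powr (s - 1)) * ennreal (Gamma s)"
    by (subst nn_integral_cmult) (simp_all add: Gamma_conv_nn_integral_real[OF s])
  also have "ennreal \<bar>1 / u\<bar> * (ennreal (1 / u powr (s - 1)) * ennreal (Gamma s)) = ennreal (Gamma s / u powr s)"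
    using u s Gamma_real_pos[OF s] by (simp add: ennreal_mult[symmetric] powr_diff less_imp_le)
  finally show ?thesis .
qed

lemma nn_integral_exponential_kernel:
  fixes u :: real
  assumes u: "u > 0"
  shows "(\<integral>\<^sup>+x. ennreal (if x > 0 then exp (- u * x) else 0) \<partial>lborel) = ennreal (1 / u)"
proof -
  have "(\<integral>\<^sup>+x. ennreal (if x > 0 then exp (- u * x) else 0) \<partial>lborel)
     = (\<integral>\<^sup>+x. ennreal (if x > 0 then x powr (1 - 1) * exp (- u * x) else 0) \<partial>lborel)"
    by (intro nn_integral_cong) auto
  also have "\<dots> = ennreal (1 / u)"
    using nn_integral_gamma_kernel[of 1 u] u by simp
  finally show ?thesis .
qed

text \<open>On the unit interval the exponential series of \<open>iexp (t * x)\<close> is dominated,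
  uniformly in \<open>x\<close>, by the series of exp \<bar>t\<bar>, so sum and integral may be
  exchanged.\<close>

lemma char_eq_moment_series:
  assumes P: "real_distribution P" and P01: "AE x in P. 0 \<le> x \<and> x \<le> 1"
  shows "(\<lambda>n. (\<i> * of_real t) ^ n /\<^sub>R fact n * of_real (\<integral>x. x ^ n \<partial>P)) sums char P t"
proof -
  interpret real_distribution P by (rule P)
  let ?f = "\<lambda>n x. (\<i> * complex_of_real (t * x)) ^ n /\<^sub>R fact n"
  have norm: "AE x in P. norm (?f n x) \<le> \<bar>t\<bar> ^ n /\<^sub>R fact n" for n
    using P01
  proof eventually_elim
    case (elim x)
    have "\<bar>t * x\<bar> ^ n \<le> \<bar>t\<bar> ^ n"
      using elim by (intro power_mono) (auto simp: abs_mult mult_left_le)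
    then show ?case by (simp add: norm_power norm_mult divide_simps abs_mult)
  qed
  have sm: "summable (\<lambda>n. \<bar>t\<bar> ^ n /\<^sub>R fact n)" by (rule summable_exp_generic)
  have int: "integrable P (?f n)" for n
    by (rule integrable_const_bound[OF norm]) measurable
  have "(\<lambda>n. integral\<^sup>L P (?f n)) sums (\<integral>x. (\<Sum>n. ?f n x) \<partial>P)"
  proof (rule sums_integral[OF int])
    have "AE x in P. \<forall>n. norm (?f n x) \<le> \<bar>t\<bar> ^ n /\<^sub>R fact n"
      using norm by (simp add: AE_all_countable)
    then show "AE x in P. summable (\<lambda>n. norm (?f n x))"
      by eventually_elim (rule summable_comparison_test'[OF sm, of 0], simp)
    show "summable (\<lambda>n. \<integral>x. norm (?f n x) \<partial>P)"
    proof (rule summable_comparison_test'[OF sm, of 0])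
      fix n :: nat
      have "(\<integral>x. norm (?f n x) \<partial>P) \<le> \<bar>t\<bar> ^ n /\<^sub>R fact n"
        by (intro integral_le_const integrable_norm int norm)
      then show "norm (\<integral>x. norm (?f n x) \<partial>P) \<le> \<bar>t\<bar> ^ n /\<^sub>R fact n"
        by (simp add: integral_nonneg_AE)
    qed
  qed
  moreover have "(\<Sum>n. ?f n x) = iexp (t * x)" for x
    by (simp add: exp_def)
  moreover have "integral\<^sup>L P (?f n) = (\<i> * of_real t) ^ n /\<^sub>R fact n * of_real (\<integral>x. x ^ n \<partial>P)" for n
  proof -
    have "integral\<^sup>L P (?f n) = (\<integral>x. (\<i> * of_real t) ^ n /\<^sub>R fact n * complex_of_real (x ^ n) \<partial>P)"
      by (intro Bochner_Integration.integral_cong refl) (simp add: power_mult_distrib)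
    also have "\<dots> = (\<i> * of_real t) ^ n /\<^sub>R fact n * (\<integral>x. complex_of_real (x ^ n) \<partial>P)"
      by (rule integral_mult_right_zero)
    also have "(\<integral>x. complex_of_real (x ^ n) \<partial>P) = of_real (\<integral>x. x ^ n \<partial>P)"
      by (rule integral_complex_of_real)
    finally show ?thesis .
  qed
  ultimately show ?thesis by (simp add: char_def)
qed

text \<open>Determinacy of the Hausdorff moment problem: on a bounded interval the moments fix the
  characteristic function, and Levy's theorem does the rest.\<close>

lemma real_distribution_eq_if_moments_eq:
  assumes P: "real_distribution P" "real_distribution P'"
    and P01: "AE x in P. 0 \<le> x \<and> x \<le> 1" "AE x in P'. 0 \<le> x \<and> x \<le> 1"
    and mom: "\<And>n :: nat. (\<integral>x. x ^ n \<partial>P) = (\<integral>x. x ^ n \<partial>P')"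
  shows "P = P'"
proof (rule Levy_uniqueness[OF P], rule ext)
  fix t show "char P t = char P' t"
    using char_eq_moment_series[OF P(1) P01(1), of t] char_eq_moment_series[OF P(2) P01(2), of t]
    unfolding mom by (rule sums_unique2)
qed

lemma density_cancel:
  fixes f :: "'a \<Rightarrow> real"
  assumes [measurable]: "f \<in> borel_measurable M" and pos: "\<And>x. f x > 0"
  shows "density (density M (\<lambda>x. ennreal (f x))) (\<lambda>x. ennreal (1 / f x)) = M"
proof -
  have "ennreal (f x) * ennreal (1 / f x) = 1" for x
    using pos[of x] by (simp add: ennreal_mult[symmetric] less_imp_le)
  then show ?thesis
    by (simp add: density_density_eq density_1)
qed

lemma measure_eq_if_laplace_eq:
  fixes P P' :: "real measure" and c :: real
  assumes sets: "sets P = sets borel" "sets P' = sets borel"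
    and nonneg: "AE x in P. x \<ge> 0" "AE x in P'. x \<ge> 0"
    and lap: "\<And>n :: nat. n > 0 \<Longrightarrow>
      (\<integral>\<^sup>+x. ennreal (exp (- real n * x)) \<partial>P) = (\<integral>\<^sup>+x. ennreal (exp (- real n * x)) \<partial>P')"
    and c: "(\<integral>\<^sup>+x. ennreal (exp (- x)) \<partial>P) = ennreal c" "c > 0"
  shows "P = P'"
proof -
  \<comment> \<open>After tilting by \<open>exp (- x)\<close> and the substitution \<open>y = exp (- x)\<close>, the Laplace
    transform at the naturals becomes the moment sequence of a law on the unit interval.\<close>
  define D where "D N = density N (\<lambda>x :: real. ennreal (exp (- x) / c))" for N
  define T where "T N = distr (D N) borel (\<lambda>x. exp (- x))" for N :: "real measure"
  have c': "(\<integral>\<^sup>+x. ennreal (exp (- x)) \<partial>P') = ennreal c"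
    using lap[of 1] c by simp
  \<comment> \<open>The measures may have infinite mass, as potential measures do; \<open>c\<close>
    normalises the tilted measure to a probability. The tilt also shifts the index: the n-th moment
    of \<open>T N\<close> is a Laplace transform at \<open>Suc n\<close>, so the argument 0, where
    it may be infinite, never occurs. The density identity says that \<open>N\<close> can be
    recovered from \<open>T N\<close>.\<close>
  have T: "real_distribution (T N) \<and> (AE x in T N. 0 \<le> x \<and> x \<le> 1) \<and> density (distr (T N) borel (\<lambda>y. - ln y)) (\<lambda>x. ennreal (1 / (exp (- x) / c))) = N
      \<and> (\<forall>n. (\<integral>y. y ^ n \<partial>T N) = enn2real (ennreal (1 / c) * (\<integral>\<^sup>+x. ennreal (exp (- real (Suc n) * x)) \<partial>N)))"
    if N_sets[measurable_cong]: "sets N = sets borel" and N0: "AE x in N. x \<ge> 0"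
      and Nc: "(\<integral>\<^sup>+x. ennreal (exp (- x)) \<partial>N) = ennreal c" for N
  proof (intro conjI allI)
    have sets_D[measurable_cong]: "sets (D N) = sets borel" by (simp add: D_def N_sets)
    have int_D: "(\<integral>\<^sup>+x. f x \<partial>D N) = (\<integral>\<^sup>+x. ennreal (exp (- x) / c) * f x \<partial>N)"
      if "f \<in> borel_measurable borel" for f
      unfolding D_def using that by (subst nn_integral_density) (auto simp: N_sets cong: measurable_cong_sets)
    have "emeasure (D N) (space (D N)) = (\<integral>\<^sup>+x. 1 \<partial>D N)" by simp
    also have "\<dots> = (\<integral>\<^sup>+x. ennreal (1 / c) * ennreal (exp (- x)) \<partial>N)"
      using c(2) by (subst int_D) (auto simp: ennreal_mult[symmetric] intro!: nn_integral_cong)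
    also have "\<dots> = ennreal (1 / c) * ennreal c"
      by (subst nn_integral_cmult) (simp_all add: Nc)
    also have "\<dots> = 1" using c(2) by (simp add: ennreal_mult[symmetric])
    finally have "prob_space (D N)" by (rule prob_spaceI)
    then show "real_distribution (T N)"
      unfolding T_def real_distribution_def real_distribution_axioms_def
      by (auto intro!: prob_space.prob_space_distr)
    have "AE x in D N. x \<ge> 0"
      unfolding D_def using N0 by (subst AE_density) auto
    then show "AE x in T N. 0 \<le> x \<and> x \<le> 1"
      unfolding T_def by (subst AE_distr_iff) auto
    have "distr (T N) borel (\<lambda>y. - ln y) = distr (D N) borel (\<lambda>x. x)"
      unfolding T_def by (subst distr_distr) (auto simp: comp_def)
    also have "\<dots> = D N" by (rule distr_id2) (simp add: sets_D)
    finally have "density (distr (T N) borel (\<lambda>y. - ln y)) (\<lambda>x. ennreal (1 / (exp (- x) / c)))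
        = density (density N (\<lambda>x. ennreal (exp (- x) / c))) (\<lambda>x. ennreal (1 / (exp (- x) / c)))"
      by (simp only: D_def)
    also have "\<dots> = N" using c(2) by (intro density_cancel) auto
    finally show "density (distr (T N) borel (\<lambda>y. - ln y)) (\<lambda>x. ennreal (1 / (exp (- x) / c))) = N" .
    fix n :: nat
    have "(\<integral>y. y ^ n \<partial>T N) = (\<integral>x. exp (- x) ^ n \<partial>D N)"
      unfolding T_def by (subst integral_distr) auto
    also have "\<dots> = enn2real (\<integral>\<^sup>+x. ennreal (exp (- x) ^ n) \<partial>D N)"
      by (rule integral_eq_nn_integral) auto
    also have "(\<integral>\<^sup>+x. ennreal (exp (- x) ^ n) \<partial>D N)
        = (\<integral>\<^sup>+x. ennreal (1 / c) * ennreal (exp (- real (Suc n) * x)) \<partial>N)"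
      using c(2) by (subst int_D)
        (auto simp: ennreal_mult[symmetric] exp_of_nat_mult[symmetric] exp_add[symmetric] algebra_simps intro!: nn_integral_cong)
    also have "\<dots> = ennreal (1 / c) * (\<integral>\<^sup>+x. ennreal (exp (- real (Suc n) * x)) \<partial>N)"
      by (rule nn_integral_cmult) simp
    finally show "(\<integral>y. y ^ n \<partial>T N) = enn2real (ennreal (1 / c) * (\<integral>\<^sup>+x. ennreal (exp (- real (Suc n) * x)) \<partial>N))" .
  qed
  note T1 = T[OF sets(1) nonneg(1) c(1)] and T2 = T[OF sets(2) nonneg(2) c']
  have "T P = T P'"
    using T1 T2 lap by (intro real_distribution_eq_if_moments_eq) (auto simp del: of_nat_Suc)
  with T1 T2 show ?thesis by metis
qed

section \<open>Potential measure of a subordinator\<close>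

lemma sigma_finite_half_line: "sigma_finite_measure (density lborel (indicator {0 :: real..}))"
  by (subst sigma_finite_measure.sigma_finite_iff_density_finite[OF sigma_finite_lborel])
     (auto intro!: AE_I2 simp: indicator_def)

text \<open>The expected occupation measure: a Borel set receives the expected time that the path
  spends in it. \<open>path_eval\<close> stands in for \<open>D r \<omega>\<close> because the image
  measure calls for joint measurability in \<omega> and \<open>r\<close>.\<close>

definition potential_measure :: "'a measure \<Rightarrow> (real \<Rightarrow> 'a \<Rightarrow> real) \<Rightarrow> real measure" where
  "potential_measure M D =
     distr (M \<Otimes>\<^sub>M density lborel (indicator {0..})) borel (\<lambda>(\<omega>, r). path_eval D r \<omega>)"

definition stable_potential :: "real \<Rightarrow> real measure" where
  "stable_potential b = density lborel (\<lambda>x. ennreal (if x > 0 then x powr (b - 1) / Gamma b else 0))"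

context prob_space
begin

lemma nn_integral_potential_measure:
  assumes X: "right_cont_process M X" and [measurable]: "f \<in> borel_measurable borel"
  shows "(\<integral>\<^sup>+x. f x \<partial>potential_measure M X)
       = (\<integral>\<^sup>+r. indicator {0..} r * (\<integral>\<^sup>+\<omega>. f (X r \<omega>) \<partial>M) \<partial>lborel)"
proof -
  let ?L = "density lborel (indicator {0 :: real..})"
  interpret L: sigma_finite_measure ?L by (rule sigma_finite_half_line)
  interpret pair_sigma_finite M ?L ..
  have [measurable]: "(\<lambda>(\<omega>, r). path_eval X r \<omega>) \<in> borel_measurable (M \<Otimes>\<^sub>M borel)"
    by (rule measurable_path_eval) (rule right_cont_processD(1)[OF X])
  have [measurable]: "(\<lambda>(\<omega>, r). path_eval X r \<omega>) \<in> borel_measurable (M \<Otimes>\<^sub>M ?L)"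
    by measurable
  have "(\<integral>\<^sup>+x. f x \<partial>potential_measure M X) = (\<integral>\<^sup>+p. f (path_eval X (snd p) (fst p)) \<partial>(M \<Otimes>\<^sub>M ?L))"
    unfolding potential_measure_def by (subst nn_integral_distr) (auto simp: case_prod_beta)
  also have "\<dots> = (\<integral>\<^sup>+r. \<integral>\<^sup>+\<omega>. f (path_eval X r \<omega>) \<partial>M \<partial>?L)"
    by (subst nn_integral_snd[symmetric]) (auto simp: case_prod_beta)
  also have "\<dots> = (\<integral>\<^sup>+r. indicator {0..} r * (\<integral>\<^sup>+\<omega>. f (path_eval X r \<omega>) \<partial>M) \<partial>lborel)"
    by (subst nn_integral_density) measurable
  also have "\<dots> = (\<integral>\<^sup>+r. indicator {0..} r * (\<integral>\<^sup>+\<omega>. f (X r \<omega>) \<partial>M) \<partial>lborel)"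
    using right_cont_processD(2)[OF X]
    by (intro nn_integral_cong) (auto simp: indicator_def intro!: nn_integral_cong)
  finally show ?thesis .
qed

text \<open>Integrating \<open>exp (- r * u powr b)\<close> over \<open>r\<close> and the Gamma
  integral for the candidate density both give \<open>1 / u powr b\<close>. The normalisation
  \<open>c = 1\<close> is this value at \<open>u = 1\<close>.\<close>

lemma potential_measure_stable:
  assumes D: "stable_subordinator M b D" and b: "0 < b"
  shows "potential_measure M D = stable_potential b"
proof (rule measure_eq_if_laplace_eq[where c=1])
  have sub: "subordinator M D" using D by (simp add: stable_subordinator_def)
  note subD = subordinatorD[OF sub]
  have lap: "(\<integral>\<^sup>+x. ennreal (exp (- u * x)) \<partial>potential_measure M D) = ennreal (1 / u powr b)"
    if u: "u > 0" for u :: real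
  proof -
    have "(\<integral>\<^sup>+x. ennreal (exp (- u * x)) \<partial>potential_measure M D)
      = (\<integral>\<^sup>+r. indicator {0..} r * (\<integral>\<^sup>+\<omega>. ennreal (exp (- u * D r \<omega>)) \<partial>M) \<partial>lborel)"
      by (intro nn_integral_potential_measure[OF subD(2)]) measurable
    also have "\<dots> = (\<integral>\<^sup>+r. ennreal (if r > 0 then exp (- (u powr b) * r) else 0) \<partial>lborel)"
    proof (intro nn_integral_cong_AE)
      have "AE x in lborel. x \<noteq> (0 :: real)" by (rule AE_lborel_singleton)
      then show "AE r in lborel. indicator {0..} r * (\<integral>\<^sup>+\<omega>. ennreal (exp (- u * D r \<omega>)) \<partial>M)
          = ennreal (if r > 0 then exp (- (u powr b) * r) else 0)"
      proof eventually_elim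
        case (elim r)
        show ?case
        proof (cases "r > 0")
          case True
          have "integrable M (\<lambda>\<omega>. exp (- u * D r \<omega>))"
            using True u subD(4) levy_process_measurable[OF subD(1), of r]
            by (intro integrable_const_bound[where B=1]) (auto intro!: AE_I2)
          then have "(\<integral>\<^sup>+\<omega>. ennreal (exp (- u * D r \<omega>)) \<partial>M) = ennreal (expectation (\<lambda>\<omega>. exp (- u * D r \<omega>)))"
            by (rule nn_integral_eq_integral) simp
          also have "expectation (\<lambda>\<omega>. exp (- u * D r \<omega>)) = exp (- r * u powr b)"
            using D True u unfolding stable_subordinator_def by auto
          finally show ?thesis using True by (simp add: mult.commute)
        qed (use elim in auto)
      qed
    qed
    also have "\<dots> = ennreal (1 / u powr b)"
      using u by (intro nn_integral_exponential_kernel) auto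
    finally show ?thesis .
  qed
  have lap': "(\<integral>\<^sup>+x. ennreal (exp (- u * x)) \<partial>stable_potential b) = ennreal (1 / u powr b)"
    if u: "u > 0" for u :: real
  proof -
    have "(\<integral>\<^sup>+x. ennreal (exp (- u * x)) \<partial>stable_potential b)
      = (\<integral>\<^sup>+x. ennreal (1 / Gamma b) * ennreal (if x > 0 then x powr (b - 1) * exp (- u * x) else 0) \<partial>lborel)"
      unfolding stable_potential_def using Gamma_real_pos[OF b]
      by (subst nn_integral_density) (auto intro!: nn_integral_cong simp: ennreal_mult[symmetric] less_imp_le)
    also have "\<dots> = ennreal (1 / Gamma b) * ennreal (Gamma b / u powr b)"
      by (subst nn_integral_cmult) (use nn_integral_gamma_kernel[OF b u] in auto)
    also have "\<dots> = ennreal (1 / u powr b)"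
      using Gamma_real_pos[OF b] by (simp add: ennreal_mult[symmetric] less_imp_le)
    finally show ?thesis .
  qed
  show "sets (potential_measure M D) = sets borel" by (simp add: potential_measure_def)
  show "sets (stable_potential b) = sets borel" by (simp add: stable_potential_def)
  show "AE x in stable_potential b. x \<ge> 0"
    unfolding stable_potential_def by (subst AE_density) (auto intro!: AE_I2)
  show "AE x in potential_measure M D. x \<ge> 0"
  proof -
    have "(\<integral>\<^sup>+x. indicator {..<0} x \<partial>potential_measure M D)
      = (\<integral>\<^sup>+r. indicator {0..} r * (\<integral>\<^sup>+\<omega>. indicator {..<0} (D r \<omega>) \<partial>M) \<partial>lborel)"
      by (intro nn_integral_potential_measure[OF subD(2)]) measurable
    also have "\<dots> = (\<integral>\<^sup>+r. 0 \<partial>(lborel :: real measure))"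
    proof (intro nn_integral_cong)
      fix r :: real
      show "indicator {0..} r * (\<integral>\<^sup>+\<omega>. indicator {..<0} (D r \<omega>) \<partial>M) = (0 :: ennreal)"
      proof (cases "r \<ge> 0")
        case True
        then have "(\<integral>\<^sup>+\<omega>. indicator {..<0} (D r \<omega>) \<partial>M) = (\<integral>\<^sup>+\<omega>. 0 \<partial>M)"
          using subD(4) by (intro nn_integral_cong) (auto simp: indicator_def not_less)
        then show ?thesis by simp
      qed simp
    qed
    finally have "(\<integral>\<^sup>+x. indicator {..<0} x \<partial>potential_measure M D) = 0" by simp
    then have "AE x in potential_measure M D. indicator {..<0} x = (0 :: ennreal)"
      by (subst (asm) nn_integral_0_iff_AE) (auto simp: potential_measure_def)
    then show ?thesis by eventually_elim (auto simp: indicator_def split: if_splits)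
  qed
  show "(\<integral>\<^sup>+x. ennreal (exp (- real n * x)) \<partial>potential_measure M D)
      = (\<integral>\<^sup>+x. ennreal (exp (- real n * x)) \<partial>stable_potential b)" if "n > 0" for n
    using lap[of "real n"] lap'[of "real n"] that by simp
  show "(\<integral>\<^sup>+x. ennreal (exp (- x)) \<partial>potential_measure M D) = ennreal 1"
    using lap[of 1] by simp
qed simp

end

section \<open>The two-fold stable potential and its diagonal constant\<close>

lemma sigma_finite_stable_potential: "sigma_finite_measure (stable_potential b)"
  unfolding stable_potential_def
  by (subst sigma_finite_measure.sigma_finite_iff_density_finite[OF sigma_finite_lborel]) auto

lemma sets_stable_potential[measurable_cong, simp]: "sets (stable_potential b) = sets borel"
  by (simp add: stable_potential_def)

lemma nn_integral_stable_potential: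
  assumes [measurable]: "f \<in> borel_measurable borel"
  shows "(\<integral>\<^sup>+x. f x \<partial>stable_potential b)
       = (\<integral>\<^sup>+x. ennreal (if x > 0 then x powr (b - 1) / Gamma b else 0) * f x \<partial>lborel)"
  unfolding stable_potential_def by (subst nn_integral_density) auto

lemma nn_integral_powr_Icc:
  fixes a c :: real
  assumes "a > -1" "c \<ge> 0"
  shows "(\<integral>\<^sup>+x. ennreal (indicator {0..c} x * x powr a) \<partial>lborel) = ennreal (c powr (a + 1) / (a + 1))"
  using nn_integral_has_integral_lebesgue[OF _ has_integral_powr_from_0[OF assms]] by simp

lemma Gamma_one_plus_real: "0 < b \<Longrightarrow> Gamma (1 + b) = b * Gamma (b :: real)"
  using Gamma_plus1[of b] by (auto simp: add.commute nonpos_Ints_def)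

text \<open>By Tonelli this mass is the mean of the inverse subordinator at level \<open>z\<close>;
  the same closed form reappears as the inner integral of \<open>potential_conv\<close>.\<close>

lemma stable_potential_atMost:
  assumes b: "0 < b" and z: "z \<ge> 0"
  shows "(\<integral>\<^sup>+x. indicator {..z} x \<partial>stable_potential b) = ennreal (z powr b / Gamma (1 + b))"
proof -
  have "(\<integral>\<^sup>+x. indicator {..z} x \<partial>stable_potential b)
     = (\<integral>\<^sup>+x. ennreal (1 / Gamma b) * ennreal (indicator {0..z} x * x powr (b - 1)) \<partial>lborel)"
    using Gamma_real_pos[OF b]
    by (subst nn_integral_stable_potential)
       (auto intro!: nn_integral_cong simp: indicator_def ennreal_mult[symmetric] less_imp_le)
  also have "\<dots> = ennreal (1 / Gamma b) * ennreal (z powr (b - 1 + 1) / (b - 1 + 1))"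
    using b z by (subst nn_integral_cmult) (auto simp only: nn_integral_powr_Icc, auto)
  also have "\<dots> = ennreal (z powr b / Gamma (1 + b))"
    using b Gamma_real_pos[OF b] Gamma_one_plus_real[OF b]
    by (simp add: ennreal_mult[symmetric] less_imp_le mult.commute)
  finally show ?thesis .
qed

text \<open>The expected area of the set of time pairs r \<le> r' with D(r) \<le> s and D(r') \<le>
  t: the value at the earlier time and the increment after it each contribute one copy of the
  potential measure. For s = t this is half the second moment of the inverse subordinator.\<close>

definition potential_conv :: "real \<Rightarrow> real \<Rightarrow> real \<Rightarrow> ennreal" where
  "potential_conv b s t = (\<integral>\<^sup>+x. indicator {..s} x * (\<integral>\<^sup>+y. indicator {..t} (x + y) \<partial>stable_potential b) \<partial>stable_potential b)"

lemma potential_conv_eq: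
  assumes b: "0 < b" and st: "0 \<le> s" "s \<le> t"
  shows "potential_conv b s t
    = (\<integral>\<^sup>+x. indicator {..s} x * ennreal ((t - x) powr b / Gamma (1 + b)) \<partial>stable_potential b)"
  unfolding potential_conv_def
proof (intro nn_integral_cong)
  fix x
  show "indicator {..s} x * (\<integral>\<^sup>+y. indicator {..t} (x + y) \<partial>stable_potential b)
      = indicator {..s} x * ennreal ((t - x) powr b / Gamma (1 + b))"
  proof (cases "x \<le> s")
    case True
    have "(\<integral>\<^sup>+y. indicator {..t} (x + y) \<partial>stable_potential b) = (\<integral>\<^sup>+y. indicator {..t - x} y \<partial>stable_potential b)"
      by (intro nn_integral_cong) (auto simp: indicator_def)
    also have "\<dots> = ennreal ((t - x) powr b / Gamma (1 + b))"
      using True st by (intro stable_potential_atMost b) auto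
    finally show ?thesis by simp
  qed simp
qed

lemma AE_stable_potential_pos: "AE x in stable_potential b. x > 0"
  unfolding stable_potential_def by (subst AE_density) (auto intro!: AE_I2)

text \<open>For 0 < x \<le> s the factor \<open>(t - x) powr b\<close> lies between
  \<open>(t - s) powr b\<close> and \<open>t powr b\<close>. Bounding it by these constants avoids
  the incomplete Beta integral, and the two results differ by an amount that vanishes for large
  \<open>t\<close> when b < 1. The upper side uses x > 0, which holds almost everywhere.\<close>

lemma potential_conv_bounds:
  assumes b: "0 < b" and st: "0 \<le> s" "s \<le> t"
  shows "potential_conv b s t \<le> ennreal (s powr b * t powr b / (Gamma (1 + b))\<^sup>2)"
    and "potential_conv b s t \<ge> ennreal (s powr b * (t - s) powr b / (Gamma (1 + b))\<^sup>2)"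
proof -
  have G: "Gamma (1 + b) > 0" using b by (intro Gamma_real_pos) simp
  have const: "(\<integral>\<^sup>+x. indicator {..s} x * ennreal (z powr b / Gamma (1 + b)) \<partial>stable_potential b)
      = ennreal (s powr b * z powr b / (Gamma (1 + b))\<^sup>2)" for z
    using G stable_potential_atMost[OF b st(1)]
    by (subst nn_integral_multc) (auto simp: ennreal_mult[symmetric] power2_eq_square less_imp_le)
  show "potential_conv b s t \<le> ennreal (s powr b * t powr b / (Gamma (1 + b))\<^sup>2)"
    unfolding potential_conv_eq[OF assms] const[symmetric]
  proof (rule nn_integral_mono_AE)
    show "AE x in stable_potential b. indicator {..s} x * ennreal ((t - x) powr b / Gamma (1 + b))
        \<le> indicator {..s} x * ennreal (t powr b / Gamma (1 + b))"
      using AE_stable_potential_pos[of b]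
    proof eventually_elim
      case (elim x)
      have "(t - x) powr b \<le> t powr b" if "x \<le> s"
        using elim b st that by (intro powr_mono2) auto
      then show ?case
        using G by (auto simp: indicator_def intro!: ennreal_leI divide_right_mono)
    qed
  qed
  show "potential_conv b s t \<ge> ennreal (s powr b * (t - s) powr b / (Gamma (1 + b))\<^sup>2)"
    unfolding potential_conv_eq[OF assms] const[symmetric]
    using b G st
    by (intro nn_integral_mono)
       (auto simp: indicator_def intro!: ennreal_leI divide_right_mono powr_mono2)
qed

text \<open>Under x = s y the density contributes the exponent b - 1, the kernel b, and the change
  of variable 1, in total 2 b. The substitution degenerates at s = 0, where both sides are 0 because
  \<open>0 powr _ = 0\<close>.\<close>

lemma potential_conv_scale:
  assumes b: "0 < b" and s: "0 \<le> s"
  shows "potential_conv b s s = ennreal (s powr (2 * b)) * potential_conv b 1 1"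
proof (cases "s = 0")
  case True
  have "potential_conv b 0 0 \<le> 0" using potential_conv_bounds(1)[OF b, of 0 0] by simp
  with True show ?thesis by simp
next
  case False
  with s have s: "s > 0" by simp
  have G: "Gamma (1 + b) > 0" "Gamma b > 0" using b by (auto intro!: Gamma_real_pos)
  let ?f = "\<lambda>s x. ennreal (if x > 0 then x powr (b - 1) / Gamma b else 0) *
      (indicator {..s} x * ennreal ((s - x) powr b / Gamma (1 + b)))"
  have *: "potential_conv b s s = (\<integral>\<^sup>+x. ?f s x \<partial>lborel)" if "s \<ge> 0" for s
    unfolding potential_conv_eq[OF b that order_refl]
    by (rule nn_integral_stable_potential) measurable
  have "(\<integral>\<^sup>+x. ?f s x \<partial>lborel) = ennreal \<bar>s\<bar> * (\<integral>\<^sup>+x. ?f s (0 + s * x) \<partial>lborel)"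
    using s by (intro nn_integral_real_affine) auto
  also have "(\<integral>\<^sup>+x. ?f s (0 + s * x) \<partial>lborel) = (\<integral>\<^sup>+x. ennreal (s powr (b - 1) * s powr b) * ?f 1 x \<partial>lborel)"
  proof (intro nn_integral_cong)
    fix x :: real
    show "?f s (0 + s * x) = ennreal (s powr (b - 1) * s powr b) * ?f 1 x"
    proof (cases "0 < x \<and> x \<le> 1")
      case True
      have "(s - s * x) powr b = s powr b * (1 - x) powr b"
        using True s by (subst powr_mult[symmetric]) (auto simp: algebra_simps)
      moreover have "(s * x) powr (b - 1) = s powr (b - 1) * x powr (b - 1)"
        using True s by (subst powr_mult) auto
      ultimately show ?thesis using True s G
        by (simp add: ennreal_mult[symmetric] less_imp_le mult_le_cancel_left1)
    next
      case False
      then show ?thesis using s by (auto simp: indicator_def zero_less_mult_iff)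
    qed
  qed
  also have "\<dots> = ennreal (s powr (b - 1) * s powr b) * potential_conv b 1 1"
    by (subst nn_integral_cmult) (auto simp: *)
  also have "ennreal \<bar>s\<bar> * (ennreal (s powr (b - 1) * s powr b) * potential_conv b 1 1)
     = ennreal (s powr (2 * b)) * potential_conv b 1 1"
  proof -
    have "s * (s powr (b - 1) * s powr b) = s powr (2 * b)"
    proof -
      have "s powr (1 + (b - 1) + b) = s powr 1 * s powr (b - 1) * s powr b"
        by (simp only: powr_add)
      moreover have "1 + (b - 1) + b = 2 * b" by simp
      ultimately show ?thesis using s by (simp add: mult.assoc)
    qed
    moreover have "ennreal \<bar>s\<bar> * (ennreal (s powr (b - 1) * s powr b) * potential_conv b 1 1)
      = ennreal (\<bar>s\<bar> * (s powr (b - 1) * s powr b)) * potential_conv b 1 1"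
      by (simp only: ennreal_mult[OF abs_ge_zero mult_nonneg_nonneg[OF powr_ge_zero powr_ge_zero]] mult.assoc)
    ultimately show ?thesis using s by simp
  qed
  finally show ?thesis using s by (simp add: *)
qed

text \<open>Since b < 1, \<open>(1 - x) powr b\<close> is at least 1 - x on the unit interval. This
  replaces the Beta integral by the elementary 1/b - 1/(b + 1), and
  \<open>Gamma (1 + b) = b * Gamma b\<close> puts the result in the stated form.\<close>

lemma potential_conv_1_lower:
  assumes b: "0 < b" "b < 1"
  shows "potential_conv b 1 1 \<ge> ennreal (1 / ((b + 1) * (Gamma (1 + b))\<^sup>2))"
proof -
  have G: "Gamma (1 + b) > 0" "Gamma b > 0" using b by (auto intro!: Gamma_real_pos)
  let ?q = "1 / (Gamma b * Gamma (1 + b))"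
  let ?p = "\<lambda>a x. ennreal (indicator {0..1} x * x powr a) :: ennreal"
  \<comment> \<open>The negative part of x^(b-1) (1 - x) = x^(b-1) - x^b is carried as an added term
    on the other side, since extended nonnegative reals have only truncated subtraction; being
    finite, it is cancelled at the end.\<close>
  have real_eq: "1 / ((b + 1) * (Gamma (1 + b))\<^sup>2) + ?q * (1 / (b + 1)) = ?q * (1 / b)"
  proof -
    have "b + 1 \<noteq> 0" "b \<noteq> 0" "Gamma b \<noteq> 0" using b G(2)[THEN less_imp_neq] by simp_all
    then show ?thesis
      unfolding Gamma_one_plus_real[OF b(1)] by (simp add: divide_simps power2_eq_square)
  qed
  have q_nonneg: "?q \<ge> 0" using G by simp
  have "ennreal (1 / ((b + 1) * (Gamma (1 + b))\<^sup>2)) + ennreal ?q * ennreal (1 / (b + 1))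
      = ennreal (1 / ((b + 1) * (Gamma (1 + b))\<^sup>2) + ?q * (1 / (b + 1)))"
  proof -
    have *: "0 \<le> 1 / ((b + 1) * (Gamma (1 + b))\<^sup>2)" "0 \<le> 1 / (b + 1)" using b by auto
    show ?thesis
      by (simp only: ennreal_plus[OF *(1) mult_nonneg_nonneg[OF q_nonneg *(2)]] ennreal_mult[OF q_nonneg *(2)])
  qed
  also have "\<dots> = ennreal ?q * ennreal (1 / b)"
    unfolding real_eq using b q_nonneg by (intro ennreal_mult) auto
  also have "\<dots> = (\<integral>\<^sup>+x. ennreal ?q * ?p (b - 1) x \<partial>lborel)"
    using nn_integral_powr_Icc[of "b - 1" 1] b by (subst nn_integral_cmult) auto
  also have "\<dots> \<le> (\<integral>\<^sup>+x. ennreal (if x > 0 then x powr (b - 1) / Gamma b else 0) *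
      (indicator {..1} x * ennreal ((1 - x) powr b / Gamma (1 + b))) + ennreal ?q * ?p b x \<partial>lborel)"
  proof (intro nn_integral_mono)
    fix x :: real
    show "ennreal ?q * ?p (b - 1) x \<le> ennreal (if x > 0 then x powr (b - 1) / Gamma b else 0) *
      (indicator {..1} x * ennreal ((1 - x) powr b / Gamma (1 + b))) + ennreal ?q * ?p b x"
    proof (cases "0 < x \<and> x \<le> 1")
      case True
      have "1 - x \<le> (1 - x) powr b"
      proof (cases "x = 1")
        case False
        with True have "(1 - x) powr 1 \<le> (1 - x) powr b"
          using b by (intro powr_mono') auto
        then show ?thesis using True by simp
      qed simp
      then have "x powr (b - 1) * (1 - x) \<le> x powr (b - 1) * (1 - x) powr b"
        by (intro mult_left_mono) auto
      moreover have "x powr (b - 1) * (1 - x) = x powr (b - 1) - x powr b"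
        using True by (simp add: field_simps powr_diff)
      ultimately have "?q * x powr (b - 1) \<le> ?q * (x powr (b - 1) * (1 - x) powr b + x powr b)"
        using G by (intro mult_left_mono) auto
      then have "ennreal (?q * x powr (b - 1)) \<le> ennreal (?q * (x powr (b - 1) * (1 - x) powr b) + ?q * x powr b)"
        by (intro ennreal_leI) (simp add: distrib_left)
      also have "\<dots> = ennreal (x powr (b - 1) / Gamma b) * ennreal ((1 - x) powr b / Gamma (1 + b)) + ennreal ?q * ennreal (x powr b)"
        using G q_nonneg by (subst ennreal_plus) (simp_all add: ennreal_mult[symmetric])
      finally show ?thesis using True unfolding ennreal_mult[OF q_nonneg powr_ge_zero] by simp
    next
      case False
      then have "indicator {0..1} x * x powr (b - 1) = 0" by (auto simp: indicator_def)
      then have "?p (b - 1) x = 0" by (simp only: ennreal_0)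
      then show ?thesis by (simp only: mult_zero_right zero_le)
    qed
  qed
  also have "\<dots> = potential_conv b 1 1 + ennreal ?q * ennreal (1 / (b + 1))"
  proof -
    have "potential_conv b 1 1 = (\<integral>\<^sup>+x. ennreal (if x > 0 then x powr (b - 1) / Gamma b else 0) *
      (indicator {..1} x * ennreal ((1 - x) powr b / Gamma (1 + b))) \<partial>lborel)"
      unfolding potential_conv_eq[OF b(1) zero_le_one order_refl]
      by (rule nn_integral_stable_potential) measurable
    moreover have "(\<integral>\<^sup>+x. ennreal ?q * ?p b x \<partial>lborel) = ennreal ?q * ennreal (1 / (b + 1))"
      using nn_integral_powr_Icc[of b 1] b by (subst nn_integral_cmult) auto
    ultimately show ?thesis by (subst nn_integral_add) auto
  qed
  finally show ?thesis
    using ennreal_add_left_cancel_le[of "ennreal ?q * ennreal (1 / (b + 1))"]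
      ennreal_mult_less_top[of "ennreal ?q" "ennreal (1 / (b + 1))"]
    by (simp only: add.commute[of _ "ennreal ?q * ennreal (1 / (b + 1))"]) auto
qed

text \<open>\<kappa> is the value at s = 1 measured in units of the squared mean: the second moment
  of the inverse subordinator is 2 \<kappa> times the square of its mean. Thus \<kappa> > 1/2
  expresses a strictly positive variance; it follows from the lower bound 1 / (b + 1) and b <
  1.\<close>

lemma potential_conv_diag:
  assumes b: "0 < b" "b < 1"
  obtains \<kappa> where "\<kappa> > 1/2"
    "\<And>s. s \<ge> 0 \<Longrightarrow> potential_conv b s s = ennreal (\<kappa> * s powr (2 * b) / (Gamma (1 + b))\<^sup>2)"
proof -
  have G: "Gamma (1 + b) > 0" using b by (intro Gamma_real_pos) simp
  have "potential_conv b 1 1 \<le> ennreal (1 / (Gamma (1 + b))\<^sup>2)"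
    using potential_conv_bounds(1)[OF b(1), of 1 1] by simp
  then obtain h where h: "potential_conv b 1 1 = ennreal h" "h \<ge> 0"
    by (cases "potential_conv b 1 1") (auto simp: top_unique)
  have "1 / ((b + 1) * (Gamma (1 + b))\<^sup>2) \<le> h"
    using potential_conv_1_lower[OF b] h by simp
  then have "1 / ((b + 1) * (Gamma (1 + b))\<^sup>2) * (Gamma (1 + b))\<^sup>2 \<le> h * (Gamma (1 + b))\<^sup>2"
    by (intro mult_right_mono) auto
  then have "1 / (b + 1) \<le> h * (Gamma (1 + b))\<^sup>2"
    using G[THEN less_imp_neq] by simp
  moreover have "1 / (b + 1) > 1 / 2" using b by (simp add: field_simps)
  ultimately have "h * (Gamma (1 + b))\<^sup>2 > 1 / 2" by linarith
  moreover have "potential_conv b s s = ennreal (h * (Gamma (1 + b))\<^sup>2 * s powr (2 * b) / (Gamma (1 + b))\<^sup>2)" if "s \<ge> 0" for s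
    using potential_conv_scale[OF b(1) that] h G by (simp add: ennreal_mult[symmetric] mult.commute)
  ultimately show thesis by (rule that)
qed

text \<open>The plane is split along its diagonal, which is null, and the later coordinate is
  written as \<open>r + p\<close>. In this form independent increments apply to a product of two
  occupation times.\<close>

lemma nn_integral_mult_eq_ordered:
  fixes f g :: "real \<Rightarrow> ennreal"
  assumes [measurable]: "f \<in> borel_measurable borel" "g \<in> borel_measurable borel"
  shows "(\<integral>\<^sup>+r. f r \<partial>lborel) * (\<integral>\<^sup>+r. g r \<partial>lborel)
    = (\<integral>\<^sup>+r. \<integral>\<^sup>+p. indicator {0..} p * (f r * g (r + p) + g r * f (r + p)) \<partial>lborel \<partial>lborel)"
proof -
  have shift: "(\<integral>\<^sup>+r. \<integral>\<^sup>+q. indicator {r..} q * (f r * g q) \<partial>lborel \<partial>lborel)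
      = (\<integral>\<^sup>+r. \<integral>\<^sup>+p. indicator {0..} p * (f r * g (r + p)) \<partial>lborel \<partial>lborel)"
    if [measurable]: "f \<in> borel_measurable borel" "g \<in> borel_measurable borel" for f g :: "real \<Rightarrow> ennreal"
  proof (rule nn_integral_cong)
    fix r :: real
    have "(\<integral>\<^sup>+q. indicator {r..} q * (f r * g q) \<partial>lborel)
        = ennreal \<bar>1\<bar> * (\<integral>\<^sup>+p. indicator {r..} (r + 1 * p) * (f r * g (r + 1 * p)) \<partial>lborel)"
      by (intro nn_integral_real_affine) auto
    also have "\<dots> = (\<integral>\<^sup>+p. indicator {0..} p * (f r * g (r + p)) \<partial>lborel)"
      by (auto intro!: nn_integral_cong simp: indicator_def)
    finally show "(\<integral>\<^sup>+q. indicator {r..} q * (f r * g q) \<partial>lborel)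
        = (\<integral>\<^sup>+p. indicator {0..} p * (f r * g (r + p)) \<partial>lborel)" .
  qed
  have "(\<lambda>p. indicator {fst p..} (snd p) :: ennreal) = indicator {p. fst p \<le> (snd p :: real)}"
    "(\<lambda>p. indicator {snd p..} (fst p) :: ennreal) = indicator {p. snd p \<le> (fst p :: real)}"
    by (auto simp: indicator_def fun_eq_iff)
  then have ind[measurable]:
    "(\<lambda>p. indicator {fst p..} (snd p :: real) :: ennreal) \<in> borel_measurable (borel \<Otimes>\<^sub>M borel)"
    "(\<lambda>p. indicator {snd p..} (fst p :: real) :: ennreal) \<in> borel_measurable (borel \<Otimes>\<^sub>M borel)"
    by (simp_all only:) measurable
  have "(\<integral>\<^sup>+r. f r \<partial>lborel) * (\<integral>\<^sup>+r. g r \<partial>lborel) = (\<integral>\<^sup>+r. \<integral>\<^sup>+q. f r * g q \<partial>lborel \<partial>lborel)"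
    by (simp add: nn_integral_cmult nn_integral_multc)
  also have "\<dots> = (\<integral>\<^sup>+r. \<integral>\<^sup>+q. indicator {r..} q * (f r * g q) + indicator {q..} r * (g q * f r) \<partial>lborel \<partial>lborel)"
  proof (rule nn_integral_cong, rule nn_integral_cong_AE)
    fix r :: real
    have "AE q in lborel. q \<noteq> r" by (rule AE_lborel_singleton)
    then show "AE q in lborel. f r * g q = indicator {r..} q * (f r * g q) + indicator {q..} r * (g q * f r)"
      by eventually_elim (auto simp: indicator_def mult.commute)
  qed
  also have "\<dots> = (\<integral>\<^sup>+r. \<integral>\<^sup>+q. indicator {r..} q * (f r * g q) \<partial>lborel \<partial>lborel)
      + (\<integral>\<^sup>+r. \<integral>\<^sup>+q. indicator {q..} r * (g q * f r) \<partial>lborel \<partial>lborel)"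
  proof -
    have "(\<lambda>p. indicator {fst p..} (snd p) * (f (fst p) * g (snd p))) \<in> borel_measurable (lborel \<Otimes>\<^sub>M lborel)"
      "(\<lambda>p. indicator {snd p..} (fst p) * (g (snd p) * f (fst p))) \<in> borel_measurable (lborel \<Otimes>\<^sub>M lborel)"
      by measurable
    then have "(\<lambda>r. \<integral>\<^sup>+q. indicator {r..} q * (f r * g q) \<partial>lborel) \<in> borel_measurable lborel"
      "(\<lambda>r. \<integral>\<^sup>+q. indicator {q..} r * (g q * f r) \<partial>lborel) \<in> borel_measurable lborel"
      by (auto dest!: lborel.borel_measurable_nn_integral_fst)
    then have "(\<integral>\<^sup>+r. (\<integral>\<^sup>+q. indicator {r..} q * (f r * g q) \<partial>lborel) + (\<integral>\<^sup>+q. indicator {q..} r * (g q * f r) \<partial>lborel) \<partial>lborel)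
      = (\<integral>\<^sup>+r. \<integral>\<^sup>+q. indicator {r..} q * (f r * g q) \<partial>lborel \<partial>lborel)
      + (\<integral>\<^sup>+r. \<integral>\<^sup>+q. indicator {q..} r * (g q * f r) \<partial>lborel \<partial>lborel)"
      by (rule nn_integral_add)
    moreover have "(\<integral>\<^sup>+q. indicator {r..} q * (f r * g q) + indicator {q..} r * (g q * f r) \<partial>lborel)
      = (\<integral>\<^sup>+q. indicator {r..} q * (f r * g q) \<partial>lborel) + (\<integral>\<^sup>+q. indicator {q..} r * (g q * f r) \<partial>lborel)" for r :: real
    proof (rule nn_integral_add)
      have "indicator {q..} r = (indicator {..r} q :: ennreal)" for q by (auto simp: indicator_def)
      then show "(\<lambda>q. indicator {q..} r * (g q * f r)) \<in> borel_measurable lborel" by simp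
    qed simp
    ultimately show ?thesis by simp
  qed
  also have "(\<integral>\<^sup>+r. \<integral>\<^sup>+q. indicator {q..} r * (g q * f r) \<partial>lborel \<partial>lborel)
     = (\<integral>\<^sup>+q. \<integral>\<^sup>+r. indicator {q..} r * (g q * f r) \<partial>lborel \<partial>lborel)"
    by (rule lborel_pair.Fubini') (auto simp: case_prod_beta)
  finally have "(\<integral>\<^sup>+r. f r \<partial>lborel) * (\<integral>\<^sup>+r. g r \<partial>lborel)
    = (\<integral>\<^sup>+r. \<integral>\<^sup>+p. indicator {0..} p * (f r * g (r + p)) \<partial>lborel \<partial>lborel)
    + (\<integral>\<^sup>+r. \<integral>\<^sup>+p. indicator {0..} p * (g r * f (r + p)) \<partial>lborel \<partial>lborel)"
    unfolding shift[OF assms] shift[OF assms(2,1)] .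
  also have "\<dots> = (\<integral>\<^sup>+r. (\<integral>\<^sup>+p. indicator {0..} p * (f r * g (r + p)) \<partial>lborel) +
      (\<integral>\<^sup>+p. indicator {0..} p * (g r * f (r + p)) \<partial>lborel) \<partial>lborel)"
    by (rule nn_integral_add[symmetric]) measurable
  also have "\<dots> = (\<integral>\<^sup>+r. \<integral>\<^sup>+p. indicator {0..} p * (f r * g (r + p) + g r * f (r + p)) \<partial>lborel \<partial>lborel)"
    unfolding distrib_left by (intro nn_integral_cong nn_integral_add[symmetric]) measurable
  finally show ?thesis .
qed

section \<open>The inverse stable subordinator\<close>

lemma inverse_subordinator_nonneg: "inverse_subordinator D t \<omega> \<ge> 0"
  unfolding inverse_subordinator_def by (auto intro!: cInf_greatest)

lemma inverse_subordinator_le: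
  assumes "r \<ge> 0" "D r \<omega> > t"
  shows "inverse_subordinator D t \<omega> \<le> r"
  using assms unfolding inverse_subordinator_def
  by (auto intro!: cInf_lower bdd_belowI[of _ 0])

lemma inverse_subordinator_less_imp:
  assumes "\<exists>r\<ge>0. D r \<omega> > t" "inverse_subordinator D t \<omega> < x"
  obtains r where "0 \<le> r" "r < x" "D r \<omega> > t"
proof -
  have "Inf {r. r \<ge> 0 \<and> D r \<omega> > t} < x"
    using assms unfolding inverse_subordinator_def by simp
  then obtain r where "r \<in> {r. r \<ge> 0 \<and> D r \<omega> > t}" "r < x"
    using assms(1) by (subst (asm) cInf_less_iff) (auto intro!: bdd_belowI[of _ 0])
  with that show thesis by auto
qed

text \<open>The existence hypothesis sits at the larger level on purpose: if the path never exceeds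
  \<open>t\<close>, the default value 0 at \<open>t\<close> may lie below the value at
  \<open>s\<close>.\<close>

lemma inverse_subordinator_mono:
  assumes "\<exists>r\<ge>0. D r \<omega> > t" "s \<le> t"
  shows "inverse_subordinator D s \<omega> \<le> inverse_subordinator D t \<omega>"
proof (rule ccontr)
  assume "\<not> ?thesis"
  then have "inverse_subordinator D t \<omega> < inverse_subordinator D s \<omega>" by simp
  then obtain r where "0 \<le> r" "r < inverse_subordinator D s \<omega>" "D r \<omega> > t"
    using inverse_subordinator_less_imp[where D=D and \<omega>=\<omega> and t=t, OF assms(1)] by blast
  with inverse_subordinator_le[where r=r and t=s and D=D and \<omega>=\<omega>] assms(2) show False by simp
qed

text \<open>A time \<open>r\<close> at which the path exceeds \<open>t\<close> bounds the inverse at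
  every level below \<open>D r \<omega>\<close>, hence throughout a right neighbourhood of
  \<open>t\<close>; if there is no such time, the inverse is 0 from \<open>t\<close> onwards. The
  second conjunct records that the limit is approached from above, as composition with a merely
  right-continuous process requires.\<close>

lemma inverse_subordinator_right_cont:
  "((\<lambda>t. inverse_subordinator D t \<omega>) \<longlongrightarrow> inverse_subordinator D t \<omega>) (at_right t)
   \<and> (\<forall>\<^sub>F u in at_right t. inverse_subordinator D u \<omega> \<ge> inverse_subordinator D t \<omega>)"
proof (cases "\<exists>r\<ge>0. D r \<omega> > t")
  case True
  have mono: "inverse_subordinator D t \<omega> \<le> inverse_subordinator D u \<omega> \<and> inverse_subordinator D u \<omega> \<le> r"
    if "t < u" "u < D r \<omega>" "r \<ge> 0" for u r
    using inverse_subordinator_mono[where D=D and \<omega>=\<omega> and t=u and s=t] inverse_subordinator_le[where r=r and t=u and D=D and \<omega>=\<omega>] that by auto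
  have ev: "\<forall>\<^sub>F u in at_right t. t < u \<and> u < D r \<omega>" if "D r \<omega> > t" for r
    using that by (auto simp: eventually_at_right[OF that])
  obtain r0 where r0: "r0 \<ge> 0" "D r0 \<omega> > t" using True by blast
  have lower: "\<forall>\<^sub>F u in at_right t. inverse_subordinator D u \<omega> \<ge> inverse_subordinator D t \<omega>"
    using ev[OF r0(2)] by eventually_elim (use mono r0 in blast)
  moreover have "((\<lambda>t. inverse_subordinator D t \<omega>) \<longlongrightarrow> inverse_subordinator D t \<omega>) (at_right t)"
  proof (rule order_tendstoI)
    fix a assume "a < inverse_subordinator D t \<omega>"
    with lower show "\<forall>\<^sub>F u in at_right t. a < inverse_subordinator D u \<omega>"
      by (auto elim: eventually_mono)
  next
    fix a assume "inverse_subordinator D t \<omega> < a"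
    then obtain r where r: "0 \<le> r" "r < a" "D r \<omega> > t"
      by (rule inverse_subordinator_less_imp[where D=D and \<omega>=\<omega> and t=t, OF True])
    show "\<forall>\<^sub>F u in at_right t. inverse_subordinator D u \<omega> < a"
      using ev[OF r(3)] by eventually_elim (use mono r in force)
  qed
  ultimately show ?thesis by blast
next
  case False
  then have "\<not> (\<exists>r\<ge>0. D r \<omega> > u)" if "u > t" for u
    using that by (meson less_trans)
  then have eq: "\<forall>\<^sub>F u in at_right t. inverse_subordinator D u \<omega> = 0"
    by (auto simp: eventually_at_filter inverse_subordinator_def intro!: always_eventually)
  have 0: "inverse_subordinator D t \<omega> = 0" using False by (auto simp: inverse_subordinator_def)
  show ?thesis unfolding 0
    using eq by (auto intro: tendsto_eventually elim: eventually_mono)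
qed

lemma time_change_inverse_right_cont:
  assumes N: "\<And>t. t \<ge> 0 \<Longrightarrow> ((\<lambda>r. N r \<omega>) \<longlongrightarrow> N t \<omega>) (at_right t)"
  shows "((\<lambda>t. time_change N (inverse_subordinator D) t \<omega>) \<longlongrightarrow> time_change N (inverse_subordinator D) t \<omega>) (at_right t)"
proof -
  let ?E = "\<lambda>t. inverse_subordinator D t \<omega>"
  have "continuous (at (?E t) within {?E t..}) (\<lambda>r. N r \<omega>)"
    using N[OF inverse_subordinator_nonneg] by (simp add: continuous_within at_within_Ici_at_right)
  from continuous_within_tendsto_compose[OF this, of ?E "at_right t"]
  show ?thesis
    using inverse_subordinator_right_cont[of D \<omega> t] unfolding time_change_def by auto
qed

text \<open>A monotone path makes the set of times with value at most \<open>t\<close> an interval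
  starting at 0. Whether its right endpoint belongs to it stays open, and the endpoint has measure
  0.\<close>

lemma inverse_subordinator_eq_nn_integral:
  assumes D: "\<And>r s. 0 \<le> r \<Longrightarrow> r \<le> s \<Longrightarrow> D r \<omega> \<le> D s \<omega>" and ex: "\<exists>r\<ge>0. D r \<omega> > t"
  shows "ennreal (inverse_subordinator D t \<omega>) = (\<integral>\<^sup>+r. indicator {0..} r * indicator {..t} (D r \<omega>) \<partial>lborel)"
proof -
  let ?E = "inverse_subordinator D t \<omega>"
  have "(\<integral>\<^sup>+r. indicator {0..} r * indicator {..t} (D r \<omega>) \<partial>lborel) = (\<integral>\<^sup>+r. indicator {0..?E} r \<partial>lborel)"
  proof (rule nn_integral_cong_AE)
    have "AE r in lborel. r \<noteq> ?E" by (rule AE_lborel_singleton)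
    then show "AE r in lborel. indicator {0..} r * indicator {..t} (D r \<omega>) = (indicator {0..?E} r :: ennreal)"
    proof eventually_elim
      case (elim r)
      have "D r \<omega> \<le> t" if "0 \<le> r" "r < ?E"
        using inverse_subordinator_le[where r=r and t=t and D=D and \<omega>=\<omega>] that by force
      moreover have "D r \<omega> > t" if r: "r > ?E"
      proof -
        obtain r' where "0 \<le> r'" "r' < r" "D r' \<omega> > t"
          using inverse_subordinator_less_imp[where D=D and \<omega>=\<omega> and t=t, OF ex r] by blast
        with D[of r' r] show ?thesis by simp
      qed
      ultimately show ?case using elim by (cases r ?E rule: linorder_cases) (auto simp: indicator_def)
    qed
  qed
  also have "\<dots> = ennreal ?E"
    using inverse_subordinator_nonneg[of D t \<omega>] by simp
  finally show ?thesis by simp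
qed

section \<open>First and second moments of the inverse stable subordinator\<close>

context prob_space
begin

text \<open>E[exp(- D 1)] = exp(-1) excludes a degenerate \<open>D 1\<close>, so the general
  divergence result applies. Almost surely, then, the inverse never falls back on its default
  value.\<close>

lemma stable_subordinator_unbounded:
  assumes D: "stable_subordinator M b D"
  shows "AE \<omega> in M. \<forall>t. \<exists>r\<ge>0. D r \<omega> > t"
proof -
  have sub: "subordinator M D" using D by (simp add: stable_subordinator_def)
  have "\<not> (AE \<omega> in M. D 1 \<omega> = 0)"
  proof
    assume "AE \<omega> in M. D 1 \<omega> = 0"
    then have "AE \<omega> in M. exp (- 1 * D 1 \<omega>) = 1" by eventually_elim simp
    then have "expectation (\<lambda>\<omega>. exp (- 1 * D 1 \<omega>)) = expectation (\<lambda>_. 1)"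
      using levy_process_measurable[OF subordinatorD(1)[OF sub], of 1]
      by (intro integral_cong_AE) auto
    also have "\<dots> = 1" by (simp add: prob_space)
    also have "expectation (\<lambda>\<omega>. exp (- 1 * D 1 \<omega>)) = exp (- 1 * 1 powr b)"
      using D unfolding stable_subordinator_def by (metis zero_le_one)
    finally show False by simp
  qed
  from subordinator_tendsto_infinity[OF sub this] show ?thesis
  proof eventually_elim
    case (elim \<omega>)
    show ?case
    proof
      fix t
      have "\<forall>\<^sub>F r in at_top. D r \<omega> > t \<and> r \<ge> 0"
        using elim by (intro eventually_conj eventually_ge_at_top) (auto simp: filterlim_at_top_dense)
      then show "\<exists>r\<ge>0. D r \<omega> > t"
        by (metis (mono_tags, lifting) eventually_at_top_linorder order_refl)
    qed
  qed
qed

lemma inverse_stable_mono_AE: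
  assumes "stable_subordinator M b D" "s \<le> t"
  shows "AE \<omega> in M. inverse_subordinator D s \<omega> \<le> inverse_subordinator D t \<omega>"
  using stable_subordinator_unbounded[OF assms(1)]
proof eventually_elim
  case (elim \<omega>)
  from elim[rule_format, of t] assms(2) show ?case by (rule inverse_subordinator_mono)
qed

lemma inverse_stable_nn_expectation:
  assumes D: "stable_subordinator M b D" and b: "0 < b" and t: "t \<ge> 0"
  shows "(\<integral>\<^sup>+\<omega>. ennreal (inverse_subordinator D t \<omega>) \<partial>M) = ennreal (t powr b / Gamma (1 + b))"
proof -
  have sub: "subordinator M D" using D by (simp add: stable_subordinator_def)
  note subD = subordinatorD[OF sub]
  interpret M_lborel: pair_sigma_finite M lborel by standard
  have ev_meas: "(\<lambda>(\<omega>, r). path_eval D r \<omega>) \<in> borel_measurable (M \<Otimes>\<^sub>M borel)"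
    by (rule measurable_path_eval) (rule right_cont_processD(1)[OF subD(2)])
  have [measurable]: "(\<lambda>(\<omega>, r). path_eval D r \<omega>) \<in> borel_measurable (M \<Otimes>\<^sub>M lborel)"
    using ev_meas by measurable
  have ev: "path_eval D r \<omega> = D r \<omega>" if "\<omega> \<in> space M" "r \<ge> 0" for r \<omega>
    using right_cont_processD(2)[OF subD(2)] that .
  have "(\<integral>\<^sup>+\<omega>. ennreal (inverse_subordinator D t \<omega>) \<partial>M)
      = (\<integral>\<^sup>+\<omega>. \<integral>\<^sup>+r. indicator {0..} r * indicator {..t} (path_eval D r \<omega>) \<partial>lborel \<partial>M)"
  proof (rule nn_integral_cong_AE)
    show "AE \<omega> in M. ennreal (inverse_subordinator D t \<omega>)
        = (\<integral>\<^sup>+r. indicator {0..} r * indicator {..t} (path_eval D r \<omega>) \<partial>lborel)"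
      using stable_subordinator_unbounded[OF D] AE_space
    proof eventually_elim
      case (elim \<omega>)
      have "ennreal (inverse_subordinator D t \<omega>) = (\<integral>\<^sup>+r. indicator {0..} r * indicator {..t} (D r \<omega>) \<partial>lborel)"
        using elim subD(3) by (intro inverse_subordinator_eq_nn_integral) auto
      also have "\<dots> = (\<integral>\<^sup>+r. indicator {0..} r * indicator {..t} (path_eval D r \<omega>) \<partial>lborel)"
        using elim ev by (intro nn_integral_cong) (auto simp: indicator_def)
      finally show ?case .
    qed
  qed
  also have "\<dots> = (\<integral>\<^sup>+r. \<integral>\<^sup>+\<omega>. indicator {0..} r * indicator {..t} (path_eval D r \<omega>) \<partial>M \<partial>lborel)"
    by (rule M_lborel.Fubini'[symmetric]) (auto simp: case_prod_beta)
  also have "\<dots> = (\<integral>\<^sup>+r. indicator {0..} r * (\<integral>\<^sup>+\<omega>. indicator {..t} (D r \<omega>) \<partial>M) \<partial>lborel)"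
    using ev by (intro nn_integral_cong) (auto simp: indicator_def intro!: nn_integral_cong)
  also have "\<dots> = (\<integral>\<^sup>+x. indicator {..t} x \<partial>potential_measure M D)"
    by (rule nn_integral_potential_measure[OF subD(2), symmetric]) measurable
  also have "\<dots> = ennreal (t powr b / Gamma (1 + b))"
    unfolding potential_measure_stable[OF D b] by (rule stable_potential_atMost[OF b t])
  finally show ?thesis .
qed

text \<open>Given \<open>r\<close>, the increment of \<open>D\<close> over the next \<open>p\<close>
  time units is an independent copy of \<open>D p\<close>. Integrating over \<open>p\<close>
  collects that copy into one potential measure, integrating over \<open>r\<close> collects
  \<open>D r\<close> into a second one; the rest is Tonelli.\<close>

lemma nn_integral_potential_conv:
  assumes D: "stable_subordinator M b D" and b: "0 < b"
  shows "(\<integral>\<^sup>+\<omega>. \<integral>\<^sup>+r. \<integral>\<^sup>+p. indicator {0..} r * (indicator {0..} p *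
           (indicator {..s} (path_eval D r \<omega>) * indicator {..t} (path_eval D (r + p) \<omega>))) \<partial>lborel \<partial>lborel \<partial>M)
    = potential_conv b s t"
proof -
  have sub: "subordinator M D" using D by (simp add: stable_subordinator_def)
  note subD = subordinatorD[OF sub]
  interpret M_lborel: pair_sigma_finite M lborel by standard
  have pe[measurable (raw)]: "(\<lambda>z. path_eval D (g z) (f z)) \<in> borel_measurable N"
    if "f \<in> measurable N M" "g \<in> borel_measurable N" for f g and N :: "'z measure"
    using that by (intro measurable_path_eval_compose[of D M] right_cont_processD(1)[OF subD(2)]) auto
  have ev: "path_eval D r \<omega> = D r \<omega>" if "\<omega> \<in> space M" "r \<ge> 0" for r \<omega>
    using right_cont_processD(2)[OF subD(2)] that .
  let ?U = "stable_potential b"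
  interpret U: sigma_finite_measure ?U by (rule sigma_finite_stable_potential)
  interpret LU: pair_sigma_finite lborel ?U by standard
  let ?f = "\<lambda>r p \<omega>. indicator {0..} r * (indicator {0..} p *
           (indicator {..s} (path_eval D r \<omega>) * indicator {..t} (path_eval D (r + p) \<omega>))) :: ennreal"
  let ?g = "\<lambda>x y. indicator {..s} x * indicator {..t} (x + y) :: ennreal"
  have g_meas[measurable]: "(\<lambda>(x, y). ?g x y) \<in> borel_measurable (borel \<Otimes>\<^sub>M borel)"
    by measurable
  have "(\<integral>\<^sup>+\<omega>. \<integral>\<^sup>+r. \<integral>\<^sup>+p. ?f r p \<omega> \<partial>lborel \<partial>lborel \<partial>M)
      = (\<integral>\<^sup>+r. \<integral>\<^sup>+\<omega>. \<integral>\<^sup>+p. ?f r p \<omega> \<partial>lborel \<partial>M \<partial>lborel)"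
    by (rule M_lborel.Fubini'[symmetric]) measurable
  also have "\<dots> = (\<integral>\<^sup>+r. \<integral>\<^sup>+p. \<integral>\<^sup>+\<omega>. ?f r p \<omega> \<partial>M \<partial>lborel \<partial>lborel)"
    by (intro nn_integral_cong M_lborel.Fubini'[symmetric]) measurable
  also have "\<dots> = (\<integral>\<^sup>+r. indicator {0..} r * (\<integral>\<^sup>+p. indicator {0..} p * (\<integral>\<^sup>+\<omega>'. \<integral>\<^sup>+\<omega>. ?g (D r \<omega>) (D p \<omega>') \<partial>M \<partial>M) \<partial>lborel) \<partial>lborel)"
  proof (rule nn_integral_cong)
    fix r :: real
    show "(\<integral>\<^sup>+p. \<integral>\<^sup>+\<omega>. ?f r p \<omega> \<partial>M \<partial>lborel)
      = indicator {0..} r * (\<integral>\<^sup>+p. indicator {0..} p * (\<integral>\<^sup>+\<omega>'. \<integral>\<^sup>+\<omega>. ?g (D r \<omega>) (D p \<omega>') \<partial>M \<partial>M) \<partial>lborel)"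
    proof (cases "r \<ge> 0")
      case r: True
      have "(\<integral>\<^sup>+\<omega>. ?f r p \<omega> \<partial>M) = indicator {0..} p * (\<integral>\<^sup>+\<omega>'. \<integral>\<^sup>+\<omega>. ?g (D r \<omega>) (D p \<omega>') \<partial>M \<partial>M)" for p
      proof (cases "p \<ge> 0")
        case p: True
        have "(\<integral>\<^sup>+\<omega>. ?f r p \<omega> \<partial>M) = (\<integral>\<^sup>+\<omega>. (\<lambda>(x, y). ?g x y) (D r \<omega>, D (r + p) \<omega> - D r \<omega>) \<partial>M)"
          using r p ev by (intro nn_integral_cong) auto
        also have "\<dots> = (\<integral>\<^sup>+\<omega>'. \<integral>\<^sup>+\<omega>. (\<lambda>(x, y). ?g x y) (D r \<omega>, D (r + p - r) \<omega>') \<partial>M \<partial>M)"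
          using r p by (intro levy_process_nn_integral[OF subD(1) _ _ g_meas]) auto
        finally show ?thesis using p by simp
      qed simp
      with r show ?thesis by simp
    qed simp
  qed
  also have "\<dots> = (\<integral>\<^sup>+r. indicator {0..} r * (\<integral>\<^sup>+y. \<integral>\<^sup>+\<omega>. ?g (D r \<omega>) y \<partial>M \<partial>?U) \<partial>lborel)"
  proof (rule nn_integral_cong)
    fix r :: real
    show "indicator {0..} r * (\<integral>\<^sup>+p. indicator {0..} p * (\<integral>\<^sup>+\<omega>'. \<integral>\<^sup>+\<omega>. ?g (D r \<omega>) (D p \<omega>') \<partial>M \<partial>M) \<partial>lborel)
      = indicator {0..} r * (\<integral>\<^sup>+y. \<integral>\<^sup>+\<omega>. ?g (D r \<omega>) y \<partial>M \<partial>?U)"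
    proof (cases "r \<ge> 0")
      case True
      then have [measurable]: "D r \<in> borel_measurable M"
        by (rule right_cont_processD(1)[OF subD(2)])
      have "(\<integral>\<^sup>+y. \<integral>\<^sup>+\<omega>. ?g (D r \<omega>) y \<partial>M \<partial>?U)
        = (\<integral>\<^sup>+p. indicator {0..} p * (\<integral>\<^sup>+\<omega>'. \<integral>\<^sup>+\<omega>. ?g (D r \<omega>) (D p \<omega>') \<partial>M \<partial>M) \<partial>lborel)"
        unfolding potential_measure_stable[OF D b, symmetric]
        by (rule nn_integral_potential_measure[OF subD(2)]) measurable
      then show ?thesis by simp
    qed simp
  qed
  also have "\<dots> = (\<integral>\<^sup>+r. \<integral>\<^sup>+y. indicator {0..} r * (\<integral>\<^sup>+\<omega>. ?g (path_eval D r \<omega>) y \<partial>M) \<partial>?U \<partial>lborel)"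
  proof (rule nn_integral_cong)
    fix r :: real
    have "(\<integral>\<^sup>+y. indicator {0..} r * (\<integral>\<^sup>+\<omega>. ?g (path_eval D r \<omega>) y \<partial>M) \<partial>?U)
       = indicator {0..} r * (\<integral>\<^sup>+y. \<integral>\<^sup>+\<omega>. ?g (path_eval D r \<omega>) y \<partial>M \<partial>?U)"
      by (rule nn_integral_cmult) measurable
    also have "\<dots> = indicator {0..} r * (\<integral>\<^sup>+y. \<integral>\<^sup>+\<omega>. ?g (D r \<omega>) y \<partial>M \<partial>?U)"
      using ev by (auto simp: indicator_def intro!: nn_integral_cong)
    finally show "indicator {0..} r * (\<integral>\<^sup>+y. \<integral>\<^sup>+\<omega>. ?g (D r \<omega>) y \<partial>M \<partial>?U)
      = (\<integral>\<^sup>+y. indicator {0..} r * (\<integral>\<^sup>+\<omega>. ?g (path_eval D r \<omega>) y \<partial>M) \<partial>?U)" by simp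
  qed
  also have "\<dots> = (\<integral>\<^sup>+y. \<integral>\<^sup>+r. indicator {0..} r * (\<integral>\<^sup>+\<omega>. ?g (path_eval D r \<omega>) y \<partial>M) \<partial>lborel \<partial>?U)"
    by (rule LU.Fubini'[symmetric]) measurable
  also have "\<dots> = (\<integral>\<^sup>+y. \<integral>\<^sup>+x. ?g x y \<partial>?U \<partial>?U)"
  proof (rule nn_integral_cong)
    fix y
    have "(\<integral>\<^sup>+x. ?g x y \<partial>?U) = (\<integral>\<^sup>+r. indicator {0..} r * (\<integral>\<^sup>+\<omega>. ?g (D r \<omega>) y \<partial>M) \<partial>lborel)"
      unfolding potential_measure_stable[OF D b, symmetric]
      by (rule nn_integral_potential_measure[OF subD(2)]) measurable
    also have "\<dots> = (\<integral>\<^sup>+r. indicator {0..} r * (\<integral>\<^sup>+\<omega>. ?g (path_eval D r \<omega>) y \<partial>M) \<partial>lborel)"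
      using ev by (intro nn_integral_cong) (auto simp: indicator_def intro!: nn_integral_cong)
    finally show "(\<integral>\<^sup>+r. indicator {0..} r * (\<integral>\<^sup>+\<omega>. ?g (path_eval D r \<omega>) y \<partial>M) \<partial>lborel) = (\<integral>\<^sup>+x. ?g x y \<partial>?U)" ..
  qed
  also have "\<dots> = (\<integral>\<^sup>+x. \<integral>\<^sup>+y. ?g x y \<partial>?U \<partial>?U)"
    by (rule pair_sigma_finite.Fubini') (unfold_locales, measurable)
  also have "\<dots> = potential_conv b s t"
    unfolding potential_conv_def by (intro nn_integral_cong nn_integral_cmult) measurable
  finally show ?thesis .
qed

text \<open>Both occupation times are expanded over ordered pairs \<open>r\<close>,
  \<open>r + p\<close>. If level \<open>s\<close> is tested at the earlier time, the pair
  contributes to \<open>potential_conv b s t\<close>. If it is tested at the later time, then D(r)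
  \<le> D(r + p) \<le> s \<le> t absorbs the condition at level \<open>t\<close> and leaves
  \<open>potential_conv b s s\<close>.\<close>

lemma inverse_stable_nn_expectation_mult:
  assumes D: "stable_subordinator M b D" and b: "0 < b" and st: "0 \<le> s" "s \<le> t"
  shows "(\<integral>\<^sup>+\<omega>. ennreal (inverse_subordinator D s \<omega>) * ennreal (inverse_subordinator D t \<omega>) \<partial>M)
    = potential_conv b s t + potential_conv b s s"
proof -
  have sub: "subordinator M D" using D by (simp add: stable_subordinator_def)
  note subD = subordinatorD[OF sub]
  have pe[measurable (raw)]: "(\<lambda>z. path_eval D (g z) (f z)) \<in> borel_measurable N"
    if "f \<in> measurable N M" "g \<in> borel_measurable N" for f g and N :: "'z measure"
    using that by (intro measurable_path_eval_compose[of D M] right_cont_processD(1)[OF subD(2)]) auto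
  have ev: "path_eval D r \<omega> = D r \<omega>" if "\<omega> \<in> space M" "r \<ge> 0" for r \<omega>
    using right_cont_processD(2)[OF subD(2)] that .
  let ?f = "\<lambda>s t r p \<omega>. indicator {0..} r * (indicator {0..} p *
           (indicator {..s} (path_eval D r \<omega>) * indicator {..t} (path_eval D (r + p) \<omega>))) :: ennreal"
  have "(\<integral>\<^sup>+\<omega>. ennreal (inverse_subordinator D s \<omega>) * ennreal (inverse_subordinator D t \<omega>) \<partial>M)
     = (\<integral>\<^sup>+\<omega>. (\<integral>\<^sup>+r. \<integral>\<^sup>+p. ?f s t r p \<omega> \<partial>lborel \<partial>lborel) + (\<integral>\<^sup>+r. \<integral>\<^sup>+p. ?f s s r p \<omega> \<partial>lborel \<partial>lborel) \<partial>M)"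
  proof (rule nn_integral_cong_AE)
    show "AE \<omega> in M. ennreal (inverse_subordinator D s \<omega>) * ennreal (inverse_subordinator D t \<omega>)
        = (\<integral>\<^sup>+r. \<integral>\<^sup>+p. ?f s t r p \<omega> \<partial>lborel \<partial>lborel) + (\<integral>\<^sup>+r. \<integral>\<^sup>+p. ?f s s r p \<omega> \<partial>lborel \<partial>lborel)"
      using stable_subordinator_unbounded[OF D] AE_space
    proof eventually_elim
      case (elim \<omega>)
      have [measurable]: "(\<lambda>r. path_eval D (g r) \<omega>) \<in> borel_measurable N"
        if "g \<in> borel_measurable N" for g and N :: "'z measure"
        using elim(2) that by measurable
      let ?A = "\<lambda>t r. indicator {0..} r * indicator {..t} (path_eval D r \<omega>) :: ennreal"
      have E: "ennreal (inverse_subordinator D u \<omega>) = (\<integral>\<^sup>+r. ?A u r \<partial>lborel)" for u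
      proof -
        have "ennreal (inverse_subordinator D u \<omega>) = (\<integral>\<^sup>+r. indicator {0..} r * indicator {..u} (D r \<omega>) \<partial>lborel)"
          using elim subD(3) by (intro inverse_subordinator_eq_nn_integral) auto
        also have "\<dots> = (\<integral>\<^sup>+r. ?A u r \<partial>lborel)"
          using elim ev by (intro nn_integral_cong) (auto simp: indicator_def)
        finally show ?thesis .
      qed
      have "ennreal (inverse_subordinator D s \<omega>) * ennreal (inverse_subordinator D t \<omega>)
        = (\<integral>\<^sup>+r. \<integral>\<^sup>+p. indicator {0..} p * (?A s r * ?A t (r + p) + ?A t r * ?A s (r + p)) \<partial>lborel \<partial>lborel)"
        unfolding E by (rule nn_integral_mult_eq_ordered) measurable
      also have "\<dots> = (\<integral>\<^sup>+r. \<integral>\<^sup>+p. ?f s t r p \<omega> + ?f s s r p \<omega> \<partial>lborel \<partial>lborel)"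
      proof (rule nn_integral_cong, rule nn_integral_cong)
        fix r p :: real
        show "indicator {0..} p * (?A s r * ?A t (r + p) + ?A t r * ?A s (r + p)) = ?f s t r p \<omega> + ?f s s r p \<omega>"
        proof (cases "r \<ge> 0 \<and> p \<ge> 0")
          case True
          have "D r \<omega> \<le> D (r + p) \<omega>" using subD(3)[OF elim(2), of r "r + p"] True by simp
          with True elim ev st show ?thesis by (auto simp: indicator_def)
        qed (auto simp: indicator_def)
      qed
      also have "\<dots> = (\<integral>\<^sup>+r. (\<integral>\<^sup>+p. ?f s t r p \<omega> \<partial>lborel) + (\<integral>\<^sup>+p. ?f s s r p \<omega> \<partial>lborel) \<partial>lborel)"
        by (intro nn_integral_cong nn_integral_add) measurable
      also have "\<dots> = (\<integral>\<^sup>+r. \<integral>\<^sup>+p. ?f s t r p \<omega> \<partial>lborel \<partial>lborel) + (\<integral>\<^sup>+r. \<integral>\<^sup>+p. ?f s s r p \<omega> \<partial>lborel \<partial>lborel)"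
        by (rule nn_integral_add) measurable
      finally show ?case .
    qed
  qed
  also have "\<dots> = (\<integral>\<^sup>+\<omega>. (\<integral>\<^sup>+r. \<integral>\<^sup>+p. ?f s t r p \<omega> \<partial>lborel \<partial>lborel) \<partial>M) + (\<integral>\<^sup>+\<omega>. (\<integral>\<^sup>+r. \<integral>\<^sup>+p. ?f s s r p \<omega> \<partial>lborel \<partial>lborel) \<partial>M)"
    by (rule nn_integral_add) measurable
  also have "\<dots> = potential_conv b s t + potential_conv b s s"
    by (simp only: nn_integral_potential_conv[OF D b])
  finally show ?thesis .
qed

end

section \<open>Moments of the fractional Poisson process\<close>

text \<open>Each factor k cancels against the factorial and shifts the series by one index. The
  factor \<open>exp r\<close> on the right is the Poisson normalisation, divided out later.\<close>

lemma sums_poisson_moments: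
  fixes r :: real
  shows "(\<lambda>k. real k * (r ^ k / fact k)) sums (r * exp r)"
    and "(\<lambda>k. (real k)\<^sup>2 * (r ^ k / fact k)) sums ((r + r\<^sup>2) * exp r)"
proof -
  have 0: "(\<lambda>k. r ^ k / fact k) sums exp r"
    using exp_converges[of r] by (simp add: divide_inverse mult.commute)
  have step: "real (Suc k) * (r ^ Suc k / fact (Suc k)) = r * (r ^ k / fact k)" for k
    by (simp add: field_simps del: of_nat_Suc)
  have "(\<lambda>k. real (Suc k) * (r ^ Suc k / fact (Suc k))) sums (r * exp r)"
    unfolding step by (rule sums_mult[OF 0])
  from sums_Suc[OF this] show 1: "(\<lambda>k. real k * (r ^ k / fact k)) sums (r * exp r)" by simp
  have step2: "(real (Suc k))\<^sup>2 * (r ^ Suc k / fact (Suc k)) = r * (real k * (r ^ k / fact k) + r ^ k / fact k)" for k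
  proof -
    have "(real (Suc k))\<^sup>2 * (r ^ Suc k / fact (Suc k)) = real (Suc k) * (real (Suc k) * (r ^ Suc k / fact (Suc k)))"
      by (simp only: power2_eq_square mult.assoc)
    also have "\<dots> = real (Suc k) * (r * (r ^ k / fact k))" by (simp only: step)
    also have "real (Suc k) * (r * x) = r * (real k * x + x)" for x by (simp add: algebra_simps)
    finally show ?thesis .
  qed
  have "(\<lambda>k. (real (Suc k))\<^sup>2 * (r ^ Suc k / fact (Suc k))) sums (r * (r * exp r + exp r))"
    unfolding step2 by (intro sums_mult sums_add 1 0)
  from sums_Suc[OF this] show "(\<lambda>k. (real k)\<^sup>2 * (r ^ k / fact k)) sums ((r + r\<^sup>2) * exp r)"
    by (simp add: power2_eq_square algebra_simps)
qed

lemma nn_integral_poisson_pmf: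
  assumes r: "r > 0" and f: "\<And>k :: nat. f k \<ge> 0"
    and sums: "(\<lambda>k. f k * (r ^ k / fact k)) sums (s * exp r)"
  shows "(\<integral>\<^sup>+k. ennreal (f k) \<partial>measure_pmf (poisson_pmf r)) = ennreal s"
proof -
  have sums': "(\<lambda>k. pmf (poisson_pmf r) k * f k) sums s"
  proof -
    have "(\<lambda>k. f k * (r ^ k / fact k) * exp (- r)) sums (s * exp r * exp (- r))"
      by (rule sums_mult2[OF sums])
    then show ?thesis using r by (simp add: exp_minus mult.commute mult.left_commute divide_inverse)
  qed
  have "(\<integral>\<^sup>+k. ennreal (f k) \<partial>measure_pmf (poisson_pmf r))
      = (\<integral>\<^sup>+k. ennreal (pmf (poisson_pmf r) k) * ennreal (f k) \<partial>count_space UNIV)"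
    by (rule nn_integral_measure_pmf)
  also have "\<dots> = (\<Sum>k. ennreal (pmf (poisson_pmf r) k * f k))"
    using f by (simp add: nn_integral_count_space_nat ennreal_mult del: pmf_poisson)
  also have "\<dots> = ennreal s"
    using sums' f by (intro suminf_ennreal_eq) auto
  finally show ?thesis .
qed

section \<open>Two-time moments before and after the inverse stable time change\<close>

context prob_space
begin

text \<open>\<open>poisson_process\<close> fixes the law of \<open>N t\<close> and not the range of
  its paths, so nonnegativity is an almost sure statement. It is what allows the truncating
  \<open>ennreal (N t \<omega>)\<close> to stand for the value itself.\<close>

lemma poisson_process_nn_integral:
  assumes N: "poisson_process M l N" and l: "l > 0" and t: "t \<ge> 0"
  shows "(\<integral>\<^sup>+\<omega>. ennreal (N t \<omega>) \<partial>M) = ennreal (l * t)"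
    and "(\<integral>\<^sup>+\<omega>. ennreal (N t \<omega>) * ennreal (N t \<omega>) \<partial>M) = ennreal (l * t + (l * t)\<^sup>2)"
    and "AE \<omega> in M. N t \<omega> \<ge> 0"
proof -
  have levy: "levy_process M N" using N by (simp add: poisson_process_def)
  note [measurable] = levy_process_measurable[OF levy t]
  have "(\<integral>\<^sup>+\<omega>. ennreal (N t \<omega>) \<partial>M) = ennreal (l * t) \<and>
    (\<integral>\<^sup>+\<omega>. ennreal (N t \<omega>) * ennreal (N t \<omega>) \<partial>M) = ennreal (l * t + (l * t)\<^sup>2) \<and>
    (AE \<omega> in M. N t \<omega> \<ge> 0)"
  \<comment> \<open>The Poisson law is prescribed for t > 0 only; at time 0 the paths themselves
    vanish.\<close>
  proof (cases "t = 0")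
    case True
    have "N t \<omega> = 0" if "\<omega> \<in> space M" for \<omega>
      using levy that True by (simp add: levy_process_def)
    then show ?thesis using True by (simp cong: nn_integral_cong_simp)
  next
    case False
    with t l have r: "l * t > 0" "t > 0" by auto
    have distr: "distr M borel (N t) = distr (measure_pmf (poisson_pmf (l * t))) borel real"
      using N r by (simp add: poisson_process_def)
    have int: "(\<integral>\<^sup>+\<omega>. f (N t \<omega>) \<partial>M) = (\<integral>\<^sup>+k. f (real k) \<partial>measure_pmf (poisson_pmf (l * t)))"
      if [measurable]: "f \<in> borel_measurable borel" for f
    proof -
      have "(\<integral>\<^sup>+\<omega>. f (N t \<omega>) \<partial>M) = (\<integral>\<^sup>+x. f x \<partial>distr M borel (N t))"
        by (subst nn_integral_distr) auto
      also have "\<dots> = (\<integral>\<^sup>+k. f (real k) \<partial>measure_pmf (poisson_pmf (l * t)))"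
        unfolding distr by (subst nn_integral_distr) auto
      finally show ?thesis .
    qed
    have "(\<integral>\<^sup>+\<omega>. ennreal (N t \<omega>) \<partial>M) = ennreal (l * t)"
      unfolding int[of ennreal, OF measurable_ennreal]
      by (rule nn_integral_poisson_pmf[OF r(1) _ sums_poisson_moments(1)]) simp
    moreover have "(\<integral>\<^sup>+\<omega>. ennreal (N t \<omega>) * ennreal (N t \<omega>) \<partial>M) = ennreal (l * t + (l * t)\<^sup>2)"
    proof -
      have "(\<integral>\<^sup>+\<omega>. ennreal (N t \<omega>) * ennreal (N t \<omega>) \<partial>M)
        = (\<integral>\<^sup>+k. ennreal (real k) * ennreal (real k) \<partial>measure_pmf (poisson_pmf (l * t)))"
        by (rule int) measurable
      also have "\<dots> = (\<integral>\<^sup>+k. ennreal ((real k)\<^sup>2) \<partial>measure_pmf (poisson_pmf (l * t)))"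
        by (intro nn_integral_cong) (simp add: power2_eq_square ennreal_mult)
      also have "\<dots> = ennreal (l * t + (l * t)\<^sup>2)"
        by (rule nn_integral_poisson_pmf[OF r(1) _ sums_poisson_moments(2)]) simp
      finally show ?thesis .
    qed
    moreover have "AE \<omega> in M. N t \<omega> \<ge> 0"
    proof -
      have "AE x in distr M borel (N t). x \<ge> 0"
        unfolding distr by (subst AE_distr_iff) auto
      then show ?thesis by (subst (asm) AE_distr_iff) auto
    qed
    ultimately show ?thesis by blast
  qed
  then show "(\<integral>\<^sup>+\<omega>. ennreal (N t \<omega>) \<partial>M) = ennreal (l * t)"
    and "(\<integral>\<^sup>+\<omega>. ennreal (N t \<omega>) * ennreal (N t \<omega>) \<partial>M) = ennreal (l * t + (l * t)\<^sup>2)"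
    and "AE \<omega> in M. N t \<omega> \<ge> 0"
    by blast+
qed

text \<open>Writing N(b) as N(a) plus an independent increment gives l a + (l a)^2 + l a l (b - a),
  which collapses to l a + l^2 a b. The factors are kept apart as extended reals so that random
  times can be substituted for \<open>a\<close> and \<open>b\<close> and integrated by
  linearity.\<close>

lemma poisson_process_nn_integral_mult:
  assumes N: "poisson_process M l N" and l: "l > 0" and ab: "0 \<le> a" "a \<le> b"
  shows "(\<integral>\<^sup>+\<omega>. ennreal (N a \<omega>) * ennreal (N b \<omega>) \<partial>M) = ennreal l * ennreal a + ennreal (l\<^sup>2) * (ennreal a * ennreal b)"
proof -
  have levy: "levy_process M N" using N by (simp add: poisson_process_def)
  have [measurable]: "N a \<in> borel_measurable M" "N b \<in> borel_measurable M"
    using levy_process_measurable[OF levy] ab by auto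
  have inc: "AE \<omega> in M. N b \<omega> - N a \<omega> \<ge> 0"
  proof -
    have "AE x in distr M borel (N (b - a)). x \<ge> 0"
      using poisson_process_nn_integral(3)[OF N l, of "b - a"] levy_process_measurable[OF levy, of "b - a"] ab
      by (subst AE_distr_iff) auto
    then have "AE x in distr M borel (\<lambda>\<omega>. N b \<omega> - N a \<omega>). x \<ge> 0"
      by (simp only: levy_process_increment_distr[OF levy ab])
    then show ?thesis by (subst (asm) AE_distr_iff) auto
  qed
  have "(\<integral>\<^sup>+\<omega>. ennreal (N a \<omega>) * ennreal (N b \<omega>) \<partial>M)
     = (\<integral>\<^sup>+\<omega>. ennreal (N a \<omega>) * ennreal (N a \<omega>) + ennreal (N a \<omega>) * ennreal (N b \<omega> - N a \<omega>) \<partial>M)"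
  proof (rule nn_integral_cong_AE)
    show "AE \<omega> in M. ennreal (N a \<omega>) * ennreal (N b \<omega>)
       = ennreal (N a \<omega>) * ennreal (N a \<omega>) + ennreal (N a \<omega>) * ennreal (N b \<omega> - N a \<omega>)"
      using inc poisson_process_nn_integral(3)[OF N l ab(1)]
      by eventually_elim (simp add: distrib_left[symmetric] ennreal_plus[symmetric] del: ennreal_plus)
  qed
  also have "\<dots> = ennreal (l * a + (l * a)\<^sup>2) + ennreal (l * a) * ennreal (l * (b - a))"
  proof -
    have "(\<integral>\<^sup>+\<omega>. ennreal (N a \<omega>) * ennreal (N b \<omega> - N a \<omega>) \<partial>M)
        = (\<integral>\<^sup>+\<omega>. ennreal (N a \<omega>) \<partial>M) * (\<integral>\<^sup>+\<omega>. ennreal (N (b - a) \<omega>) \<partial>M)"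
      by (rule levy_process_nn_integral_mult[OF levy ab]) measurable
    then show ?thesis
      using ab by (subst nn_integral_add) (simp_all add: poisson_process_nn_integral[OF N l])
  qed
  also have "\<dots> = ennreal (l * a + (l * a)\<^sup>2 + (l * a) * (l * (b - a)))"
    using ab l by (simp add: ennreal_mult[symmetric] ennreal_plus[symmetric] del: ennreal_plus)
  also have "l * a + (l * a)\<^sup>2 + (l * a) * (l * (b - a)) = l * a + l\<^sup>2 * (a * b)"
    by (simp add: power2_eq_square algebra_simps)
  also have "ennreal (l * a + l\<^sup>2 * (a * b)) = ennreal l * ennreal a + ennreal (l\<^sup>2) * (ennreal a * ennreal b)"
    using ab l by (simp add: ennreal_mult[symmetric] ennreal_plus[symmetric] del: ennreal_plus)
  finally show ?thesis .
qed

text \<open>\<open>q\<close> is the mean at time 1, namely l / Gamma(1 + b), and \<kappa> is the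
  diagonal constant of the two-fold potential. Only the middle term of the two-time moment is
  bracketed; the terms depending on \<open>s\<close> alone are exact and later produce the limit of
  the covariance.\<close>

lemma fractional_poisson_moments:
  assumes F: "fractional_poisson_process M b l F" and b: "0 < b" "b < 1" and l: "l > 0"
  obtains q \<kappa> where "q > 0" "\<kappa> > 1/2" "right_cont_process M F"
    "\<And>t. t \<ge> 0 \<Longrightarrow> AE \<omega> in M. F t \<omega> \<ge> 0"
    "\<And>t. t \<ge> 0 \<Longrightarrow> (\<integral>\<^sup>+\<omega>. ennreal (F t \<omega>) \<partial>M) = ennreal (q * t powr b)"
    "\<And>t. t \<ge> 0 \<Longrightarrow> (\<integral>\<^sup>+\<omega>. ennreal (F t \<omega>) * ennreal (F t \<omega>) \<partial>M)
      = ennreal (q * t powr b + 2 * q\<^sup>2 * \<kappa> * t powr (2 * b))"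
    "\<And>s t. 0 \<le> s \<Longrightarrow> s \<le> t \<Longrightarrow> (\<integral>\<^sup>+\<omega>. ennreal (F s \<omega>) * ennreal (F t \<omega>) \<partial>M)
      \<le> ennreal (q * s powr b + q\<^sup>2 * (s powr b * t powr b + \<kappa> * s powr (2 * b)))"
    "\<And>s t. 0 \<le> s \<Longrightarrow> s \<le> t \<Longrightarrow> (\<integral>\<^sup>+\<omega>. ennreal (F s \<omega>) * ennreal (F t \<omega>) \<partial>M)
      \<ge> ennreal (q * s powr b + q\<^sup>2 * (s powr b * (t - s) powr b + \<kappa> * s powr (2 * b)))"
proof -
  obtain N D where N: "poisson_process M l N" and D: "stable_subordinator M b D"
    and ind: "indep_processes M N (inverse_subordinator D)" and F_eq: "F = time_change N (inverse_subordinator D)"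
    using F unfolding fractional_poisson_process_def by blast
  let ?E = "inverse_subordinator D"
  define g where "g = 1 / Gamma (1 + b)"
  have g: "g > 0" unfolding g_def using b by (auto intro!: Gamma_real_pos)
  have rc: "right_cont_process M N"
    using N by (auto simp: poisson_process_def intro: levy_process_right_cont)
  have E_meas[measurable]: "?E t \<in> borel_measurable M" if "t \<ge> 0" for t
    using indep_processes_measurable[OF ind that] by simp
  obtain \<kappa> where \<kappa>: "\<kappa> > 1/2"
    "\<And>s. s \<ge> 0 \<Longrightarrow> potential_conv b s s = ennreal (\<kappa> * s powr (2 * b) / (Gamma (1 + b))\<^sup>2)"
    using potential_conv_diag[OF b] by blast
  have diag: "potential_conv b s s = ennreal (g\<^sup>2 * (\<kappa> * s powr (2 * b)))" if "s \<ge> 0" for s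
    using \<kappa>(2)[OF that] by (simp add: g_def power_divide)
  have conv_le: "potential_conv b s t \<le> ennreal (g\<^sup>2 * (s powr b * t powr b))"
    and conv_ge: "potential_conv b s t \<ge> ennreal (g\<^sup>2 * (s powr b * (t - s) powr b))" if "0 \<le> s" "s \<le> t" for s t
    using potential_conv_bounds[OF b(1) that] by (simp_all add: g_def power_divide)
  have prod: "(\<integral>\<^sup>+\<omega>. ennreal (F s \<omega>) * ennreal (F t \<omega>) \<partial>M)
      = ennreal (l * g * s powr b) + ennreal (l\<^sup>2) * (potential_conv b s t + potential_conv b s s)"
    if st: "0 \<le> s" "s \<le> t" for s t
  proof -
    have [measurable]: "?E s \<in> borel_measurable M" "?E t \<in> borel_measurable M" using st by auto
    have "(\<lambda>p. ennreal (fst p) * ennreal (snd p)) \<in> borel_measurable (borel \<Otimes>\<^sub>M borel)" by measurable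
    from time_change_decoupling[OF ind rc inverse_subordinator_nonneg, of s t, OF _ _ this]
    have "(\<integral>\<^sup>+\<omega>. ennreal (F s \<omega>) * ennreal (F t \<omega>) \<partial>M)
      = (\<integral>\<^sup>+\<omega>'. \<integral>\<^sup>+\<omega>. ennreal (N (?E s \<omega>') \<omega>) * ennreal (N (?E t \<omega>') \<omega>) \<partial>M \<partial>M)"
      using st by (simp add: F_eq)
    also have "\<dots> = (\<integral>\<^sup>+\<omega>. ennreal l * ennreal (?E s \<omega>) + ennreal (l\<^sup>2) * (ennreal (?E s \<omega>) * ennreal (?E t \<omega>)) \<partial>M)"
    \<comment> \<open>The Poisson formula needs the two inner times in order, and the inverse
      subordinator is monotone only almost surely.\<close>
    proof (rule nn_integral_cong_AE)
      show "AE \<omega>' in M. (\<integral>\<^sup>+\<omega>. ennreal (N (?E s \<omega>') \<omega>) * ennreal (N (?E t \<omega>') \<omega>) \<partial>M)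
        = ennreal l * ennreal (?E s \<omega>') + ennreal (l\<^sup>2) * (ennreal (?E s \<omega>') * ennreal (?E t \<omega>'))"
        using inverse_stable_mono_AE[OF D st(2)]
        by eventually_elim (intro poisson_process_nn_integral_mult[OF N l] inverse_subordinator_nonneg)
    qed
    also have "\<dots> = ennreal l * (\<integral>\<^sup>+\<omega>. ennreal (?E s \<omega>) \<partial>M)
        + ennreal (l\<^sup>2) * (\<integral>\<^sup>+\<omega>. ennreal (?E s \<omega>) * ennreal (?E t \<omega>) \<partial>M)"
      by (subst nn_integral_add) (auto simp: nn_integral_cmult)
    also have "\<dots> = ennreal (l * g * s powr b) + ennreal (l\<^sup>2) * (potential_conv b s t + potential_conv b s s)"
      using l inverse_stable_nn_expectation[OF D b(1) st(1)] inverse_stable_nn_expectation_mult[OF D b(1) st] g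
      by (simp add: ennreal_mult[symmetric] g_def)
    finally show ?thesis .
  qed
  \<comment> \<open>Here \<open>x\<close> takes three values: the diagonal value, the upper bound
    and the lower bound of the two-fold potential, each divided by \<open>g\<^sup>2\<close>.\<close>
  have collect: "ennreal (l * g * s powr b) + ennreal (l\<^sup>2) * (ennreal (g\<^sup>2 * x) + ennreal (g\<^sup>2 * (\<kappa> * s powr (2 * b))))
      = ennreal (l * g * s powr b + (l * g)\<^sup>2 * (x + \<kappa> * s powr (2 * b)))" if "x \<ge> 0" for s x
  proof -
    have "ennreal (g\<^sup>2 * x) + ennreal (g\<^sup>2 * (\<kappa> * s powr (2 * b))) = ennreal (g\<^sup>2 * (x + \<kappa> * s powr (2 * b)))"
      using that \<kappa>(1) by (simp add: distrib_left ennreal_plus[symmetric] del: ennreal_plus)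
    moreover have "ennreal (l\<^sup>2) * ennreal (g\<^sup>2 * (x + \<kappa> * s powr (2 * b))) = ennreal ((l * g)\<^sup>2 * (x + \<kappa> * s powr (2 * b)))"
      using that \<kappa>(1) by (subst ennreal_mult[symmetric]) (auto simp: power_mult_distrib mult.assoc)
    ultimately show ?thesis
      using that \<kappa>(1) l g by (simp add: ennreal_plus[symmetric] del: ennreal_plus)
  qed
  show thesis
  proof
    show "l * g > 0" using l g by simp
    show "\<kappa> > 1/2" by (rule \<kappa>(1))
    have F_meas: "F t \<in> borel_measurable M" if "t \<ge> 0" for t
      unfolding F_eq using time_change_right_cont_measurable[OF ind rc inverse_subordinator_nonneg that] .
    then show "right_cont_process M F"
      unfolding right_cont_process_def F_eq
      using time_change_inverse_right_cont[of N _ D] right_cont_processD(3)[OF rc] by auto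
    fix t :: real assume t: "t \<ge> 0"
    show "AE \<omega> in M. F t \<omega> \<ge> 0"
      unfolding F_eq
      by (rule time_change_AE[OF ind rc inverse_subordinator_nonneg t])
         (auto intro!: AE_I2 poisson_process_nn_integral(3)[OF N l] inverse_subordinator_nonneg)
    show "(\<integral>\<^sup>+\<omega>. ennreal (F t \<omega>) \<partial>M) = ennreal (l * g * t powr b)"
    proof -
      have [measurable]: "?E t \<in> borel_measurable M" using t by simp
      have "(\<integral>\<^sup>+\<omega>. ennreal (F t \<omega>) \<partial>M) = (\<integral>\<^sup>+\<omega>'. \<integral>\<^sup>+\<omega>. ennreal (N (?E t \<omega>') \<omega>) \<partial>M \<partial>M)"
        unfolding F_eq by (rule time_change_decoupling1[OF ind rc inverse_subordinator_nonneg t]) measurable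
      also have "\<dots> = (\<integral>\<^sup>+\<omega>. ennreal l * ennreal (?E t \<omega>) \<partial>M)"
        using l by (intro nn_integral_cong)
          (simp add: poisson_process_nn_integral(1)[OF N l inverse_subordinator_nonneg] ennreal_mult inverse_subordinator_nonneg)
      also have "\<dots> = ennreal (l * g * t powr b)"
        using l g inverse_stable_nn_expectation[OF D b(1) t]
        by (simp add: nn_integral_cmult ennreal_mult[symmetric] g_def)
      finally show ?thesis .
    qed
    show "(\<integral>\<^sup>+\<omega>. ennreal (F t \<omega>) * ennreal (F t \<omega>) \<partial>M)
      = ennreal (l * g * t powr b + 2 * (l * g)\<^sup>2 * \<kappa> * t powr (2 * b))"
      unfolding prod[OF t order_refl] diag[OF t]
      using collect[of "\<kappa> * t powr (2 * b)" t] \<kappa>(1) by (simp add: mult.assoc mult.left_commute)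
  next
    fix s t :: real assume st: "0 \<le> s" "s \<le> t"
    show "(\<integral>\<^sup>+\<omega>. ennreal (F s \<omega>) * ennreal (F t \<omega>) \<partial>M)
      \<le> ennreal (l * g * s powr b + (l * g)\<^sup>2 * (s powr b * t powr b + \<kappa> * s powr (2 * b)))"
      unfolding prod[OF st] diag[OF st(1)] collect[of "s powr b * t powr b", symmetric, simplified]
      by (intro add_mono mult_left_mono conv_le[OF st]) auto
    show "(\<integral>\<^sup>+\<omega>. ennreal (F s \<omega>) * ennreal (F t \<omega>) \<partial>M)
      \<ge> ennreal (l * g * s powr b + (l * g)\<^sup>2 * (s powr b * (t - s) powr b + \<kappa> * s powr (2 * b)))"
      unfolding prod[OF st] diag[OF st(1)] collect[of "s powr b * (t - s) powr b", symmetric, simplified]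
      by (intro add_mono mult_left_mono conv_ge[OF st]) auto
  qed
qed

end

section \<open>The tempered Mittag-Leffler clock\<close>

text \<open>The interface between the clock and the limit argument. \<open>c\<close> and
  \<open>w\<close> are the rates of mean and variance, so that \<open>Y t / t\<close> has variance
  \<open>w / t\<close>. The last clause expresses independent increments through nonnegative test
  functions, with the law of the increment left as it stands.\<close>

locale linear_clock = prob_space +
  fixes Y :: "real \<Rightarrow> 'a \<Rightarrow> real" and c w :: real
  assumes clock_measurable: "\<And>t. t \<ge> 0 \<Longrightarrow> Y t \<in> borel_measurable M"
    and clock_nonneg: "\<And>t \<omega>. t \<ge> 0 \<Longrightarrow> \<omega> \<in> space M \<Longrightarrow> Y t \<omega> \<ge> 0"
    and clock_mono: "\<And>s t \<omega>. 0 \<le> s \<Longrightarrow> s \<le> t \<Longrightarrow> \<omega> \<in> space M \<Longrightarrow> Y s \<omega> \<le> Y t \<omega>"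
    and c_pos: "c > 0"
    and clock_square_integrable: "\<And>t. t \<ge> 0 \<Longrightarrow> integrable M (\<lambda>\<omega>. (Y t \<omega>)\<^sup>2)"
    and clock_mean: "\<And>t. t \<ge> 0 \<Longrightarrow> expectation (Y t) = c * t"
    and clock_square_mean: "\<And>t. t \<ge> 0 \<Longrightarrow> expectation (\<lambda>\<omega>. (Y t \<omega>)\<^sup>2) = (c * t)\<^sup>2 + w * t"
    and clock_unbounded: "AE \<omega> in M. filterlim (\<lambda>t. Y t \<omega>) at_top at_top"
    and clock_increment: "\<And>s t f g. 0 \<le> s \<Longrightarrow> s \<le> t \<Longrightarrow> f \<in> borel_measurable borel \<Longrightarrow> g \<in> borel_measurable borel \<Longrightarrow>
       (\<integral>\<^sup>+\<omega>. f (Y s \<omega>) * g (Y t \<omega> - Y s \<omega>) \<partial>M) = (\<integral>\<^sup>+\<omega>. f (Y s \<omega>) \<partial>M) * (\<integral>\<^sup>+\<omega>. g (Y t \<omega> - Y s \<omega>) \<partial>M)"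

context prob_space
begin

text \<open>Multiplying a gamma density by x^2 gives an unnormalised gamma density whose shape is
  larger by 2.\<close>

lemma gamma_subordinator_square_integrable:
  assumes G: "gamma_subordinator M l b G" and lb: "l > 0" "b > 0" and t: "t \<ge> 0"
  shows "integrable M (\<lambda>\<omega>. (G t \<omega>)\<^sup>2)"
proof (cases "t = 0")
  case True
  have "integrable M (\<lambda>\<omega>. (G t \<omega>)\<^sup>2) \<longleftrightarrow> integrable M (\<lambda>\<omega>. 0 :: real)"
    using G True subordinatorD(5)[of M G]
    by (intro Bochner_Integration.integrable_cong) (auto simp: gamma_subordinator_def)
  then show ?thesis by simp
next
  case False
  with t lb have t: "t > 0" and bt: "b * t > 0" by auto
  let ?f = "\<lambda>x. ennreal (if x > 0 then l powr (b * t) / Gamma (b * t) * x powr (b * t - 1) * exp (- l * x) else 0)"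
  have d: "distributed M lborel (G t) ?f"
    using G t by (simp add: gamma_subordinator_def)
  have [measurable]: "G t \<in> borel_measurable M"
    using distributed_measurable[OF d] by simp
  have "(\<integral>\<^sup>+\<omega>. ennreal ((G t \<omega>)\<^sup>2) \<partial>M) = (\<integral>\<^sup>+x. ?f x * ennreal (x\<^sup>2) \<partial>lborel)"
    by (rule distributed_nn_integral[OF d, symmetric]) measurable
  also have "\<dots> = (\<integral>\<^sup>+x. ennreal (l powr (b * t) / Gamma (b * t)) *
      ennreal (if x > 0 then x powr ((b * t + 2) - 1) * exp (- l * x) else 0) \<partial>lborel)"
  proof (rule nn_integral_cong)
    fix x :: real
    show "?f x * ennreal (x\<^sup>2) = ennreal (l powr (b * t) / Gamma (b * t)) *
      ennreal (if x > 0 then x powr ((b * t + 2) - 1) * exp (- l * x) else 0)"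
    proof (cases "x > 0")
      case True
      have "x powr ((b * t + 2) - 1) = x powr (b * t - 1) * x powr 2"
        by (simp add: powr_add[symmetric])
      also have "x powr 2 = x\<^sup>2" using True by (simp add: powr_numeral)
      finally show ?thesis using True Gamma_real_pos[OF bt]
        by (simp add: ennreal_mult[symmetric] less_imp_le mult_ac)
    qed simp
  qed
  also have "\<dots> = ennreal (l powr (b * t) / Gamma (b * t)) * ennreal (Gamma (b * t + 2) / l powr (b * t + 2))"
    by (subst nn_integral_cmult) (use bt lb nn_integral_gamma_kernel[of "b * t + 2" l] in auto)
  also have "\<dots> < \<infinity>" by (simp add: ennreal_mult_less_top)
  finally show ?thesis by (intro integrableI_nonneg) auto
qed

text \<open>The untempered stable law has infinite mean, so finiteness must come from the tempering:
  the quadratic Taylor bound for the exponential gives x^2 exp(- \<mu> x) \<le> 2 / \<mu>^2, and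
  what remains is the total mass of the stable density.\<close>

lemma tempered_stable_square_integrable:
  assumes S: "tempered_stable_subordinator M a \<mu> S" and \<mu>: "\<mu> > 0" and t: "t \<ge> 0"
  shows "integrable M (\<lambda>\<omega>. (S t \<omega>)\<^sup>2)"
proof (cases "t = 0")
  case True
  have "integrable M (\<lambda>\<omega>. (S t \<omega>)\<^sup>2) \<longleftrightarrow> integrable M (\<lambda>\<omega>. 0 :: real)"
    using S True subordinatorD(5)[of M S]
    by (intro Bochner_Integration.integrable_cong) (auto simp: tempered_stable_subordinator_def)
  then show ?thesis by simp
next
  case False
  with t have t: "t > 0" by simp
  from S obtain g where g: "stable_density a g"
    and d: "\<And>t. t > 0 \<Longrightarrow> distributed M lborel (S t)
          (\<lambda>x. ennreal (if x > 0 then exp (- \<mu> * x + \<mu> powr a * t) * g x t else 0))"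
    unfolding tempered_stable_subordinator_def by blast
  have [measurable]: "(\<lambda>x. g x t) \<in> borel_measurable borel" and g0: "\<And>x. x > 0 \<Longrightarrow> g x t \<ge> 0"
    using g t unfolding stable_density_def by auto
  \<comment> \<open>At u = 0 the Laplace transform is 1, because \<open>0 powr a = 0\<close>. A
    nonintegrable function has Bochner integral 0 by convention, so this nonzero value yields
    integrability.\<close>
  have g1: "(LBINT x:{0<..}. exp (- 0 * x) * g x t) = exp (- t * 0 powr a)"
    using g t unfolding stable_density_def by blast
  have int: "set_integrable lborel {0<..} (\<lambda>x. g x t)"
  proof (rule ccontr)
    assume "\<not> ?thesis"
    then have "(LBINT x:{0<..}. exp (- 0 * x) * g x t) = 0"
      by (simp add: set_integrable_def set_lebesgue_integral_def not_integrable_integral_eq)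
    with g1 show False by simp
  qed
  have [measurable]: "S t \<in> borel_measurable M"
    using distributed_measurable[OF d[OF t]] by simp
  have "(\<integral>\<^sup>+\<omega>. ennreal ((S t \<omega>)\<^sup>2) \<partial>M)
     = (\<integral>\<^sup>+x. ennreal (if x > 0 then exp (- \<mu> * x + \<mu> powr a * t) * g x t else 0) * ennreal (x\<^sup>2) \<partial>lborel)"
    by (rule distributed_nn_integral[OF d[OF t], symmetric]) measurable
  also have "\<dots> \<le> (\<integral>\<^sup>+x. ennreal (2 / \<mu>\<^sup>2 * exp (\<mu> powr a * t)) * ennreal (norm (indicator {0<..} x *\<^sub>R g x t)) \<partial>lborel)"
  proof (rule nn_integral_mono)
    fix x :: real
    show "ennreal (if x > 0 then exp (- \<mu> * x + \<mu> powr a * t) * g x t else 0) * ennreal (x\<^sup>2)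
       \<le> ennreal (2 / \<mu>\<^sup>2 * exp (\<mu> powr a * t)) * ennreal (norm (indicator {0<..} x *\<^sub>R g x t))"
    proof (cases "x > 0")
      case True
      have "(\<mu> * x)\<^sup>2 / 2 \<le> exp (\<mu> * x)"
        using exp_lower_Taylor_quadratic[of "\<mu> * x"] True \<mu> by (smt (verit) mult_nonneg_nonneg)
      then have "x\<^sup>2 * exp (- \<mu> * x) \<le> 2 / \<mu>\<^sup>2"
        using \<mu> by (simp add: exp_minus power_mult_distrib field_simps)
      then have "x\<^sup>2 * exp (- \<mu> * x) * (exp (\<mu> powr a * t) * g x t) \<le> 2 / \<mu>\<^sup>2 * (exp (\<mu> powr a * t) * g x t)"
        using g0[OF True] by (intro mult_right_mono) auto
      moreover have "exp (- \<mu> * x + \<mu> powr a * t) = exp (- \<mu> * x) * exp (\<mu> powr a * t)"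
        by (rule exp_add)
      ultimately have le: "(exp (- \<mu> * x + \<mu> powr a * t) * g x t) * x\<^sup>2 \<le> (2 / \<mu>\<^sup>2 * exp (\<mu> powr a * t)) * g x t"
        by (simp only: mult_ac)
      have "ennreal (exp (- \<mu> * x + \<mu> powr a * t) * g x t) * ennreal (x\<^sup>2)
          = ennreal ((exp (- \<mu> * x + \<mu> powr a * t) * g x t) * x\<^sup>2)"
        using g0[OF True] by (intro ennreal_mult[symmetric]) auto
      also have "\<dots> \<le> ennreal ((2 / \<mu>\<^sup>2 * exp (\<mu> powr a * t)) * g x t)"
        using le by (rule ennreal_leI)
      also have "\<dots> = ennreal (2 / \<mu>\<^sup>2 * exp (\<mu> powr a * t)) * ennreal (g x t)"
        using g0[OF True] by (intro ennreal_mult) auto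
      finally show ?thesis using True g0[OF True] by simp
    qed simp
  qed
  also have "\<dots> = ennreal (2 / \<mu>\<^sup>2 * exp (\<mu> powr a * t)) * (\<integral>\<^sup>+x. ennreal (norm (indicator {0<..} x *\<^sub>R g x t)) \<partial>lborel)"
    by (rule nn_integral_cmult) measurable
  also have "\<dots> < \<infinity>"
    using int unfolding set_integrable_def integrable_iff_bounded by (simp add: ennreal_mult_less_top)
  finally show ?thesis by (intro integrableI_nonneg) auto
qed

text \<open>Given \<open>G\<close>, the moments of \<open>S\<close> at time \<open>G t\<close> are
  polynomials in \<open>G t\<close>, which yields the mean and the second moment. For the
  increments: given \<open>G\<close>, those of \<open>S\<close> over the two clock intervals are
  independent, with laws depending only on the lengths \<open>G s\<close> and
  \<open>G t - G s\<close>, and these lengths are themselves independent.\<close>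

lemma tempered_mittag_leffler_clock:
  assumes Y: "tempered_mittag_leffler_process M a b1 l1 \<mu> Y" and pos: "\<mu> > 0" "l1 > 0" "b1 > 0"
  obtains c w where "linear_clock M Y c w"
proof -
  from Y obtain S G where S: "tempered_stable_subordinator M a \<mu> S" and G: "gamma_subordinator M l1 b1 G"
    and ind: "indep_processes M S G" and Y_eq: "Y = time_change S G"
    unfolding tempered_mittag_leffler_process_def by blast
  have subS: "subordinator M S" and subG: "subordinator M G"
    using S G by (simp_all add: tempered_stable_subordinator_def gamma_subordinator_def)
  note SD = subordinatorD[OF subS] and GD = subordinatorD[OF subG]
  have S_nz: "\<not> (AE \<omega> in M. S 1 \<omega> = 0)"
  proof -
    obtain g where "\<forall>t>0. distributed M lborel (S t)
        (\<lambda>x. ennreal (if x > 0 then exp (- \<mu> * x + \<mu> powr a * t) * g x t else 0))"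
      using S unfolding tempered_stable_subordinator_def by blast
    from distributed_pos_imp_not_AE_0[OF this[rule_format, OF zero_less_one]] show ?thesis .
  qed
  have G_nz: "\<not> (AE \<omega> in M. G 1 \<omega> = 0)"
  proof -
    have "\<forall>t>0. distributed M lborel (G t) (\<lambda>x. ennreal (if x > 0
        then l1 powr (b1 * t) / Gamma (b1 * t) * x powr (b1 * t - 1) * exp (- l1 * x) else 0))"
      using G unfolding gamma_subordinator_def by blast
    from distributed_pos_imp_not_AE_0[OF this[rule_format, OF zero_less_one]] show ?thesis .
  qed
  have S_sq: "integrable M (\<lambda>\<omega>. (S t \<omega>)\<^sup>2)" and G_sq: "integrable M (\<lambda>\<omega>. (G t \<omega>)\<^sup>2)" if "t \<ge> 0" for t
    using tempered_stable_square_integrable[OF S pos(1) that]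
      gamma_subordinator_square_integrable[OF G pos(2,3) that] .
  obtain mS vS where mS: "mS > 0" "vS \<ge> 0"
    "\<And>t. t \<ge> 0 \<Longrightarrow> expectation (S t) = mS * t"
    "\<And>t. t \<ge> 0 \<Longrightarrow> expectation (\<lambda>\<omega>. (S t \<omega>)\<^sup>2) = (mS * t)\<^sup>2 + vS * t"
    using subordinator_moments[OF subS S_sq S_nz] by blast
  obtain mG vG where mG: "mG > 0" "vG \<ge> 0"
    "\<And>t. t \<ge> 0 \<Longrightarrow> expectation (G t) = mG * t"
    "\<And>t. t \<ge> 0 \<Longrightarrow> expectation (\<lambda>\<omega>. (G t \<omega>)\<^sup>2) = (mG * t)\<^sup>2 + vG * t"
    using subordinator_moments[OF subG G_sq G_nz] by blast
  have S_meas[measurable]: "S t \<in> borel_measurable M" and G_meas[measurable]: "G t \<in> borel_measurable M"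
    if "t \<ge> 0" for t
    using levy_process_measurable[OF SD(1) that] levy_process_measurable[OF GD(1) that] .
  have S_int: "integrable M (S t)" and G_int: "integrable M (G t)" if "t \<ge> 0" for t
    using square_integrable_imp_integrable[OF S_meas[OF that] S_sq[OF that]]
      square_integrable_imp_integrable[OF G_meas[OF that] G_sq[OF that]] .
  have G0: "\<And>r \<omega>. r \<ge> 0 \<Longrightarrow> \<omega> \<in> space M \<Longrightarrow> G r \<omega> \<ge> 0" using GD(4) by blast
  note dec = time_change_decoupling[OF ind SD(2) G0] and dec1 = time_change_decoupling1[OF ind SD(2) G0]
  have Y_meas: "Y t \<in> borel_measurable M" if "t \<ge> 0" for t
    unfolding Y_eq by (rule time_change_right_cont_measurable[OF ind SD(2) G0 that])
  have Y_nonneg: "Y t \<omega> \<ge> 0" if "t \<ge> 0" "\<omega> \<in> space M" for t \<omega>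
    unfolding Y_eq time_change_def using SD(4) G0 that by blast
  have Y_mono: "Y s \<omega> \<le> Y t \<omega>" if "0 \<le> s" "s \<le> t" "\<omega> \<in> space M" for s t \<omega>
    unfolding Y_eq time_change_def using SD(3) GD(3) G0 that by blast
  define c where "c = mS * mG"
  \<comment> \<open>The law of total variance: fluctuation of the inner clock scaled by the squared
    mean rate of \<open>S\<close>, plus the variance of \<open>S\<close> run for the mean inner
    time.\<close>
  define w where "w = mS\<^sup>2 * vG + vS * mG"
  have Y1: "(\<integral>\<^sup>+\<omega>. ennreal (Y t \<omega>) \<partial>M) = ennreal (c * t)" if t: "t \<ge> 0" for t
  proof -
    have "(\<integral>\<^sup>+\<omega>. ennreal (Y t \<omega>) \<partial>M) = (\<integral>\<^sup>+\<omega>'. \<integral>\<^sup>+\<omega>. ennreal (S (G t \<omega>') \<omega>) \<partial>M \<partial>M)"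
      unfolding Y_eq using t by (intro dec1) auto
    also have "\<dots> = (\<integral>\<^sup>+\<omega>'. ennreal (mS * G t \<omega>') \<partial>M)"
      using t G0 S_int SD(4) mS
      by (intro nn_integral_cong, subst nn_integral_eq_integral) (auto intro!: AE_I2)
    also have "\<dots> = ennreal (c * t)"
      using t G0 G_int mS mG by (subst nn_integral_eq_integral) (auto intro!: AE_I2 simp: c_def mult_ac)
    finally show ?thesis .
  qed
  have Y2: "(\<integral>\<^sup>+\<omega>. ennreal ((Y t \<omega>)\<^sup>2) \<partial>M) = ennreal ((c * t)\<^sup>2 + w * t)" if t: "t \<ge> 0" for t
  proof -
    have "(\<integral>\<^sup>+\<omega>. ennreal ((Y t \<omega>)\<^sup>2) \<partial>M) = (\<integral>\<^sup>+\<omega>'. \<integral>\<^sup>+\<omega>. ennreal ((S (G t \<omega>') \<omega>)\<^sup>2) \<partial>M \<partial>M)"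
      unfolding Y_eq using t by (intro dec1) auto
    also have "\<dots> = (\<integral>\<^sup>+\<omega>'. ennreal (mS\<^sup>2 * (G t \<omega>')\<^sup>2 + vS * G t \<omega>') \<partial>M)"
      using t G0 S_sq mS
      by (intro nn_integral_cong, subst nn_integral_eq_integral) (auto simp: power_mult_distrib)
    also have "\<dots> = ennreal (expectation (\<lambda>\<omega>'. mS\<^sup>2 * (G t \<omega>')\<^sup>2 + vS * G t \<omega>'))"
      using t G0 G_int G_sq mS
      by (intro nn_integral_eq_integral) (auto intro!: AE_I2)
    also have "expectation (\<lambda>\<omega>'. mS\<^sup>2 * (G t \<omega>')\<^sup>2 + vS * G t \<omega>') = mS\<^sup>2 * ((mG * t)\<^sup>2 + vG * t) + vS * (mG * t)"
      using t G_int G_sq mG by simp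
    also have "\<dots> = (c * t)\<^sup>2 + w * t"
      by (simp add: c_def w_def power_mult_distrib algebra_simps)
    finally show ?thesis .
  qed
  have increment: "(\<integral>\<^sup>+\<omega>. f (Y s \<omega>) * g (Y t \<omega> - Y s \<omega>) \<partial>M)
      = (\<integral>\<^sup>+\<omega>. f (Y s \<omega>) \<partial>M) * (\<integral>\<^sup>+\<omega>. g (Y t \<omega> - Y s \<omega>) \<partial>M)"
    if st: "0 \<le> s" "s \<le> t" and fg[measurable]: "f \<in> borel_measurable borel" "g \<in> borel_measurable borel"
    for s t and f g :: "real \<Rightarrow> ennreal"
  proof -
    \<comment> \<open>With \<open>path_eval S a\<close> in place of \<open>S a\<close>, the inner
      expectations are measurable functions of \<open>a\<close> on the whole line, as required of
      the test functions in the increment formula for \<open>G\<close>.\<close>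
    have gen: "(\<integral>\<^sup>+\<omega>. f (Y s \<omega>) * g (Y t \<omega> - Y s \<omega>) \<partial>M) =
        (\<integral>\<^sup>+\<omega>'. \<integral>\<^sup>+\<omega>. f (path_eval S (G s \<omega>') \<omega>) \<partial>M \<partial>M) * (\<integral>\<^sup>+\<omega>'. \<integral>\<^sup>+\<omega>. g (path_eval S (G (t - s) \<omega>') \<omega>) \<partial>M \<partial>M)"
      if [measurable]: "f \<in> borel_measurable borel" "g \<in> borel_measurable borel" for f g :: "real \<Rightarrow> ennreal"
    proof -
      have pe[measurable (raw)]: "(\<lambda>z. path_eval S (h z) (k z)) \<in> borel_measurable N"
        if "k \<in> measurable N M" "h \<in> borel_measurable N" for h k and N :: "'z measure"
        using that by (intro measurable_path_eval_compose[of S M] right_cont_processD(1)[OF SD(2)]) auto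
      have "(\<lambda>p. f (fst p) * g (snd p - fst p)) \<in> borel_measurable (borel \<Otimes>\<^sub>M borel)" by measurable
      from dec[OF _ _ _ _ this, of s t] st
      have "(\<integral>\<^sup>+\<omega>. f (Y s \<omega>) * g (Y t \<omega> - Y s \<omega>) \<partial>M)
        = (\<integral>\<^sup>+\<omega>'. \<integral>\<^sup>+\<omega>. f (S (G s \<omega>') \<omega>) * g (S (G t \<omega>') \<omega> - S (G s \<omega>') \<omega>) \<partial>M \<partial>M)"
        by (simp add: Y_eq)
      also have "\<dots> = (\<integral>\<^sup>+\<omega>'. (\<integral>\<^sup>+\<omega>. f (path_eval S (G s \<omega>') \<omega>) \<partial>M) *
          (\<integral>\<^sup>+\<omega>. g (path_eval S (G t \<omega>' - G s \<omega>') \<omega>) \<partial>M) \<partial>M)"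
      proof (rule nn_integral_cong)
        fix \<omega>' assume \<omega>': "\<omega>' \<in> space M"
        have G: "0 \<le> G s \<omega>'" "G s \<omega>' \<le> G t \<omega>'" using GD(3,4) st \<omega>' by auto
        have "(\<integral>\<^sup>+\<omega>. f (S (G s \<omega>') \<omega>) * g (S (G t \<omega>') \<omega> - S (G s \<omega>') \<omega>) \<partial>M)
          = (\<integral>\<^sup>+\<omega>. f (S (G s \<omega>') \<omega>) \<partial>M) * (\<integral>\<^sup>+\<omega>. g (S (G t \<omega>' - G s \<omega>') \<omega>) \<partial>M)"
          by (rule levy_process_nn_integral_mult[OF SD(1) G]) measurable
        also have "\<dots> = (\<integral>\<^sup>+\<omega>. f (path_eval S (G s \<omega>') \<omega>) \<partial>M) *
            (\<integral>\<^sup>+\<omega>. g (path_eval S (G t \<omega>' - G s \<omega>') \<omega>) \<partial>M)"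
          using right_cont_processD(2)[OF SD(2)] G by (simp cong: nn_integral_cong_simp)
        finally show "(\<integral>\<^sup>+\<omega>. f (S (G s \<omega>') \<omega>) * g (S (G t \<omega>') \<omega> - S (G s \<omega>') \<omega>) \<partial>M)
          = (\<integral>\<^sup>+\<omega>. f (path_eval S (G s \<omega>') \<omega>) \<partial>M) *
            (\<integral>\<^sup>+\<omega>. g (path_eval S (G t \<omega>' - G s \<omega>') \<omega>) \<partial>M)" .
      qed
      also have "\<dots> = (\<integral>\<^sup>+\<omega>'. \<integral>\<^sup>+\<omega>. f (path_eval S (G s \<omega>') \<omega>) \<partial>M \<partial>M) * (\<integral>\<^sup>+\<omega>'. \<integral>\<^sup>+\<omega>. g (path_eval S (G (t - s) \<omega>') \<omega>) \<partial>M \<partial>M)"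
        by (rule levy_process_nn_integral_mult[OF GD(1) st, of "\<lambda>a. \<integral>\<^sup>+\<omega>. f (path_eval S a \<omega>) \<partial>M"
              "\<lambda>a. \<integral>\<^sup>+\<omega>. g (path_eval S a \<omega>) \<partial>M"]) measurable
      finally show ?thesis .
    qed
    \<comment> \<open>Setting one test function to the constant 1 in \<open>gen\<close> identifies
      each factor on its right-hand side with a marginal integral of \<open>Y\<close>.\<close>
    have one: "(\<lambda>_. 1) \<in> borel_measurable (borel :: real measure)" by simp
    have "(\<integral>\<^sup>+\<omega>. f (Y s \<omega>) \<partial>M) = (\<integral>\<^sup>+\<omega>'. \<integral>\<^sup>+\<omega>. f (path_eval S (G s \<omega>') \<omega>) \<partial>M \<partial>M)"
      "(\<integral>\<^sup>+\<omega>. g (Y t \<omega> - Y s \<omega>) \<partial>M) = (\<integral>\<^sup>+\<omega>'. \<integral>\<^sup>+\<omega>. g (path_eval S (G (t - s) \<omega>') \<omega>) \<partial>M \<partial>M)"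
      using gen[OF fg(1) one] gen[OF one fg(2)] by (simp_all add: emeasure_space_1)
    then show ?thesis using gen[OF fg] by simp
  qed
  have unbounded: "AE \<omega> in M. filterlim (\<lambda>t. Y t \<omega>) at_top at_top"
    using subordinator_tendsto_infinity[OF subS S_nz] subordinator_tendsto_infinity[OF subG G_nz]
    unfolding Y_eq time_change_def by eventually_elim (rule filterlim_compose)
  have "linear_clock M Y c w"
  proof (unfold_locales)
    show "c > 0" using mS mG by (simp add: c_def)
    fix t :: real assume t: "t \<ge> 0"
    show "integrable M (\<lambda>\<omega>. (Y t \<omega>)\<^sup>2)"
      using Y2[OF t] Y_meas[OF t] by (intro integrableI_nonneg) auto
    show "expectation (Y t) = c * t"
      using Y1[OF t] Y_meas[OF t] Y_nonneg[OF t] t mS mG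
      by (subst integral_eq_nn_integral) (auto intro!: AE_I2 simp: c_def)
    show "expectation (\<lambda>\<omega>. (Y t \<omega>)\<^sup>2) = (c * t)\<^sup>2 + w * t"
    proof -
      have "(c * t)\<^sup>2 + w * t \<ge> 0" using t mS mG by (auto simp: w_def)
      moreover have "expectation (\<lambda>\<omega>. (Y t \<omega>)\<^sup>2) = enn2real (\<integral>\<^sup>+\<omega>. ennreal ((Y t \<omega>)\<^sup>2) \<partial>M)"
        using Y_meas[OF t] by (intro integral_eq_nn_integral) auto
      ultimately show ?thesis by (simp only: Y2[OF t] enn2real_ennreal)
    qed
  qed (use Y_meas Y_nonneg Y_mono unbounded increment in blast)+
  then show thesis by (rule that)
qed

end

section \<open>Asymptotics of the clock\<close>

text \<open>For y = x / c and 0 < p \<le> 1, y^p always lies between 1 and y. This gives a linear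
  bound around \<open>c\<close> that is valid down to x = 0, although the power is not Lipschitz
  there.\<close>

lemma powr_dev_le_linear:
  fixes x c p :: real
  assumes x: "x \<ge> 0" and c: "c > 0" and p: "0 < p" "p \<le> 1"
  shows "\<bar>x powr p - c powr p\<bar> \<le> c powr (p - 1) * \<bar>x - c\<bar>"
proof -
  define y where "y = x / c"
  have y: "y \<ge> 0" and x_eq: "x = c * y" using x c by (auto simp: y_def)
  have "\<bar>y powr p - 1\<bar> \<le> \<bar>y - 1\<bar>"
  proof (cases "y \<ge> 1")
    case True
    then have "1 \<le> y powr p" "y powr p \<le> y powr 1"
      using p ge_one_powr_ge_zero[of y p] powr_mono[of p 1 y] by auto
    then show ?thesis using True by simp
  next
    case False
    have "y powr 1 \<le> y powr p" using p y False by (intro powr_mono') auto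
    moreover have "y powr p \<le> 1" using p y False by (intro powr_le1) auto
    ultimately show ?thesis using y False by simp
  qed
  then have "c powr p * \<bar>y powr p - 1\<bar> \<le> c powr p * \<bar>y - 1\<bar>"
    by (intro mult_left_mono) auto
  moreover have "\<bar>x powr p - c powr p\<bar> = c powr p * \<bar>y powr p - 1\<bar>"
  proof -
    have "x powr p - c powr p = c powr p * (y powr p - 1)"
      unfolding x_eq using y c by (subst powr_mult) (auto simp: algebra_simps)
    then show ?thesis by (simp add: abs_mult)
  qed
  moreover have "c powr p * \<bar>y - 1\<bar> = c powr (p - 1) * \<bar>x - c\<bar>"
  proof -
    have "x - c = c * (y - 1)" unfolding x_eq by (simp add: algebra_simps)
    then show ?thesis using c by (simp add: abs_mult powr_diff)
  qed
  ultimately show ?thesis by simp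
qed

text \<open>x^(2p) is the square of x^p, expanded around c^p. A quadratic term must appear because 2
  p may exceed 1.\<close>

lemma powr_double_dev_le_quadratic:
  fixes x c p :: real
  assumes x: "x \<ge> 0" and c: "c > 0" and p: "0 < p" "p \<le> 1"
  shows "\<bar>x powr (2 * p) - c powr (2 * p)\<bar>
    \<le> 2 * c powr p * c powr (p - 1) * \<bar>x - c\<bar> + (c powr (p - 1))\<^sup>2 * (x - c)\<^sup>2"
proof -
  define d where "d = x powr p - c powr p"
  have d: "\<bar>d\<bar> \<le> c powr (p - 1) * \<bar>x - c\<bar>"
    unfolding d_def by (rule powr_dev_le_linear[OF assms])
  have sq: "z powr (2 * p) = (z powr p)\<^sup>2" for z :: real
    by (simp add: power2_eq_square powr_add[symmetric])
  have "x powr (2 * p) - c powr (2 * p) = 2 * c powr p * d + d\<^sup>2"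
    unfolding sq d_def by (simp add: power2_eq_square algebra_simps)
  then have "\<bar>x powr (2 * p) - c powr (2 * p)\<bar> \<le> 2 * c powr p * \<bar>d\<bar> + \<bar>d\<bar>\<^sup>2"
    using abs_triangle_ineq[of "2 * c powr p * d" "d\<^sup>2"] by (simp add: abs_mult)
  also have "\<dots> \<le> 2 * c powr p * (c powr (p - 1) * \<bar>x - c\<bar>) + (c powr (p - 1) * \<bar>x - c\<bar>)\<^sup>2"
    using d by (intro add_mono mult_left_mono power_mono) auto
  finally show ?thesis by (simp add: power_mult_distrib mult.assoc)
qed

text \<open>With u = s / t everything reduces to z \<le> z^p on the unit interval. The bound
  \<open>s powr p\<close> does not depend on \<open>t\<close> and serves as a dominating function;
  the bound with \<open>t powr (p - 1)\<close> decays and gives the pointwise limit.\<close>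

lemma powr_increment_bounds:
  fixes s t p :: real
  assumes s: "0 \<le> s" "s \<le> t" and p: "0 < p" "p \<le> 1"
  shows "0 \<le> t powr p - (t - s) powr p"
    and "t powr p - (t - s) powr p \<le> s powr p"
    and "t > 0 \<Longrightarrow> t powr p - (t - s) powr p \<le> s * t powr (p - 1)"
proof -
  show "0 \<le> t powr p - (t - s) powr p" using s p by (simp add: powr_mono2)
  have *: "t powr p - (t - s) powr p \<le> t powr p * (s / t)" "t powr p * (s / t) \<le> s powr p" if t: "t > 0"
  proof -
    define u where "u = s / t"
    have u: "0 \<le> u" "u \<le> 1" and s_eq: "s = t * u" using s t by (auto simp: u_def)
    have ge: "z \<le> z powr p" if "0 \<le> z" "z \<le> 1" for z :: real
      using powr_mono'[of p 1 z] that p by simp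
    have ts: "(t - s) powr p = t powr p * (1 - u) powr p" "s powr p = t powr p * u powr p"
      using t u by (simp_all add: s_eq powr_mult[symmetric] algebra_simps)
    have "t powr p * (1 - u) \<le> (t - s) powr p"
      unfolding ts using ge[of "1 - u"] u by (intro mult_left_mono) auto
    then show "t powr p - (t - s) powr p \<le> t powr p * (s / t)"
      by (simp add: u_def[symmetric] algebra_simps)
    show "t powr p * (s / t) \<le> s powr p"
      unfolding ts u_def[symmetric] using ge[of u] u by (intro mult_left_mono) auto
  qed
  show "t powr p - (t - s) powr p \<le> s powr p"
  proof (cases "t > 0")
    case True
    from order_trans[OF *[OF this]] show ?thesis .
  next
    case False
    with s have "t = 0" "s = 0" by auto
    then show ?thesis by simp
  qed
  show "t powr p - (t - s) powr p \<le> s * t powr (p - 1)" if "t > 0"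
    using *(1)[OF that] that by (simp add: powr_diff mult.commute)
qed

section \<open>Powers of the clock at large times\<close>

context linear_clock
begin

lemma clock_powr_integrable:
  assumes t: "t \<ge> 0" and p: "0 \<le> p" "p \<le> 2"
  shows "integrable M (\<lambda>\<omega>. Y t \<omega> powr p)"
proof (rule Bochner_Integration.integrable_bound)
  show "integrable M (\<lambda>\<omega>. 1 + (Y t \<omega>)\<^sup>2)"
    using clock_square_integrable[OF t] by simp
  show "(\<lambda>\<omega>. Y t \<omega> powr p) \<in> borel_measurable M"
    using clock_measurable[OF t] by measurable
  show "AE \<omega> in M. norm (Y t \<omega> powr p) \<le> norm (1 + (Y t \<omega>)\<^sup>2)"
  proof (rule AE_I2)
    fix \<omega> assume "\<omega> \<in> space M"
    then have Y: "Y t \<omega> \<ge> 0" by (rule clock_nonneg[OF t])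
    have "Y t \<omega> powr p \<le> 1 + (Y t \<omega>)\<^sup>2"
    proof (cases "Y t \<omega> \<le> 1")
      case True
      then have "Y t \<omega> powr p \<le> 1" using Y p by (intro powr_le1) auto
      then show ?thesis by (simp add: add_increasing2)
    next
      case False
      then have "Y t \<omega> powr p \<le> Y t \<omega> powr 2" using p by (intro powr_mono) auto
      also have "\<dots> = (Y t \<omega>)\<^sup>2" using False by (simp add: powr_numeral)
      finally show ?thesis by simp
    qed
    then show "norm (Y t \<omega> powr p) \<le> norm (1 + (Y t \<omega>)\<^sup>2)" by simp
  qed
qed

lemma clock_integrable: "t \<ge> 0 \<Longrightarrow> integrable M (Y t)"
  by (rule square_integrable_imp_integrable[OF clock_measurable clock_square_integrable])

lemma clock_ratio_sq_dev:
  assumes t: "t > 0"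
  shows "integrable M (\<lambda>\<omega>. (Y t \<omega> / t - c)\<^sup>2)" "expectation (\<lambda>\<omega>. (Y t \<omega> / t - c)\<^sup>2) = w / t"
proof -
  have t0: "t \<ge> 0" using t by simp
  have eq: "(Y t \<omega> / t - c)\<^sup>2 = (Y t \<omega>)\<^sup>2 / t\<^sup>2 - (2 * c / t) * Y t \<omega> + c\<^sup>2" for \<omega>
    by (simp add: power2_diff power_divide)
  show "integrable M (\<lambda>\<omega>. (Y t \<omega> / t - c)\<^sup>2)"
    unfolding eq using clock_square_integrable[OF t0] clock_integrable[OF t0] by simp
  have "expectation (\<lambda>\<omega>. (Y t \<omega> / t - c)\<^sup>2) = ((c * t)\<^sup>2 + w * t) / t\<^sup>2 - (2 * c / t) * (c * t) + c\<^sup>2"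
    unfolding eq using clock_square_integrable[OF t0] clock_integrable[OF t0]
    by (simp add: clock_mean[OF t0] clock_square_mean[OF t0] prob_space)
  also have "\<dots> = w / t"
    using t by (simp add: field_simps power2_eq_square)
  finally show "expectation (\<lambda>\<omega>. (Y t \<omega> / t - c)\<^sup>2) = w / t" .
qed

text \<open>A deviation bound of \<open>f\<close> around the single point \<open>c\<close> is
  integrated against the law of \<open>Y t / t\<close>. The linear part contributes order t^(-1/2),
  the quadratic part order 1/t, both read off from the variance \<open>w / t\<close>.\<close>

lemma clock_ratio_tendsto:
  fixes f :: "real \<Rightarrow> real"
  assumes f[measurable]: "f \<in> borel_measurable borel"
    and dev: "\<And>x. x \<ge> 0 \<Longrightarrow> \<bar>f x - f c\<bar> \<le> A * \<bar>x - c\<bar> + B * (x - c)\<^sup>2" and AB: "A \<ge> 0" "B \<ge> 0"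
  shows "((\<lambda>t. expectation (\<lambda>\<omega>. f (Y t \<omega> / t))) \<longlongrightarrow> f c) at_top"
proof -
  have bound: "norm (expectation (\<lambda>\<omega>. f (Y t \<omega> / t)) - f c) \<le> A * ((1 + w) / (2 * sqrt t)) + B * (w / t)"
    if t: "t > 0" for t
  proof -
    have t0: "t \<ge> 0" using t by simp
    note [measurable] = clock_measurable[OF t0]
    note sq = clock_ratio_sq_dev[OF t]
    have intY: "integrable M (\<lambda>\<omega>. \<bar>Y t \<omega> / t - c\<bar>)"
      using clock_integrable[OF t0] by simp
    have dev': "norm (f (Y t \<omega> / t) - f c) \<le> A * \<bar>Y t \<omega> / t - c\<bar> + B * (Y t \<omega> / t - c)\<^sup>2" if "\<omega> \<in> space M" for \<omega>
      using dev[of "Y t \<omega> / t"] clock_nonneg[OF t0 that] t by simp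
    have int_dev: "integrable M (\<lambda>\<omega>. f (Y t \<omega> / t) - f c)"
    proof (rule Bochner_Integration.integrable_bound)
      show "integrable M (\<lambda>\<omega>. A * \<bar>Y t \<omega> / t - c\<bar> + B * (Y t \<omega> / t - c)\<^sup>2)"
        using intY sq(1) by simp
      show "AE \<omega> in M. norm (f (Y t \<omega> / t) - f c) \<le> norm (A * \<bar>Y t \<omega> / t - c\<bar> + B * (Y t \<omega> / t - c)\<^sup>2)"
        using dev' by (intro AE_I2) (auto intro: order_trans[OF _ abs_ge_self])
    qed measurable
    have "integrable M (\<lambda>\<omega>. (f (Y t \<omega> / t) - f c) + f c)"
      using int_dev by (intro Bochner_Integration.integrable_add) auto
    then have int_f: "integrable M (\<lambda>\<omega>. f (Y t \<omega> / t))" by simp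
    have "expectation (\<lambda>\<omega>. f (Y t \<omega> / t)) - f c = expectation (\<lambda>\<omega>. f (Y t \<omega> / t) - f c)"
      using int_f by (simp add: prob_space)
    also have "norm \<dots> \<le> expectation (\<lambda>\<omega>. norm (f (Y t \<omega> / t) - f c))"
      by (rule integral_norm_bound)
    also have "\<dots> \<le> expectation (\<lambda>\<omega>. A * \<bar>Y t \<omega> / t - c\<bar> + B * (Y t \<omega> / t - c)\<^sup>2)"
      using int_dev intY sq(1) dev' by (intro integral_mono) auto
    also have "\<dots> = A * expectation (\<lambda>\<omega>. \<bar>Y t \<omega> / t - c\<bar>) + B * (w / t)"
      using intY sq by simp
    also have "\<dots> \<le> A * ((1 + w) / (2 * sqrt t)) + B * (w / t)"
    proof -
      \<comment> \<open>AM-GM with weight \<open>sqrt t\<close>: \<open>2 z \<le> 1 / sqrt t + sqrt t * z\<^sup>2\<close>\<close>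
      have "expectation (\<lambda>\<omega>. \<bar>Y t \<omega> / t - c\<bar>) \<le> expectation (\<lambda>\<omega>. 1 / (2 * sqrt t) + sqrt t / 2 * (Y t \<omega> / t - c)\<^sup>2)"
      proof (rule integral_mono[OF intY])
        show "integrable M (\<lambda>\<omega>. 1 / (2 * sqrt t) + sqrt t / 2 * (Y t \<omega> / t - c)\<^sup>2)"
          using sq(1) by simp
        fix \<omega>
        define z where "z = \<bar>Y t \<omega> / t - c\<bar>"
        have "0 \<le> (sqrt t * z - 1)\<^sup>2 / (2 * sqrt t)" using t by simp
        also have "\<dots> = 1 / (2 * sqrt t) + sqrt t / 2 * z\<^sup>2 - z"
          using t by (simp add: power2_eq_square field_simps)
        finally show "\<bar>Y t \<omega> / t - c\<bar> \<le> 1 / (2 * sqrt t) + sqrt t / 2 * (Y t \<omega> / t - c)\<^sup>2"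
          by (simp add: z_def)
      qed
      also have "\<dots> = 1 / (2 * sqrt t) + sqrt t / 2 * (w / t)"
        using sq by (simp add: prob_space)
      also have "\<dots> = (1 + w) / (2 * sqrt t)"
        using t by (simp add: field_simps)
      finally show ?thesis using AB by (intro add_mono mult_left_mono) auto
    qed
    finally show ?thesis .
  qed
  have "((\<lambda>t. A * ((1 + w) / (2 * sqrt t)) + B * (w / t)) \<longlongrightarrow> A * 0 + B * 0) at_top"
  proof (intro tendsto_add tendsto_mult tendsto_const)
    show "((\<lambda>t. (1 + w) / (2 * sqrt t)) \<longlongrightarrow> 0) at_top"
      by (intro real_tendsto_divide_at_top[OF tendsto_const] filterlim_tendsto_pos_mult_at_top[OF tendsto_const]
          sqrt_at_top) simp
    show "((\<lambda>t. w / t) \<longlongrightarrow> 0) at_top"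
      by (intro real_tendsto_divide_at_top[OF tendsto_const] filterlim_ident)
  qed
  then have "((\<lambda>t. A * ((1 + w) / (2 * sqrt t)) + B * (w / t)) \<longlongrightarrow> 0) at_top" by simp
  then have "((\<lambda>t. expectation (\<lambda>\<omega>. f (Y t \<omega> / t)) - f c) \<longlongrightarrow> 0) at_top"
    by (rule Lim_null_comparison[rotated]) (rule eventually_mono[OF eventually_gt_at_top[of 0]], rule bound)
  then show ?thesis by (rule LIM_zero_cancel)
qed

lemma clock_powr_ratio_tendsto:
  assumes p: "0 < p" "p < 1"
  shows "((\<lambda>t. expectation (\<lambda>\<omega>. Y t \<omega> powr p) / t powr p) \<longlongrightarrow> c powr p) at_top"
    and "((\<lambda>t. expectation (\<lambda>\<omega>. Y t \<omega> powr (2 * p)) / t powr (2 * p)) \<longlongrightarrow> c powr (2 * p)) at_top"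
proof -
  have eq: "expectation (\<lambda>\<omega>. (Y t \<omega> / t) powr r) = expectation (\<lambda>\<omega>. Y t \<omega> powr r) / t powr r" if "t > 0" for t r
  proof -
    have "expectation (\<lambda>\<omega>. (Y t \<omega> / t) powr r) = expectation (\<lambda>\<omega>. Y t \<omega> powr r / t powr r)"
      using that clock_nonneg[of t] by (intro Bochner_Integration.integral_cong) (auto simp: powr_divide)
    then show ?thesis by simp
  qed
  have "((\<lambda>t. expectation (\<lambda>\<omega>. (Y t \<omega> / t) powr p)) \<longlongrightarrow> c powr p) at_top"
    using powr_dev_le_linear[OF _ c_pos, of _ p] p
    by (intro clock_ratio_tendsto[where A="c powr (p - 1)" and B=0]) auto
  then show "((\<lambda>t. expectation (\<lambda>\<omega>. Y t \<omega> powr p) / t powr p) \<longlongrightarrow> c powr p) at_top"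
    by (rule Lim_transform_eventually) (rule eventually_mono[OF eventually_gt_at_top[of 0]], simp add: eq)
  have "((\<lambda>t. expectation (\<lambda>\<omega>. (Y t \<omega> / t) powr (2 * p))) \<longlongrightarrow> c powr (2 * p)) at_top"
    using powr_double_dev_le_quadratic[OF _ c_pos, of _ p] p
    by (intro clock_ratio_tendsto[where A="2 * c powr p * c powr (p - 1)" and B="(c powr (p - 1))\<^sup>2"]) auto
  then show "((\<lambda>t. expectation (\<lambda>\<omega>. Y t \<omega> powr (2 * p)) / t powr (2 * p)) \<longlongrightarrow> c powr (2 * p)) at_top"
    by (rule Lim_transform_eventually) (rule eventually_mono[OF eventually_gt_at_top[of 0]], simp add: eq)
qed

text \<open>Dominated convergence with majorant \<open>Y s powr (r + p)\<close>: pointwise the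
  difference is at most \<open>Y s * Y t powr (p - 1)\<close>, which vanishes because
  \<open>Y t\<close> diverges and p < 1. The weights r = 0 and r = p are those occurring in the
  covariance bounds.\<close>

lemma clock_powr_increment_tendsto:
  assumes p: "0 < p" "p < 1" and s: "s \<ge> 0" and r: "r = 0 \<or> r = p"
  shows "((\<lambda>t. expectation (\<lambda>\<omega>. Y s \<omega> powr r * (Y t \<omega> powr p - (Y t \<omega> - Y s \<omega>) powr p))) \<longlongrightarrow> 0) at_top"
proof -
  let ?d = "\<lambda>t \<omega>. Y s \<omega> powr r * (Y t \<omega> powr p - (Y t \<omega> - Y s \<omega>) powr p)"
  \<comment> \<open>The integrand is cut off for t < s, where neither the order of
    \<open>Y s\<close> and \<open>Y t\<close> nor measurability of \<open>Y t\<close> is at hand;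
    the limit at infinity does not notice.\<close>
  have "((\<lambda>t. expectation (\<lambda>\<omega>. if t \<ge> s then ?d t \<omega> else 0)) \<longlongrightarrow> expectation (\<lambda>\<omega>. 0)) at_top"
  proof (rule integral_dominated_convergence_at_top[where w="\<lambda>\<omega>. Y s \<omega> powr (r + p)"])
    show "integrable M (\<lambda>\<omega>. Y s \<omega> powr (r + p))"
      using p r s by (intro clock_powr_integrable) auto
    show "\<forall>\<^sub>F t in at_top. AE \<omega> in M. norm (if t \<ge> s then ?d t \<omega> else 0) \<le> Y s \<omega> powr (r + p)"
    proof (rule always_eventually, rule allI, rule AE_I2)
      fix t \<omega> assume \<omega>: "\<omega> \<in> space M"
      show "norm (if t \<ge> s then ?d t \<omega> else 0) \<le> Y s \<omega> powr (r + p)"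
      proof (cases "t \<ge> s")
        case True
        have "0 \<le> Y s \<omega>" "Y s \<omega> \<le> Y t \<omega>" using clock_nonneg clock_mono s \<omega> True by auto
        from powr_increment_bounds(1,2)[OF this p(1) less_imp_le[OF p(2)]]
        have "\<bar>?d t \<omega>\<bar> \<le> Y s \<omega> powr r * Y s \<omega> powr p"
          by (simp add: abs_mult mult_left_mono)
        then show ?thesis using True by (simp add: powr_add)
      qed simp
    qed
    show "AE \<omega> in M. ((\<lambda>t. if t \<ge> s then ?d t \<omega> else 0) \<longlongrightarrow> 0) at_top"
      using clock_unbounded AE_space
    proof eventually_elim
      case (elim \<omega>)
      have "((\<lambda>t. Y t \<omega> powr (p - 1)) \<longlongrightarrow> 0) at_top"
        using p by (intro tendsto_neg_powr elim(1)) auto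
      then have "((\<lambda>t. Y s \<omega> powr r * (Y s \<omega> * Y t \<omega> powr (p - 1))) \<longlongrightarrow> Y s \<omega> powr r * (Y s \<omega> * 0)) at_top"
        by (intro tendsto_mult tendsto_const)
      then have lim: "((\<lambda>t. Y s \<omega> powr r * (Y s \<omega> * Y t \<omega> powr (p - 1))) \<longlongrightarrow> 0) at_top" by simp
      have "\<forall>\<^sub>F t in at_top. Y t \<omega> > 0" using elim(1) by (auto simp: filterlim_at_top_dense)
      with eventually_ge_at_top[of s]
      have "\<forall>\<^sub>F t in at_top. norm (if t \<ge> s then ?d t \<omega> else 0) \<le> Y s \<omega> powr r * (Y s \<omega> * Y t \<omega> powr (p - 1))"
      proof eventually_elim
        fix t assume t: "s \<le> t" "0 < Y t \<omega>"
        have "0 \<le> Y s \<omega>" "Y s \<omega> \<le> Y t \<omega>" using clock_nonneg clock_mono s elim(2) t by auto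
        from powr_increment_bounds(1,3)[OF this p(1) less_imp_le[OF p(2)]]
        show "norm (if t \<ge> s then ?d t \<omega> else 0) \<le> Y s \<omega> powr r * (Y s \<omega> * Y t \<omega> powr (p - 1))"
          using t by (simp add: abs_mult mult_left_mono)
      qed
      from Lim_null_comparison[OF this lim] show ?case .
    qed
    show "(\<lambda>\<omega>. if t \<ge> s then ?d t \<omega> else 0) \<in> borel_measurable M" for t
    proof (cases "t \<ge> s")
      case True
      have [measurable]: "Y t \<in> borel_measurable M" "Y s \<in> borel_measurable M"
        using True s clock_measurable by auto
      show ?thesis by measurable
    qed simp
  qed simp
  then have "((\<lambda>t. expectation (\<lambda>\<omega>. if t \<ge> s then ?d t \<omega> else 0)) \<longlongrightarrow> 0) at_top" by simp
  then show ?thesis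
    by (rule Lim_transform_eventually)
       (rule eventually_mono[OF eventually_ge_at_top[of s]], simp)
qed

text \<open>The factorisation is where independence of the clock increments enters the covariance.
  It has no counterpart for \<open>Y s powr p * Y t powr p\<close>, which is why the lower bracket
  of the two-time moment is phrased with t - s.\<close>

lemma clock_powr_increment:
  assumes st: "0 \<le> s" "s \<le> t" and p: "0 < p" "p < 1"
  shows "integrable M (\<lambda>\<omega>. (Y t \<omega> - Y s \<omega>) powr p)"
    and "integrable M (\<lambda>\<omega>. Y s \<omega> powr p * (Y t \<omega> - Y s \<omega>) powr p)"
    and "integrable M (\<lambda>\<omega>. Y s \<omega> powr p * Y t \<omega> powr p)"
    and "expectation (\<lambda>\<omega>. Y s \<omega> powr p * (Y t \<omega> - Y s \<omega>) powr p)
      = expectation (\<lambda>\<omega>. Y s \<omega> powr p) * expectation (\<lambda>\<omega>. (Y t \<omega> - Y s \<omega>) powr p)"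
proof -
  have t: "t \<ge> 0" using st by simp
  note [measurable] = clock_measurable[OF st(1)] clock_measurable[OF t]
  have Y: "0 \<le> Y s \<omega>" "Y s \<omega> \<le> Y t \<omega>" if "\<omega> \<in> space M" for \<omega>
    using clock_nonneg clock_mono st that by auto
  show "integrable M (\<lambda>\<omega>. (Y t \<omega> - Y s \<omega>) powr p)"
    using Y p t by (intro Bochner_Integration.integrable_bound[OF clock_powr_integrable[of t p]])
      (auto intro!: AE_I2 powr_mono2)
  have sq: "x powr p * x powr p = x powr (2 * p)" for x :: real
    by (simp add: powr_add[symmetric])
  have int2: "integrable M (\<lambda>\<omega>. Y t \<omega> powr p * Y t \<omega> powr p)"
    unfolding sq using p t by (intro clock_powr_integrable) auto
  show "integrable M (\<lambda>\<omega>. Y s \<omega> powr p * (Y t \<omega> - Y s \<omega>) powr p)"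
    using Y p by (intro Bochner_Integration.integrable_bound[OF int2])
      (auto intro!: AE_I2 mult_mono powr_mono2 simp: abs_mult)
  show "integrable M (\<lambda>\<omega>. Y s \<omega> powr p * Y t \<omega> powr p)"
    using Y p by (intro Bochner_Integration.integrable_bound[OF int2])
      (auto intro!: AE_I2 mult_mono powr_mono2 simp: abs_mult)
  have "(\<integral>\<^sup>+\<omega>. ennreal (Y s \<omega> powr p * (Y t \<omega> - Y s \<omega>) powr p) \<partial>M)
     = (\<integral>\<^sup>+\<omega>. ennreal (Y s \<omega> powr p) * ennreal ((Y t \<omega> - Y s \<omega>) powr p) \<partial>M)"
    by (simp add: ennreal_mult)
  also have "\<dots> = (\<integral>\<^sup>+\<omega>. ennreal (Y s \<omega> powr p) \<partial>M) * (\<integral>\<^sup>+\<omega>. ennreal ((Y t \<omega> - Y s \<omega>) powr p) \<partial>M)"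
    by (rule clock_increment[OF st, of "\<lambda>x. ennreal (x powr p)" "\<lambda>x. ennreal (x powr p)"]) measurable
  finally show "expectation (\<lambda>\<omega>. Y s \<omega> powr p * (Y t \<omega> - Y s \<omega>) powr p)
      = expectation (\<lambda>\<omega>. Y s \<omega> powr p) * expectation (\<lambda>\<omega>. (Y t \<omega> - Y s \<omega>) powr p)"
    by (simp add: integral_eq_nn_integral enn2real_mult)
qed

lemma clock_powr_expectation_pos:
  assumes s: "s > 0" and p: "0 < p" "p < 1"
  shows "expectation (\<lambda>\<omega>. Y s \<omega> powr p) > 0"
proof -
  have s0: "s \<ge> 0" using s by simp
  have int: "integrable M (\<lambda>\<omega>. Y s \<omega> powr p)" using p s by (intro clock_powr_integrable) auto
  have "expectation (\<lambda>\<omega>. Y s \<omega> powr p) \<noteq> 0"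
  proof
    assume "expectation (\<lambda>\<omega>. Y s \<omega> powr p) = 0"
    then have "AE \<omega> in M. Y s \<omega> powr p = 0"
      using int by (subst (asm) integral_nonneg_eq_0_iff_AE) auto
    then have "AE \<omega> in M. Y s \<omega> = 0" by eventually_elim simp
    then have "expectation (Y s) = expectation (\<lambda>_. 0)"
      using clock_measurable[OF s0] by (intro integral_cong_AE) auto
    then show False using clock_mean[OF s0] c_pos s by simp
  qed
  moreover have "expectation (\<lambda>\<omega>. Y s \<omega> powr p) \<ge> 0" by (simp add: integral_nonneg_AE)
  ultimately show ?thesis by linarith
qed

text \<open>Nonnegativity of the variance of \<open>Y s powr p\<close>; it prevents the subtracted
  squared mean from spoiling positivity of the variance of \<open>Q\<close>.\<close>

lemma clock_powr_jensen:
  assumes s: "s \<ge> 0" and p: "0 < p" "p < 1"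
  shows "(expectation (\<lambda>\<omega>. Y s \<omega> powr p))\<^sup>2 \<le> expectation (\<lambda>\<omega>. Y s \<omega> powr (2 * p))"
proof -
  have sq: "(x powr p)\<^sup>2 = x powr (2 * p)" for x :: real
    by (simp add: power2_eq_square powr_add[symmetric])
  have "variance (\<lambda>\<omega>. Y s \<omega> powr p) = expectation (\<lambda>\<omega>. Y s \<omega> powr (2 * p)) - (expectation (\<lambda>\<omega>. Y s \<omega> powr p))\<^sup>2"
    using clock_powr_integrable[OF s, of p] clock_powr_integrable[OF s, of "2 * p"] p
    by (subst variance_eq) (auto simp: sq)
  then show ?thesis using variance_positive[of "\<lambda>\<omega>. Y s \<omega> powr p"] by simp
qed

end

section \<open>Long-range dependence\<close>

context linear_clock
begin

text \<open>Conditioning on the clock replaces each power of time in the moments of \<open>F\<close>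
  by the same power of \<open>Y\<close>, so \<open>m1\<close> and \<open>m2\<close> determine mean
  and variance of \<open>Q\<close>. The limit of the covariance is made of those terms of the
  two-time moment that do not involve \<open>t\<close>.\<close>

lemma time_change_long_range_dependent:
  assumes b: "0 < b" "b < 1" and q: "q > 0" and \<kappa>: "\<kappa> > 1/2"
    and rc: "right_cont_process M F" and ind: "indep_processes M F Y"
    and F_nonneg: "\<And>t. t \<ge> 0 \<Longrightarrow> AE \<omega> in M. F t \<omega> \<ge> 0"
    and F_mean: "\<And>t. t \<ge> 0 \<Longrightarrow> (\<integral>\<^sup>+\<omega>. ennreal (F t \<omega>) \<partial>M) = ennreal (q * t powr b)"
    and F_sq: "\<And>t. t \<ge> 0 \<Longrightarrow> (\<integral>\<^sup>+\<omega>. ennreal (F t \<omega>) * ennreal (F t \<omega>) \<partial>M)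
      = ennreal (q * t powr b + 2 * q\<^sup>2 * \<kappa> * t powr (2 * b))"
    and F_le: "\<And>s t. 0 \<le> s \<Longrightarrow> s \<le> t \<Longrightarrow> (\<integral>\<^sup>+\<omega>. ennreal (F s \<omega>) * ennreal (F t \<omega>) \<partial>M)
      \<le> ennreal (q * s powr b + q\<^sup>2 * (s powr b * t powr b + \<kappa> * s powr (2 * b)))"
    and F_ge: "\<And>s t. 0 \<le> s \<Longrightarrow> s \<le> t \<Longrightarrow> (\<integral>\<^sup>+\<omega>. ennreal (F s \<omega>) * ennreal (F t \<omega>) \<partial>M)
      \<ge> ennreal (q * s powr b + q\<^sup>2 * (s powr b * (t - s) powr b + \<kappa> * s powr (2 * b)))"
  shows "long_range_dependent M (time_change F Y)"
proof -
  define Q where "Q = time_change F Y"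
  define m1 where "m1 t = expectation (\<lambda>\<omega>. Y t \<omega> powr b)" for t
  define m2 where "m2 t = expectation (\<lambda>\<omega>. Y t \<omega> powr (2 * b))" for t
  have int1: "integrable M (\<lambda>\<omega>. Y t \<omega> powr b)" and int2: "integrable M (\<lambda>\<omega>. Y t \<omega> powr (2 * b))" if "t \<ge> 0" for t
    using clock_powr_integrable[OF that] b by auto
  have m1_nonneg: "m1 t \<ge> 0" and m2_nonneg: "m2 t \<ge> 0" for t
    unfolding m1_def m2_def by (simp_all add: integral_nonneg_AE)
  have m1_pos: "m1 t > 0" if "t > 0" for t
    unfolding m1_def by (rule clock_powr_expectation_pos[OF that b])
  have jensen: "(m1 t)\<^sup>2 \<le> m2 t" if "t \<ge> 0" for t
    unfolding m1_def m2_def by (rule clock_powr_jensen[OF that b])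
  note dec = time_change_decoupling[OF ind rc clock_nonneg] and dec1 = time_change_decoupling1[OF ind rc clock_nonneg]
  have Q_meas[measurable]: "Q t \<in> borel_measurable M" if "t \<ge> 0" for t
    unfolding Q_def by (rule time_change_right_cont_measurable[OF ind rc clock_nonneg that])
  have Q_nonneg: "AE \<omega> in M. Q t \<omega> \<ge> 0" if "t \<ge> 0" for t
    unfolding Q_def
    by (rule time_change_AE[OF ind rc clock_nonneg that]) (auto intro!: AE_I2 F_nonneg clock_nonneg that)
  have mult_meas: "(\<lambda>p. ennreal (fst p) * ennreal (snd p)) \<in> borel_measurable (borel \<Otimes>\<^sub>M borel)"
    by measurable
  have Q_prod: "(\<integral>\<^sup>+\<omega>. ennreal (Q s \<omega>) * ennreal (Q t \<omega>) \<partial>M)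
      = (\<integral>\<^sup>+\<omega>'. \<integral>\<^sup>+\<omega>. ennreal (F (Y s \<omega>') \<omega>) * ennreal (F (Y t \<omega>') \<omega>) \<partial>M \<partial>M)" if "s \<ge> 0" "t \<ge> 0" for s t
    using dec[OF _ _ that mult_meas] by (simp add: Q_def)
  have Q1: "(\<integral>\<^sup>+\<omega>. ennreal (Q t \<omega>) \<partial>M) = ennreal (q * m1 t)" if t: "t \<ge> 0" for t
  proof -
    have "(\<integral>\<^sup>+\<omega>. ennreal (Q t \<omega>) \<partial>M) = (\<integral>\<^sup>+\<omega>'. \<integral>\<^sup>+\<omega>. ennreal (F (Y t \<omega>') \<omega>) \<partial>M \<partial>M)"
      unfolding Q_def using t by (intro dec1) auto
    also have "\<dots> = (\<integral>\<^sup>+\<omega>'. ennreal (q * Y t \<omega>' powr b) \<partial>M)"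
      using clock_nonneg[OF t] by (intro nn_integral_cong F_mean)
    also have "\<dots> = ennreal (q * m1 t)"
      using int1[OF t] q unfolding m1_def by (subst nn_integral_eq_integral) auto
    finally show ?thesis .
  qed
  have Q2: "(\<integral>\<^sup>+\<omega>. ennreal (Q t \<omega>) * ennreal (Q t \<omega>) \<partial>M) = ennreal (q * m1 t + 2 * q\<^sup>2 * \<kappa> * m2 t)"
    if t: "t \<ge> 0" for t
  proof -
    have "(\<integral>\<^sup>+\<omega>. ennreal (Q t \<omega>) * ennreal (Q t \<omega>) \<partial>M)
       = (\<integral>\<^sup>+\<omega>'. ennreal (q * Y t \<omega>' powr b + 2 * q\<^sup>2 * \<kappa> * Y t \<omega>' powr (2 * b)) \<partial>M)"
      unfolding Q_prod[OF t t] using clock_nonneg[OF t] by (intro nn_integral_cong F_sq)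
    also have "\<dots> = ennreal (expectation (\<lambda>\<omega>. q * Y t \<omega> powr b + 2 * q\<^sup>2 * \<kappa> * Y t \<omega> powr (2 * b)))"
      using int1[OF t] int2[OF t] q \<kappa> by (intro nn_integral_eq_integral) auto
    also have "expectation (\<lambda>\<omega>. q * Y t \<omega> powr b + 2 * q\<^sup>2 * \<kappa> * Y t \<omega> powr (2 * b)) = q * m1 t + 2 * q\<^sup>2 * \<kappa> * m2 t"
      using int1[OF t] int2[OF t] by (simp add: m1_def m2_def)
    finally show ?thesis .
  qed
  have Q_sq_nn: "(\<integral>\<^sup>+\<omega>. ennreal ((Q t \<omega>)\<^sup>2) \<partial>M) = ennreal (q * m1 t + 2 * q\<^sup>2 * \<kappa> * m2 t)" if t: "t \<ge> 0" for t
  proof -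
    have "(\<integral>\<^sup>+\<omega>. ennreal ((Q t \<omega>)\<^sup>2) \<partial>M) = (\<integral>\<^sup>+\<omega>. ennreal (Q t \<omega>) * ennreal (Q t \<omega>) \<partial>M)"
      using Q_nonneg[OF t]
      by (intro nn_integral_cong_AE) (auto simp: power2_eq_square ennreal_mult elim!: eventually_mono)
    then show ?thesis using Q2[OF t] by simp
  qed
  have Q_sq_int: "integrable M (\<lambda>\<omega>. (Q t \<omega>)\<^sup>2)" if t: "t \<ge> 0" for t
    using Q_sq_nn[OF t] Q_meas[OF t] by (intro integrableI_nonneg) auto
  have Q_int: "integrable M (Q t)" if t: "t \<ge> 0" for t
    by (rule square_integrable_imp_integrable[OF Q_meas[OF t] Q_sq_int[OF t]])
  have Q_mean: "expectation (Q t) = q * m1 t" if t: "t \<ge> 0" for t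
  proof -
    have "expectation (Q t) = enn2real (\<integral>\<^sup>+\<omega>. ennreal (Q t \<omega>) \<partial>M)"
      by (rule integral_eq_nn_integral[OF Q_meas[OF t] Q_nonneg[OF t]])
    then show ?thesis using q m1_nonneg[of t] by (simp only: Q1[OF t]) simp
  qed
  have Q_var: "variance (Q t) = q * m1 t + q\<^sup>2 * (2 * \<kappa> * m2 t - (m1 t)\<^sup>2)" if t: "t \<ge> 0" for t
  proof -
    have "q * m1 t + 2 * q\<^sup>2 * \<kappa> * m2 t \<ge> 0" using q \<kappa> m1_nonneg[of t] m2_nonneg[of t] by simp
    moreover have "expectation (\<lambda>\<omega>. (Q t \<omega>)\<^sup>2) = enn2real (\<integral>\<^sup>+\<omega>. ennreal ((Q t \<omega>)\<^sup>2) \<partial>M)"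
      using Q_meas[OF t] by (intro integral_eq_nn_integral) auto
    ultimately have "expectation (\<lambda>\<omega>. (Q t \<omega>)\<^sup>2) = q * m1 t + 2 * q\<^sup>2 * \<kappa> * m2 t"
      by (simp only: Q_sq_nn[OF t] enn2real_ennreal)
    then show ?thesis
      using variance_eq[OF Q_int[OF t] Q_sq_int[OF t]] Q_mean[OF t]
      by (simp add: power_mult_distrib algebra_simps)
  qed
  \<comment> \<open>The bracket is nonnegative by 2 \<kappa> \<ge> 1 and the Jensen inequality;
    strict positivity comes from the Poisson term \<open>q * m1 t\<close>.\<close>
  have var_pos: "variance (Q t) > 0" if t: "t > 0" for t
  proof -
    have "1 * m2 t \<le> (2 * \<kappa>) * m2 t" using \<kappa> m2_nonneg[of t] by (intro mult_right_mono) auto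
    then have "2 * \<kappa> * m2 t - (m1 t)\<^sup>2 \<ge> 0" using jensen[of t] t by simp
    then show ?thesis using Q_var[of t] m1_pos[OF t] q t by (simp add: add_pos_nonneg)
  qed
  \<comment> \<open>The Poisson term is of order t^b and disappears after normalisation. In the
    bracket, \<open>m2 t\<close> and \<open>(m1 t)\<^sup>2\<close> have the same leading term (c
    t)^(2b), so the coefficient left over is 2 \<kappa> - 1.\<close>
  have var_lim: "((\<lambda>t. variance (Q t) / t powr (2 * b)) \<longlongrightarrow> q\<^sup>2 * c powr (2 * b) * (2 * \<kappa> - 1)) at_top"
  proof -
    have sq: "(x powr b)\<^sup>2 = x powr (2 * b)" for x :: real
      by (simp add: power2_eq_square powr_add[symmetric])
    have "((\<lambda>t. q * (m1 t / t powr b * t powr (- b)) + q\<^sup>2 * (2 * \<kappa> * (m2 t / t powr (2 * b)) - (m1 t / t powr b)\<^sup>2))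
        \<longlongrightarrow> q * (c powr b * 0) + q\<^sup>2 * (2 * \<kappa> * (c powr (2 * b)) - (c powr b)\<^sup>2)) at_top"
      unfolding m1_def m2_def
      using b by (intro tendsto_intros clock_powr_ratio_tendsto tendsto_neg_powr filterlim_ident) auto
    also have "q * (c powr b * 0) + q\<^sup>2 * (2 * \<kappa> * (c powr (2 * b)) - (c powr b)\<^sup>2) = q\<^sup>2 * c powr (2 * b) * (2 * \<kappa> - 1)"
      by (simp add: sq algebra_simps)
    finally show ?thesis
    proof (rule Lim_transform_eventually)
      show "\<forall>\<^sub>F t in at_top. q * (m1 t / t powr b * t powr (- b)) + q\<^sup>2 * (2 * \<kappa> * (m2 t / t powr (2 * b)) - (m1 t / t powr b)\<^sup>2)
          = variance (Q t) / t powr (2 * b)"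
        using eventually_gt_at_top[of 0]
      proof eventually_elim
        fix t :: real assume t: "0 < t"
        have p: "t powr b * t powr b = t powr (2 * b)" by (simp add: powr_add[symmetric])
        have "m1 t / t powr b * t powr (- b) = m1 t / t powr (2 * b)"
          unfolding p[symmetric] by (simp add: powr_minus divide_inverse mult.assoc)
        moreover have "(m1 t / t powr b)\<^sup>2 = (m1 t)\<^sup>2 / t powr (2 * b)"
          by (simp add: power_divide sq)
        ultimately show "q * (m1 t / t powr b * t powr (- b)) + q\<^sup>2 * (2 * \<kappa> * (m2 t / t powr (2 * b)) - (m1 t / t powr b)\<^sup>2)
          = variance (Q t) / t powr (2 * b)"
          using t by (simp add: Q_var add_divide_distrib diff_divide_distrib right_diff_distrib)
      qed
    qed
  qed
  have cov_lim: "((\<lambda>t. covariance M (Q s) (Q t)) \<longlongrightarrow> q * m1 s + q\<^sup>2 * \<kappa> * m2 s) at_top" if s: "s > 0" for s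
  proof -
    \<comment> \<open>\<open>e b t\<close> is the gap between the expected cross terms of the upper
      and lower brackets, \<open>e 0 t\<close> the gap between the means of
      \<open>Y t powr b\<close> and \<open>(Y t - Y s) powr b\<close>.\<close>
    define e where "e r t = expectation (\<lambda>\<omega>. Y s \<omega> powr r * (Y t \<omega> powr b - (Y t \<omega> - Y s \<omega>) powr b))" for r t
    have s0: "s \<ge> 0" using s by simp
    \<comment> \<open>The lower cross term factors as \<open>m1 s * (m1 t - e 0 t)\<close>, and
      \<open>m1 s * m1 t\<close> is what the product of the means subtracts. The upper cross term
      exceeds the lower one by \<open>e b t\<close>, so the growing parts cancel on both
      sides.\<close>
    have bounds: "q * m1 s + q\<^sup>2 * \<kappa> * m2 s - q\<^sup>2 * (m1 s * e 0 t) \<le> covariance M (Q s) (Q t) \<and>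
      covariance M (Q s) (Q t) \<le> q * m1 s + q\<^sup>2 * \<kappa> * m2 s + q\<^sup>2 * (e b t - m1 s * e 0 t)" if st: "t \<ge> s" for t
    proof -
      have t: "t \<ge> 0" using st s by simp
      note inc = clock_powr_increment[OF s0 st b]
      have Y: "0 \<le> Y s \<omega>" "Y s \<omega> \<le> Y t \<omega>" if "\<omega> \<in> space M" for \<omega>
        using clock_nonneg clock_mono s0 st that by auto
      have e0: "expectation (\<lambda>\<omega>. (Y t \<omega> - Y s \<omega>) powr b) = m1 t - e 0 t"
      proof -
        have "e 0 t = expectation (\<lambda>\<omega>. Y t \<omega> powr b - (Y t \<omega> - Y s \<omega>) powr b)"
          unfolding e_def
        proof (rule integral_cong_AE)
          \<comment> \<open>\<open>0 powr 0 = 0\<close> is harmless: the other factor vanishes where \<open>Y s \<omega> = 0\<close>.\<close>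
          show "AE \<omega> in M. Y s \<omega> powr 0 * (Y t \<omega> powr b - (Y t \<omega> - Y s \<omega>) powr b) = Y t \<omega> powr b - (Y t \<omega> - Y s \<omega>) powr b"
            by (intro AE_I2) (simp add: powr_def)
        qed (use clock_measurable[OF s0] clock_measurable[OF t] in measurable)
        also have "\<dots> = m1 t - expectation (\<lambda>\<omega>. (Y t \<omega> - Y s \<omega>) powr b)"
          using int1[OF t] inc(1) by (simp add: m1_def)
        finally show ?thesis by simp
      qed
      have eb: "expectation (\<lambda>\<omega>. Y s \<omega> powr b * Y t \<omega> powr b)
          = e b t + expectation (\<lambda>\<omega>. Y s \<omega> powr b * (Y t \<omega> - Y s \<omega>) powr b)"
        unfolding e_def using inc(2,3) by (simp add: right_diff_distrib)
      define P where "P = expectation (\<lambda>\<omega>. Q s \<omega> * Q t \<omega>)"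
      have intP: "integrable M (\<lambda>\<omega>. Q s \<omega> * Q t \<omega>)"
      proof (rule Bochner_Integration.integrable_bound)
        show "integrable M (\<lambda>\<omega>. (Q s \<omega>)\<^sup>2 + (Q t \<omega>)\<^sup>2)"
          using Q_sq_int[OF s0] Q_sq_int[OF t] by simp
        show "(\<lambda>\<omega>. Q s \<omega> * Q t \<omega>) \<in> borel_measurable M"
          using Q_meas[OF s0] Q_meas[OF t] by measurable
        show "AE \<omega> in M. norm (Q s \<omega> * Q t \<omega>) \<le> norm ((Q s \<omega>)\<^sup>2 + (Q t \<omega>)\<^sup>2)"
        proof (rule AE_I2)
          fix \<omega>
          have "2 * (\<bar>Q s \<omega>\<bar> * \<bar>Q t \<omega>\<bar>) \<le> (Q s \<omega>)\<^sup>2 + (Q t \<omega>)\<^sup>2"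
            using sum_squares_bound[of "\<bar>Q s \<omega>\<bar>" "\<bar>Q t \<omega>\<bar>"] by (simp add: mult.assoc)
          moreover have "0 \<le> \<bar>Q s \<omega>\<bar> * \<bar>Q t \<omega>\<bar>" by simp
          ultimately show "norm (Q s \<omega> * Q t \<omega>) \<le> norm ((Q s \<omega>)\<^sup>2 + (Q t \<omega>)\<^sup>2)"
            by (simp only: real_norm_def abs_mult)
        qed
      qed
      have QQ_nonneg: "AE \<omega> in M. 0 \<le> Q s \<omega> * Q t \<omega>"
        using Q_nonneg[OF s0] Q_nonneg[OF t] by eventually_elim simp
      have QQ_mult: "AE \<omega> in M. ennreal (Q s \<omega> * Q t \<omega>) = ennreal (Q s \<omega>) * ennreal (Q t \<omega>)"
        using Q_nonneg[OF s0] Q_nonneg[OF t] by eventually_elim (rule ennreal_mult)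
      have P_nonneg: "P \<ge> 0"
        unfolding P_def by (rule integral_nonneg_AE[OF QQ_nonneg])
      have P_nn: "ennreal P = (\<integral>\<^sup>+\<omega>'. \<integral>\<^sup>+\<omega>. ennreal (F (Y s \<omega>') \<omega>) * ennreal (F (Y t \<omega>') \<omega>) \<partial>M \<partial>M)"
      proof -
        have "ennreal P = (\<integral>\<^sup>+\<omega>. ennreal (Q s \<omega> * Q t \<omega>) \<partial>M)"
          unfolding P_def by (rule nn_integral_eq_integral[OF intP QQ_nonneg, symmetric])
        also have "\<dots> = (\<integral>\<^sup>+\<omega>. ennreal (Q s \<omega>) * ennreal (Q t \<omega>) \<partial>M)"
          by (rule nn_integral_cong_AE[OF QQ_mult])
        finally show ?thesis unfolding Q_prod[OF s0 t] .
      qed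
      have P_le: "P \<le> q * m1 s + q\<^sup>2 * (expectation (\<lambda>\<omega>. Y s \<omega> powr b * Y t \<omega> powr b) + \<kappa> * m2 s)"
      proof -
        have "ennreal P \<le> (\<integral>\<^sup>+\<omega>. ennreal (q * Y s \<omega> powr b + q\<^sup>2 * (Y s \<omega> powr b * Y t \<omega> powr b + \<kappa> * Y s \<omega> powr (2 * b))) \<partial>M)"
          unfolding P_nn using Y by (intro nn_integral_mono F_le) auto
        also have "\<dots> = ennreal (expectation (\<lambda>\<omega>. q * Y s \<omega> powr b + q\<^sup>2 * (Y s \<omega> powr b * Y t \<omega> powr b + \<kappa> * Y s \<omega> powr (2 * b))))"
          using int1[OF s0] int2[OF s0] inc(3) q \<kappa> by (intro nn_integral_eq_integral) auto
        finally have "P \<le> expectation (\<lambda>\<omega>. q * Y s \<omega> powr b + q\<^sup>2 * (Y s \<omega> powr b * Y t \<omega> powr b + \<kappa> * Y s \<omega> powr (2 * b)))"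
          using q \<kappa> by (subst (asm) ennreal_le_iff) (auto intro!: integral_nonneg_AE)
        then show ?thesis
          using int1[OF s0] int2[OF s0] inc(3) by (simp add: m1_def m2_def)
      qed
      have P_ge: "P \<ge> q * m1 s + q\<^sup>2 * (expectation (\<lambda>\<omega>. Y s \<omega> powr b * (Y t \<omega> - Y s \<omega>) powr b) + \<kappa> * m2 s)"
      proof -
        have "ennreal (expectation (\<lambda>\<omega>. q * Y s \<omega> powr b + q\<^sup>2 * (Y s \<omega> powr b * (Y t \<omega> - Y s \<omega>) powr b + \<kappa> * Y s \<omega> powr (2 * b))))
          = (\<integral>\<^sup>+\<omega>. ennreal (q * Y s \<omega> powr b + q\<^sup>2 * (Y s \<omega> powr b * (Y t \<omega> - Y s \<omega>) powr b + \<kappa> * Y s \<omega> powr (2 * b))) \<partial>M)"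
          using int1[OF s0] int2[OF s0] inc(2) q \<kappa> by (intro nn_integral_eq_integral[symmetric]) auto
        also have "\<dots> \<le> ennreal P"
          unfolding P_nn using Y by (intro nn_integral_mono F_ge) auto
        finally have "P \<ge> expectation (\<lambda>\<omega>. q * Y s \<omega> powr b + q\<^sup>2 * (Y s \<omega> powr b * (Y t \<omega> - Y s \<omega>) powr b + \<kappa> * Y s \<omega> powr (2 * b)))"
          using P_nonneg by (subst (asm) ennreal_le_iff) auto
        then show ?thesis
          using int1[OF s0] int2[OF s0] inc(2) by (simp add: m1_def m2_def)
      qed
      have cov: "covariance M (Q s) (Q t) = P - (q * m1 s) * (q * m1 t)"
      proof -
        have "covariance M (Q s) (Q t)
          = expectation (\<lambda>\<omega>. Q s \<omega> * Q t \<omega> - q * m1 t * Q s \<omega> - q * m1 s * Q t \<omega> + (q * m1 s) * (q * m1 t))"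
          unfolding covariance_def Q_mean[OF s0] Q_mean[OF t]
          by (intro Bochner_Integration.integral_cong refl) (simp add: algebra_simps)
        also have "\<dots> = P - q * m1 t * (q * m1 s) - q * m1 s * (q * m1 t) + (q * m1 s) * (q * m1 t)"
          using intP Q_int[OF s0] Q_int[OF t] by (simp add: P_def Q_mean[OF s0] Q_mean[OF t] prob_space)
        finally show ?thesis by (simp add: algebra_simps)
      qed
      show ?thesis
        using P_le P_ge unfolding cov eb inc(4) e0 m1_def[symmetric]
        by (simp add: power2_eq_square algebra_simps)
    qed
    have lim0: "(e 0 \<longlongrightarrow> 0) at_top" and limb: "(e b \<longlongrightarrow> 0) at_top"
      unfolding e_def by (rule clock_powr_increment_tendsto[OF b s0], simp)+
    have "((\<lambda>t. q * m1 s + q\<^sup>2 * \<kappa> * m2 s - q\<^sup>2 * (m1 s * e 0 t)) \<longlongrightarrow> q * m1 s + q\<^sup>2 * \<kappa> * m2 s - q\<^sup>2 * (m1 s * 0)) at_top"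
      by (intro tendsto_intros lim0)
    moreover have "((\<lambda>t. q * m1 s + q\<^sup>2 * \<kappa> * m2 s + q\<^sup>2 * (e b t - m1 s * e 0 t)) \<longlongrightarrow> q * m1 s + q\<^sup>2 * \<kappa> * m2 s + q\<^sup>2 * (0 - m1 s * 0)) at_top"
      by (intro tendsto_intros lim0 limb)
    ultimately show ?thesis
    proof (rule_tac tendsto_sandwich)
      show "\<forall>\<^sub>F t in at_top. q * m1 s + q\<^sup>2 * \<kappa> * m2 s - q\<^sup>2 * (m1 s * e 0 t) \<le> covariance M (Q s) (Q t)"
        by (rule eventually_mono[OF eventually_ge_at_top[of s]]) (use bounds in blast)
      show "\<forall>\<^sub>F t in at_top. covariance M (Q s) (Q t) \<le> q * m1 s + q\<^sup>2 * \<kappa> * m2 s + q\<^sup>2 * (e b t - m1 s * e 0 t)"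
        by (rule eventually_mono[OF eventually_ge_at_top[of s]]) (use bounds in blast)
    qed simp_all
  qed
  show ?thesis
    unfolding long_range_dependent_def Q_def[symmetric]
  proof (rule exI[of _ b], intro conjI allI impI b)
    fix s :: real assume s: "s > 0"
    let ?L = "q * m1 s + q\<^sup>2 * \<kappa> * m2 s" and ?V = "q\<^sup>2 * c powr (2 * b) * (2 * \<kappa> - 1)"
    have L: "?L > 0" using m1_pos[OF s] m2_nonneg[of s] q \<kappa> by (simp add: add_pos_nonneg)
    have V: "?V > 0" using q \<kappa> c_pos by simp
    \<comment> \<open>Division by \<open>t powr (- b)\<close> moves under the root of the variance
      as \<open>t powr (2 * b)\<close>. The decay exponent \<open>b\<close> is thus half the growth
      exponent of the variance, and \<open>k\<close> is the limit of the covariance over the two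
      limiting standard deviations.\<close>
    have "((\<lambda>t. covariance M (Q s) (Q t) / (sqrt (variance (Q s)) * sqrt (variance (Q t) / t powr (2 * b))))
      \<longlongrightarrow> ?L / (sqrt (variance (Q s)) * sqrt ?V)) at_top"
      using V var_pos[OF s] by (intro tendsto_intros cov_lim[OF s] var_lim) auto
    then have "((\<lambda>t. correlation M (Q s) (Q t) / t powr (- b)) \<longlongrightarrow> ?L / (sqrt (variance (Q s)) * sqrt ?V)) at_top"
    proof (rule Lim_transform_eventually)
      show "\<forall>\<^sub>F t in at_top. covariance M (Q s) (Q t) / (sqrt (variance (Q s)) * sqrt (variance (Q t) / t powr (2 * b)))
          = correlation M (Q s) (Q t) / t powr (- b)"
        using eventually_gt_at_top[of 0]
      proof eventually_elim
        fix t :: real assume t: "0 < t"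
        have "sqrt (t powr (2 * b)) = t powr b"
          by (rule real_sqrt_unique) (simp_all add: power2_eq_square powr_add[symmetric])
        then show "covariance M (Q s) (Q t) / (sqrt (variance (Q s)) * sqrt (variance (Q t) / t powr (2 * b)))
          = correlation M (Q s) (Q t) / t powr (- b)"
          unfolding correlation_def real_sqrt_mult real_sqrt_divide
          by (simp add: powr_minus divide_inverse)
      qed
    qed
    moreover have "?L / (sqrt (variance (Q s)) * sqrt ?V) > 0"
      using L V var_pos[OF s] by simp
    ultimately show "\<exists>k>0. ((\<lambda>t. correlation M (Q s) (Q t) / t powr (- b)) \<longlongrightarrow> k) at_top" by blast
  qed
qed

end

theorem theorem4p1:
  fixes M :: "'a measure"
    and \<alpha> \<beta> \<mu> lam\<^sub>1 \<beta>\<^sub>1 lam :: real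
    and Q :: "real \<Rightarrow> 'a \<Rightarrow> real"
  assumes "prob_space M"
    and "0 < \<alpha>" "\<alpha> < 1" "0 < \<beta>" "\<beta> < 1"
    and "\<mu> > 0" "lam\<^sub>1 > 0" "\<beta>\<^sub>1 > 0" "lam > 0"
    and "tstfnbp M \<alpha> \<beta> \<beta>\<^sub>1 lam\<^sub>1 \<mu> lam Q"
  shows "long_range_dependent M Q"
proof -
  interpret prob_space M by fact
  obtain F Y where F: "fractional_poisson_process M \<beta> lam F"
    and Y: "tempered_mittag_leffler_process M \<alpha> \<beta>\<^sub>1 lam\<^sub>1 \<mu> Y"
    and ind: "indep_processes M F Y" and Q: "Q = time_change F Y"
    using assms(10) unfolding tstfnbp_def by blast
  obtain c w where "linear_clock M Y c w"
    using tempered_mittag_leffler_clock[OF Y assms(6-8)] .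
  then interpret linear_clock M Y c w .
  show ?thesis
  proof (rule fractional_poisson_moments[OF F assms(4,5,9)])
    fix q \<kappa> :: real
    assume *: "q > 0" "\<kappa> > 1/2" "right_cont_process M F"
      "\<And>t. t \<ge> 0 \<Longrightarrow> AE \<omega> in M. F t \<omega> \<ge> 0"
      "\<And>t. t \<ge> 0 \<Longrightarrow> (\<integral>\<^sup>+\<omega>. ennreal (F t \<omega>) \<partial>M) = ennreal (q * t powr \<beta>)"
      "\<And>t. t \<ge> 0 \<Longrightarrow> (\<integral>\<^sup>+\<omega>. ennreal (F t \<omega>) * ennreal (F t \<omega>) \<partial>M)
        = ennreal (q * t powr \<beta> + 2 * q\<^sup>2 * \<kappa> * t powr (2 * \<beta>))"
      "\<And>s t. 0 \<le> s \<Longrightarrow> s \<le> t \<Longrightarrow> (\<integral>\<^sup>+\<omega>. ennreal (F s \<omega>) * ennreal (F t \<omega>) \<partial>M)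
        \<le> ennreal (q * s powr \<beta> + q\<^sup>2 * (s powr \<beta> * t powr \<beta> + \<kappa> * s powr (2 * \<beta>)))"
      "\<And>s t. 0 \<le> s \<Longrightarrow> s \<le> t \<Longrightarrow> (\<integral>\<^sup>+\<omega>. ennreal (F s \<omega>) * ennreal (F t \<omega>) \<partial>M)
        \<ge> ennreal (q * s powr \<beta> + q\<^sup>2 * (s powr \<beta> * (t - s) powr \<beta> + \<kappa> * s powr (2 * \<beta>)))"
    show ?thesis
      unfolding Q
      by (rule time_change_long_range_dependent[OF assms(4,5) *(1-3) ind *(4-8)])
  qed
qed

end
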